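(* Let $n\ge1$ and let $\sigma_{\min}$ denote the smallest singular value of a $\mathrm{GUE}_n$ matrix. Then for all $s\ge0$, $$\mathrm P(\sigma_{\min}\ge s)=\frac{F\big(-\frac12,\lceil\frac n2\rceil,\frac{s^2}2\big)}{F\big(-\frac12,\lceil\frac n2\rceil,0\big)}\times\frac{F\big(+\frac12,\lfloor\frac n2\rfloor,\frac{s^2}2\big)}{F\big(+\frac12,\lfloor\frac n2\rfloor,0\big)},$$ where $F(a,m,t)=\det\big(\Gamma(i+j-1+a,t)\big)_{1\le i,j\le m}$.
   Context: $\mathrm{GUE}_n$ is the law of $\frac12(G+G^{\mathrm H})$, where $G$ is an $n\times n$ matrix whose entries have real and imaginary parts that are all independent standard normal, and $G^{\mathrm H}$ is the conjugate transpose. (So diagonal entries are standard normal, and the real and imaginary parts of entries above the diagonal are independent normals of mean $0$ and variance $\frac12$.) $\Gamma(u,t)=\int_t^\infty y^{u-1}e^{-y}\,dy$ is the upper incomplete gamma function. The determinant of an empty ($m=0$) matrix is $1$. *)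

theory Defs
  imports "HOL-Probability.Probability" "Jordan_Normal_Form.Schur_Decomposition"
begin

text \<open>Matrices have type \<^typ>\<open>complex mat\<close>, whose entries are indexed from 0. This type carries no
  topology, so the Borel sigma-algebra on the n by n matrices is pulled back along the entries.\<close>

definition mat_borel :: "nat \<Rightarrow> complex mat measure" where
  "mat_borel n = vimage_algebra (carrier_mat n n)
     (\<lambda>A. \<lambda>ij\<in>{..<n} \<times> {..<n}. A $$ ij) (\<Pi>\<^sub>M ij\<in>{..<n} \<times> {..<n}. borel)"

text \<open>The sample space of the real parts (\<^term>\<open>False\<close>) and imaginary parts (\<^term>\<open>True\<close>) of the
  entries of G, all independent standard normal.\<close>

definition gauss_parts :: "nat \<Rightarrow> ((nat \<times> nat) \<times> bool \<Rightarrow> real) measure" where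
  "gauss_parts n = (\<Pi>\<^sub>M k\<in>({..<n} \<times> {..<n}) \<times> UNIV. density lborel (\<lambda>x. ennreal (std_normal_density x)))"

definition gauss_mat :: "nat \<Rightarrow> ((nat \<times> nat) \<times> bool \<Rightarrow> real) \<Rightarrow> complex mat" where
  "gauss_mat n g = mat n n (\<lambda>ij. Complex (g (ij, False)) (g (ij, True)))"

definition GUE :: "nat \<Rightarrow> complex mat measure" where
  "GUE n = distr (gauss_parts n) (mat_borel n)
     (\<lambda>g. (1 / 2) \<cdot>\<^sub>m (gauss_mat n g + mat_adjoint (gauss_mat n g)))"

text \<open>Singular values without multiplicity, for square matrices.\<close>

definition singular_values :: "complex mat \<Rightarrow> real set" where
  "singular_values A = {\<sigma>. 0 \<le> \<sigma> \<and> eigenvalue (mat_adjoint A * A) (complex_of_real (\<sigma>\<^sup>2))}"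

definition sigma_min :: "complex mat \<Rightarrow> real" where
  "sigma_min A = Min (singular_values A)"

definition upper_Gamma :: "real \<Rightarrow> real \<Rightarrow> real" where
  "upper_Gamma u t = (LBINT y:{t..}. y powr (u - 1) * exp (- y))"

text \<open>The indices are shifted by one because matrix entries are indexed from 0.\<close>

definition F :: "real \<Rightarrow> nat \<Rightarrow> real \<Rightarrow> real" where
  "F a m t = Determinant.det (mat m m (\<lambda>(i, j). upper_Gamma (real (Suc i) + real (Suc j) - 1 + a) t))"

lemma prob_space_gauss_parts: "prob_space (gauss_parts n)"
  unfolding gauss_parts_def
  by (intro prob_space_PiM prob_space_normal_density) simp

lemma GUE_map_measurable:
  "(\<lambda>g. (1 / 2) \<cdot>\<^sub>m (gauss_mat n g + mat_adjoint (gauss_mat n g)))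
     \<in> gauss_parts n \<rightarrow>\<^sub>M mat_borel n"
proof -
  have adj: "mat_adjoint (gauss_mat n g) $$ (i, j) = cnj (gauss_mat n g $$ (j, i))"
    if "i < n" "j < n" for g i j
    using that by (simp add: mat_adjoint_def mat_of_rows_def gauss_mat_def)
  have c: "gauss_mat n g \<in> carrier_mat n n" "mat_adjoint (gauss_mat n g) \<in> carrier_mat n n" for g
    by (auto simp: mat_adjoint_def gauss_mat_def)
  have m: "(\<lambda>g. Complex (g ((i, j), False)) (g ((i, j), True))) \<in> borel_measurable (gauss_parts n)"
    if "i < n" "j < n" for i j
  proof -
    have "(\<lambda>g. g ((i, j), b)) \<in> borel_measurable (gauss_parts n)" for b
      using measurable_component_singleton[of "((i, j), b)" "({..<n} \<times> {..<n}) \<times> UNIV"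
          "\<lambda>_. density lborel (\<lambda>x. ennreal (std_normal_density x))"] that
      unfolding gauss_parts_def by (simp cong: measurable_cong_sets)
    then show ?thesis
      by (simp add: Complex_eq)
  qed
  have mc: "(\<lambda>g. cnj (Complex (g ((i, j), False)) (g ((i, j), True)))) \<in> borel_measurable (gauss_parts n)"
    if "i < n" "j < n" for i j
    by (rule measurable_compose[OF m[OF that]])
      (intro borel_measurable_continuous_onI continuous_intros)
  show ?thesis
    unfolding mat_borel_def
  proof (rule measurable_vimage_algebra2)
    show "(\<lambda>g. (1 / 2) \<cdot>\<^sub>m (gauss_mat n g + mat_adjoint (gauss_mat n g)))
        \<in> space (gauss_parts n) \<rightarrow> carrier_mat n n"
      using c by auto
    show "(\<lambda>g. \<lambda>ij\<in>{..<n} \<times> {..<n}.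
        ((1 / 2) \<cdot>\<^sub>m (gauss_mat n g + mat_adjoint (gauss_mat n g))) $$ ij)
        \<in> gauss_parts n \<rightarrow>\<^sub>M (\<Pi>\<^sub>M ij\<in>{..<n} \<times> {..<n}. borel)"
    proof (rule measurable_restrict)
      fix ij assume "ij \<in> {..<n} \<times> {..<n}"
      then obtain i j where ij: "ij = (i, j)" "i < n" "j < n" by auto
      have "((1 / 2) \<cdot>\<^sub>m (gauss_mat n g + mat_adjoint (gauss_mat n g))) $$ ij =
          (1 / 2) * (Complex (g ((i, j), False)) (g ((i, j), True))
            + cnj (Complex (g ((j, i), False)) (g ((j, i), True))))" for g
        using ij c[of g] adj[of i j g] by (auto simp: gauss_mat_def)
      then show "(\<lambda>g. ((1 / 2) \<cdot>\<^sub>m (gauss_mat n g + mat_adjoint (gauss_mat n g))) $$ ij)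
          \<in> borel_measurable (gauss_parts n)"
        by (simp only:)
          (intro borel_measurable_times borel_measurable_add borel_measurable_const m mc ij(2,3))
    qed
  qed
qed

lemma prob_space_GUE: "prob_space (GUE n)"
  unfolding GUE_def
  by (rule prob_space.prob_space_distr[OF prob_space_gauss_parts GUE_map_measurable])

end

theory Submission
  imports Defs
begin

text \<open>
  Bordering a Hermitian matrix of size n with known eigenvalues by a Gaussian vector v and a
  Gaussian corner d gives a matrix whose eigenvalues are the zeros of a secular equation.  The map
  from the squared moduli of the entries of v together with d to the coefficients of the
  characteristic polynomial is triangular up to a Vandermonde factor, and the map from coefficients
  to roots has the Vandermonde determinant as Jacobian.  Integrating out the interlacing eigenvalues of
  the minor yields, by induction on n, the eigenvalue density proportional to the squared Vandermonde
  determinant times the Gaussian weight.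

  Andreief's identity then expresses the probability through the Hankel determinant of the moments
  of the Gaussian weight restricted to \<open>\<bar>x\<bar> \<ge> s\<close>.  The odd moments vanish,
  so the Hankel matrix splits into its even and odd block, and the substitution \<open>y = x\<^sup>2 / 2\<close> turns
  the even moments into incomplete gamma values.
\<close>

subsection \<open>Integration over products of Lebesgue measure\<close>

text \<open>No Jacobian of a map in several variables is ever differentiated. Each change of
  variables is cut into triangular affine maps and into steps that alter one coordinate while the
  others are fixed; Tonelli's theorem joins the steps. Nearly all integrals take values in the
  nonnegative extended reals, so no integrability is tracked on the way.

  The statement that passes through the induction concerns integrals of unitarily invariant
  functions, not the eigenvalues as a random vector. The average of such a function over the border
  is again unitarily invariant as a function of the minor, so the induction hypothesis applies to
  this average and the minor may be taken real diagonal.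

  Constants that depend on n only are carried along symbolically. They are fixed at the very end by
  the case s = 0, where the event has probability one; this is where the denominators with argument
  0 come from.\<close>

abbreviation lebn :: "nat \<Rightarrow> (nat \<Rightarrow> 'a :: euclidean_space) measure" where
  "lebn k \<equiv> \<Pi>\<^sub>M i\<in>{..<k}. lborel"

lemma sigma_finite_lebn: "sigma_finite_measure (lebn k)"
proof -
  interpret product_sigma_finite "\<lambda>_::nat. lborel :: 'a measure" ..
  show ?thesis by (rule sigma_finite) simp
qed

lemma nn_integral_swap:
  assumes "sigma_finite_measure M" "sigma_finite_measure N"
    and "case_prod f \<in> borel_measurable (M \<Otimes>\<^sub>M N)"
  shows "(\<integral>\<^sup>+ x. (\<integral>\<^sup>+ y. f x y \<partial>N) \<partial>M) = (\<integral>\<^sup>+ y. (\<integral>\<^sup>+ x. f x y \<partial>M) \<partial>N)"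
  using pair_sigma_finite.Fubini'[OF pair_sigma_finite.intro[OF assms(1,2)] assms(3)] by simp

lemma measurable_nn_integral:
  assumes "sigma_finite_measure N" "case_prod f \<in> borel_measurable (M \<Otimes>\<^sub>M N)"
  shows "(\<lambda>x. \<integral>\<^sup>+ y. f x y \<partial>N) \<in> borel_measurable M"
  using sigma_finite_measure.borel_measurable_nn_integral_fst[OF assms] by simp

lemma measurable_lebn_upd [measurable (raw)]:
  assumes "f \<in> N \<rightarrow>\<^sub>M lebn k" "g \<in> N \<rightarrow>\<^sub>M borel"
  shows "(\<lambda>x. (f x)(k := g x)) \<in> N \<rightarrow>\<^sub>M lebn (Suc k)"
  using assms by (intro measurable_fun_upd[where J="{..<k}"]) auto

lemma measurable_lebn_component:
  "f \<in> N \<rightarrow>\<^sub>M lebn k \<Longrightarrow> i < k \<Longrightarrow> (\<lambda>x. f x i) \<in> N \<rightarrow>\<^sub>M borel"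
  using measurable_compose[of f N "lebn k" "\<lambda>x. x i" lborel]
    measurable_component_singleton[of i "{..<k}" "\<lambda>_. lborel"] by simp

lemma measurable_lebnI [measurable (raw)]:
  assumes "\<And>i. i < k \<Longrightarrow> f i \<in> N \<rightarrow>\<^sub>M borel"
  shows "(\<lambda>x. \<lambda>i\<in>{..<k}. f i x) \<in> N \<rightarrow>\<^sub>M lebn k"
  using assms by (intro measurable_restrict) auto

lemma space_lebn: "x \<in> space (lebn k) \<longleftrightarrow> x \<in> extensional {..<k}"
  by (simp add: space_PiM PiE_def)

lemma nn_integral_lebn_Suc:
  assumes "f \<in> borel_measurable (lebn (Suc k))"
  shows "(\<integral>\<^sup>+ x. f x \<partial>lebn (Suc k)) = (\<integral>\<^sup>+ x. (\<integral>\<^sup>+ y. f (x(k := y)) \<partial>lborel) \<partial>lebn k)"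
proof -
  interpret product_sigma_finite "\<lambda>_::nat. lborel :: 'a measure" ..
  show ?thesis
    using product_nn_integral_insert[of "{..<k}" k f] assms by (simp add: lessThan_Suc)
qed

lemma nn_integral_lebn_Suc_rev:
  assumes "f \<in> borel_measurable (lebn (Suc k))"
  shows "(\<integral>\<^sup>+ x. f x \<partial>lebn (Suc k)) = (\<integral>\<^sup>+ y. (\<integral>\<^sup>+ x. f (x(k := y)) \<partial>lebn k) \<partial>lborel)"
proof -
  interpret product_sigma_finite "\<lambda>_::nat. lborel :: 'a measure" ..
  show ?thesis
    using product_nn_integral_insert_rev[of "{..<k}" k f] assms by (simp add: lessThan_Suc)
qed

lemma nn_integral_lebn_0: "(\<integral>\<^sup>+ x. f x \<partial>lebn 0) = f (\<lambda>_. undefined)"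
  by (simp add: PiM_empty nn_integral_count_space_finite)

text \<open>The Jacobian of a triangular map is the product of its diagonal entries. The last
  coordinate is shifted by a function of the earlier ones only, so with those fixed its integral is
  a one-variable affine substitution, and the map on the remaining coordinates has the same shape.
  The Jacobian stands as a factor on the left so that nothing is divided in
  \<open>ennreal\<close>.\<close>

lemma nn_integral_lower_triangular:
  fixes a :: "nat \<Rightarrow> real" and b :: "nat \<Rightarrow> (nat \<Rightarrow> real) \<Rightarrow> real" and \<Phi> :: "(nat \<Rightarrow> real) \<Rightarrow> ennreal"
  assumes "\<And>i. i < k \<Longrightarrow> a i \<noteq> 0"
    and "\<And>i. i < k \<Longrightarrow> b i \<in> borel_measurable (lebn i)"
    and "\<Phi> \<in> borel_measurable (lebn k)"
  shows "(\<Prod>i<k. ennreal \<bar>a i\<bar>) *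
      (\<integral>\<^sup>+ x. \<Phi> (\<lambda>i\<in>{..<k}. a i * x i + b i (restrict x {..<i})) \<partial>lebn k) = (\<integral>\<^sup>+ x. \<Phi> x \<partial>lebn k)"
  using assms
proof (induction k arbitrary: \<Phi>)
  case 0
  show ?case by (simp add: PiM_empty nn_integral_count_space_finite restrict_def)
next
  case (Suc k)
  note [measurable] = Suc.prems(3)
  have [measurable]: "b i \<in> borel_measurable (lebn i)" if "i < Suc k" for i
    using Suc.prems(2) that by simp
  define T where "T x = (\<lambda>i\<in>{..<k}. a i * x i + b i (restrict x {..<i}))" for x
  have [measurable]: "T \<in> lebn k \<rightarrow>\<^sub>M lebn k"
    unfolding T_def by measurable
  have res: "(\<lambda>x. restrict x {..<i}) \<in> lebn (Suc k) \<rightarrow>\<^sub>M lebn i" if "i < Suc k" for i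
    using that by (intro measurable_restrict_subset) auto
  have [measurable]: "(\<lambda>x. b i (restrict x {..<i})) \<in> borel_measurable (lebn (Suc k))" if "i < Suc k" for i
    using that res[OF that] by measurable
  define \<Psi> where "\<Psi> x = \<Phi> (\<lambda>i\<in>{..<Suc k}. a i * x i + b i (restrict x {..<i}))" for x
  have \<Psi> [measurable]: "\<Psi> \<in> borel_measurable (lebn (Suc k))"
    unfolding \<Psi>_def by measurable
  have upd [measurable]: "(\<lambda>(x, y). x(k := y)) \<in> lebn k \<Otimes>\<^sub>M lborel \<rightarrow>\<^sub>M lebn (Suc k)"
    by measurable
  have [measurable]: "(\<lambda>x. \<integral>\<^sup>+ y. \<Psi> (x(k := y)) \<partial>lborel) \<in> borel_measurable (lebn k)"
    "(\<lambda>x. \<integral>\<^sup>+ y. \<Phi> (x(k := y)) \<partial>lborel) \<in> borel_measurable (lebn k)"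
    by measurable
  have inner: "ennreal \<bar>a k\<bar> * (\<integral>\<^sup>+ y. \<Phi> (\<lambda>i\<in>{..<Suc k}. a i * (x(k := y)) i + b i (restrict (x(k := y)) {..<i})) \<partial>lborel)
      = (\<integral>\<^sup>+ y. \<Phi> ((T x)(k := y)) \<partial>lborel)" if x: "x \<in> space (lebn k)" for x
  proof -
    have "(\<lambda>i\<in>{..<Suc k}. a i * (x(k := y)) i + b i (restrict (x(k := y)) {..<i}))
       = (T x)(k := b k x + a k * y)" for y
    proof
      fix i
      have "restrict (x(k := y)) {..<i} = restrict x {..<i}" if "i \<le> k"
        using that by (auto simp: restrict_def)
      moreover have "restrict x {..<k} = x"
        using x by (simp add: space_lebn extensional_restrict)
      ultimately show "(\<lambda>i\<in>{..<Suc k}. a i * (x(k := y)) i + b i (restrict (x(k := y)) {..<i})) i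
         = ((T x)(k := b k x + a k * y)) i"
        by (auto simp: T_def)
    qed
    moreover have [measurable]: "(\<lambda>y. \<Phi> ((T x)(k := y))) \<in> borel_measurable borel"
      using x by measurable
    ultimately show ?thesis
      using Suc.prems(1)[of k] nn_integral_real_affine[of "\<lambda>y. \<Phi> ((T x)(k := y))" "a k" "b k x"] by simp
  qed
  have "(\<Prod>i<Suc k. ennreal \<bar>a i\<bar>) * (\<integral>\<^sup>+ x. \<Psi> x \<partial>lebn (Suc k))
     = (\<Prod>i<k. ennreal \<bar>a i\<bar>) * (\<integral>\<^sup>+ x. ennreal \<bar>a k\<bar> * (\<integral>\<^sup>+ y. \<Psi> (x(k := y)) \<partial>lborel) \<partial>lebn k)"
    by (simp add: nn_integral_lebn_Suc[OF \<Psi>] nn_integral_cmult mult_ac del: fun_upd_apply)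
  also have "\<dots> = (\<Prod>i<k. ennreal \<bar>a i\<bar>) * (\<integral>\<^sup>+ x. (\<integral>\<^sup>+ y. \<Phi> ((T x)(k := y)) \<partial>lborel) \<partial>lebn k)"
    using inner by (simp add: \<Psi>_def cong: nn_integral_cong)
  also have "\<dots> = (\<integral>\<^sup>+ x. (\<integral>\<^sup>+ y. \<Phi> (x(k := y)) \<partial>lborel) \<partial>lebn k)"
    unfolding T_def by (rule Suc.IH) (use Suc.prems in \<open>auto simp del: fun_upd_apply\<close>)
  also have "\<dots> = (\<integral>\<^sup>+ x. \<Phi> x \<partial>lebn (Suc k))"
    by (rule nn_integral_lebn_Suc[symmetric]) fact
  finally show ?case unfolding \<Psi>_def .
qed

text \<open>The hypothesis \<open>eq\<close> says in integral form that each \<open>T i\<close>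
  carries \<open>M\<close> to \<open>N\<close>. The product measures then correspond as well, since
  the coordinates can be exchanged one at a time.\<close>

lemma nn_integral_PiM_map:
  fixes M :: "'a measure" and N :: "'b measure" and T :: "nat \<Rightarrow> 'a \<Rightarrow> 'b"
  assumes "sigma_finite_measure M" "sigma_finite_measure N"
    and T: "\<And>i. i < k \<Longrightarrow> T i \<in> M \<rightarrow>\<^sub>M N"
    and eq: "\<And>i \<phi>. i < k \<Longrightarrow> \<phi> \<in> borel_measurable N \<Longrightarrow> (\<integral>\<^sup>+ x. \<phi> (T i x) \<partial>M) = (\<integral>\<^sup>+ x. \<phi> x \<partial>N)"
    and "\<Phi> \<in> borel_measurable (\<Pi>\<^sub>M i\<in>{..<k}. N)"
  shows "(\<integral>\<^sup>+ x. \<Phi> (\<lambda>i\<in>{..<k}. T i (x i)) \<partial>(\<Pi>\<^sub>M i\<in>{..<k}. M)) = (\<integral>\<^sup>+ x. \<Phi> x \<partial>(\<Pi>\<^sub>M i\<in>{..<k}. N))"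
  using T eq assms(5)
proof (induction k arbitrary: \<Phi>)
  case 0
  show ?case by (simp add: PiM_empty nn_integral_count_space_finite restrict_def)
next
  case (Suc k)
  interpret M: sigma_finite_measure M by fact
  interpret N: sigma_finite_measure N by fact
  interpret PM: product_sigma_finite "\<lambda>_::nat. M" ..
  interpret PN: product_sigma_finite "\<lambda>_::nat. N" ..
  note [measurable] = Suc.prems(3)
  have [measurable]: "T i \<in> M \<rightarrow>\<^sub>M N" if "i < Suc k" for i using that Suc.prems(1) by simp
  have [measurable]: "(\<lambda>x. x i) \<in> (\<Pi>\<^sub>M i\<in>{..<Suc k}. M) \<rightarrow>\<^sub>M M" if "i < Suc k" for i
    using that by (intro measurable_component_singleton) simp
  have [measurable]: "(\<lambda>x. x i) \<in> (\<Pi>\<^sub>M i\<in>{..<k}. M) \<rightarrow>\<^sub>M M" if "i < k" for i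
    using that by (intro measurable_component_singleton) simp
  define R where "R x = (\<lambda>i\<in>{..<k}. T i (x i))" for x
  have [measurable]: "R \<in> (\<Pi>\<^sub>M i\<in>{..<k}. M) \<rightarrow>\<^sub>M (\<Pi>\<^sub>M i\<in>{..<k}. N)"
    unfolding R_def by (intro measurable_restrict) simp
  have \<Phi>: "(\<lambda>x. \<Phi> (\<lambda>i\<in>{..<Suc k}. T i (x i))) \<in> borel_measurable (\<Pi>\<^sub>M i\<in>insert k {..<k}. M)"
    unfolding lessThan_Suc[symmetric]
    by (intro measurable_compose[OF _ Suc.prems(3)] measurable_restrict) simp
  have upd: "(\<lambda>(x, y). x(k := y)) \<in> (\<Pi>\<^sub>M i\<in>{..<k}. N) \<Otimes>\<^sub>M N \<rightarrow>\<^sub>M (\<Pi>\<^sub>M i\<in>{..<Suc k}. N)"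
    by (simp add: split_beta', intro measurable_fun_upd[where J="{..<k}"]) auto
  have [measurable]: "(\<lambda>(x, y). \<Phi> (x(k := y))) \<in> borel_measurable ((\<Pi>\<^sub>M i\<in>{..<k}. N) \<Otimes>\<^sub>M N)"
    using measurable_compose[OF upd Suc.prems(3)] by (simp add: split_beta' del: fun_upd_apply)
  have split: "(\<lambda>i\<in>{..<Suc k}. T i ((x(k := y)) i)) = (R x)(k := T k y)" for x y
    by (auto simp: R_def restrict_def)
  have "(\<integral>\<^sup>+ x. \<Phi> (\<lambda>i\<in>{..<Suc k}. T i (x i)) \<partial>(\<Pi>\<^sub>M i\<in>{..<Suc k}. M))
     = (\<integral>\<^sup>+ x. (\<integral>\<^sup>+ y. \<Phi> ((R x)(k := T k y)) \<partial>M) \<partial>(\<Pi>\<^sub>M i\<in>{..<k}. M))"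
    unfolding lessThan_Suc[of k, THEN arg_cong[of _ _ "\<lambda>I. \<Pi>\<^sub>M i\<in>I. M"]]
    by (subst PM.product_nn_integral_insert[OF _ _ \<Phi>]) (simp_all only: split, simp_all)
  also have "\<dots> = (\<integral>\<^sup>+ x. (\<integral>\<^sup>+ y. \<Phi> ((R x)(k := y)) \<partial>N) \<partial>(\<Pi>\<^sub>M i\<in>{..<k}. M))"
  proof (intro nn_integral_cong Suc.prems(2))
    fix x assume x: "x \<in> space (\<Pi>\<^sub>M i\<in>{..<k}. M)"
    have "R \<in> (\<Pi>\<^sub>M i\<in>{..<k}. M) \<rightarrow>\<^sub>M (\<Pi>\<^sub>M i\<in>{..<k}. N)" by measurable
    from measurable_space[OF this x] have "R x \<in> space (\<Pi>\<^sub>M i\<in>{..<k}. N)" .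
    then show "(\<lambda>y. \<Phi> ((R x)(k := y))) \<in> borel_measurable N" by measurable
  qed simp
  also have "\<dots> = (\<integral>\<^sup>+ x. (\<integral>\<^sup>+ y. \<Phi> (x(k := y)) \<partial>N) \<partial>(\<Pi>\<^sub>M i\<in>{..<k}. N))"
    unfolding R_def
  proof (rule Suc.IH)
    show "(\<lambda>x. \<integral>\<^sup>+ y. \<Phi> (x(k := y)) \<partial>N) \<in> borel_measurable (\<Pi>\<^sub>M i\<in>{..<k}. N)" by measurable
  qed (use Suc.prems in auto)
  also have "\<dots> = (\<integral>\<^sup>+ x. \<Phi> x \<partial>(\<Pi>\<^sub>M i\<in>{..<Suc k}. N))"
    using Suc.prems(3) unfolding lessThan_Suc by (subst PN.product_nn_integral_insert) auto
  finally show ?case .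
qed

lemma nn_integral_lborel_translate:
  fixes a :: "'a :: euclidean_space"
  assumes "f \<in> borel_measurable borel"
  shows "(\<integral>\<^sup>+ x. f (x + a) \<partial>lborel) = (\<integral>\<^sup>+ x. f x \<partial>lborel)"
proof -
  have "(\<integral>\<^sup>+ x. f x \<partial>lborel) = (\<integral>\<^sup>+ x. f x \<partial>distr lborel borel ((+) a))"
    by (simp add: lborel_distr_plus)
  also have "\<dots> = (\<integral>\<^sup>+ x. f (a + x) \<partial>lborel)"
    using assms by (subst nn_integral_distr) auto
  finally show ?thesis by (simp add: add.commute)
qed

lemma nn_integral_lborel_reflect:
  fixes f :: "'a :: euclidean_space \<Rightarrow> ennreal"
  assumes [measurable]: "f \<in> borel_measurable borel"
  shows "(\<integral>\<^sup>+ x. f (- x) \<partial>lborel) = (\<integral>\<^sup>+ x. f x \<partial>lborel)"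
proof -
  have "(\<integral>\<^sup>+ x. f x \<partial>lborel) = (\<integral>\<^sup>+ x. f x \<partial>distr lborel borel uminus)"
    using lborel_affine[of "-1" "0 :: 'a"] by (simp add: density_1 fun_Compl_def)
  then show ?thesis by (simp add: nn_integral_distr)
qed

lemma nn_integral_lebn_translate:
  fixes a :: "nat \<Rightarrow> 'a :: euclidean_space"
  assumes "\<Phi> \<in> borel_measurable (lebn k)"
  shows "(\<integral>\<^sup>+ x. \<Phi> (\<lambda>i\<in>{..<k}. x i + a i) \<partial>lebn k) = (\<integral>\<^sup>+ x. \<Phi> x \<partial>lebn k)"
  using assms
  by (intro nn_integral_PiM_map[where T="\<lambda>i x. x + a i"])
     (auto intro!: nn_integral_lborel_translate lborel.sigma_finite_measure_axioms)

text \<open>The disc of radius sqrt w has area pi w, so the squared modulus carries planar Lebesgue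
  measure to pi times Lebesgue measure on the half-line.\<close>

lemma nn_integral_cmod_square:
  assumes [measurable]: "\<phi> \<in> borel_measurable borel"
  shows "(\<integral>\<^sup>+ z. \<phi> ((cmod z)\<^sup>2) \<partial>lborel) = (\<integral>\<^sup>+ w. \<phi> w \<partial>density lborel (\<lambda>w. ennreal pi * indicator {0..} w))"
proof -
  \<comment> \<open>The sign makes all rays {x<..} of finite measure, as the uniqueness criterion
    for measures demands: the preimage of such a ray is a bounded disc or empty.\<close>
  have eq: "distr lborel borel (\<lambda>z. - ((cmod z)\<^sup>2)) = density lborel (\<lambda>w. ennreal pi * indicator {..0} w)"
    (is "?A = ?B")
  proof (rule measure_eqI_lessThan)
    fix x :: real
    have "{z. x < - ((cmod z)\<^sup>2)} = (if x < 0 then ball 0 (sqrt (- x)) else {})"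
    proof (cases "x < 0")
      case True
      then have "x < - ((cmod z)\<^sup>2) \<longleftrightarrow> cmod z < sqrt (- x)" for z
        using real_sqrt_less_iff[of "(cmod z)\<^sup>2" "- x"] by auto
      then have "{z. x < - ((cmod z)\<^sup>2)} = ball 0 (sqrt (- x))"
        by (simp only: set_eq_iff mem_Collect_eq mem_ball_0 simp_thms)
      with True show ?thesis by simp
    next
      case False
      then have "\<not> x < - ((cmod z)\<^sup>2)" for z
        using zero_le_power2[of "cmod z"] by linarith
      with False show ?thesis by auto
    qed
    then have "emeasure ?A {x<..} = emeasure lborel (if x < 0 then ball (0 :: complex) (sqrt (- x)) else {})"
      by (simp add: emeasure_distr vimage_def)
    also have "\<dots> = ennreal pi * ennreal (max 0 (- x))"
    proof (cases "x < 0")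
      case True
      then show ?thesis
        using ennreal_mult'[of pi "- x"] by (simp add: emeasure_ball unit_ball_vol_2)
    qed simp
    finally have A: "emeasure ?A {x<..} = ennreal pi * ennreal (max 0 (- x))" .
    have "emeasure ?B {x<..} = (\<integral>\<^sup>+ w. ennreal pi * indicator {x<..0} w \<partial>lborel)"
      by (subst emeasure_density) (auto intro!: nn_integral_cong simp: indicator_def)
    then have "emeasure ?B {x<..} = ennreal pi * ennreal (max 0 (- x))"
      by (cases "x \<le> 0") (simp_all add: nn_integral_cmult_indicator)
    with A show "emeasure ?A {x<..} = emeasure ?B {x<..}" "emeasure ?A {x<..} < \<infinity>"
      by (simp_all add: ennreal_mult_less_top)
  qed simp_all
  have "(\<integral>\<^sup>+ z. \<phi> ((cmod z)\<^sup>2) \<partial>lborel) = (\<integral>\<^sup>+ w. \<phi> (- w) \<partial>?A)"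
    by (simp add: nn_integral_distr)
  also have "\<dots> = (\<integral>\<^sup>+ w. ennreal pi * indicator {..0} w * \<phi> (- w) \<partial>lborel)"
    unfolding eq by (simp add: nn_integral_density)
  also have "\<dots> = (\<integral>\<^sup>+ w. ennreal pi * indicator {0..} w * \<phi> w \<partial>lborel)"
    using nn_integral_lborel_reflect[of "\<lambda>w. ennreal pi * indicator {..0} w * \<phi> (- w)"]
    by (simp add: indicator_def)
  also have "\<dots> = (\<integral>\<^sup>+ w. \<phi> w \<partial>density lborel (\<lambda>w. ennreal pi * indicator {0..} w))"
    by (simp add: nn_integral_density)
  finally show ?thesis .
qed

subsection \<open>Gaussian integrals\<close>

lemma nn_integral_exp_cmod_square:
  "(\<integral>\<^sup>+ z. ennreal (exp (- (cmod z)\<^sup>2)) \<partial>lborel) = ennreal pi"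
proof -
  have "(\<integral>\<^sup>+ z. ennreal (exp (- (cmod z)\<^sup>2)) \<partial>lborel)
     = (\<integral>\<^sup>+ w. ennreal pi * (ennreal (w ^ 0 * exp (- w)) * indicator {0..} w) \<partial>lborel)"
    using nn_integral_cmod_square[of "\<lambda>w. ennreal (exp (- w))"]
    by (simp add: nn_integral_density mult_ac)
  also have "\<dots> = ennreal pi"
    using nn_intergal_power_times_exp_Ici[of 0] by (subst nn_integral_cmult) (auto simp: mult_ac)
  finally show ?thesis .
qed

text \<open>Uniqueness of translation invariant measures, with the Gaussian \<open>G\<close> as test
  function. The double integral of \<open>G y * f (R x)\<close> is c times the integral of f over R
  x. Translating x by \<open>S y\<close> replaces R x by R x + y; translating y by - R x moves the
  shift into the Gaussian; and G (y - R x) integrates over x to c again, because \<open>R\<close>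
  preserves the norm. The result is c times the integral of f, and c is positive and finite.\<close>

lemma nn_integral_isometry_complex:
  fixes R S :: "(nat \<Rightarrow> complex) \<Rightarrow> nat \<Rightarrow> complex"
  assumes R [measurable]: "R \<in> lebn n \<rightarrow>\<^sub>M lebn n" and S [measurable]: "S \<in> lebn n \<rightarrow>\<^sub>M lebn n"
    and RS: "\<And>x. x \<in> space (lebn n) \<Longrightarrow> R (S x) = x"
    and add: "\<And>x y i. \<lbrakk>x \<in> space (lebn n); y \<in> space (lebn n); i < n\<rbrakk>
        \<Longrightarrow> R (\<lambda>i\<in>{..<n}. x i + y i) i = R x i + R y i"
    and norm: "\<And>x. x \<in> space (lebn n) \<Longrightarrow> (\<Sum>i<n. (cmod (R x i))\<^sup>2) = (\<Sum>i<n. (cmod (x i))\<^sup>2)"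
    and f [measurable]: "f \<in> borel_measurable (lebn n)"
  shows "(\<integral>\<^sup>+ x. f (R x) \<partial>lebn n) = (\<integral>\<^sup>+ x. f x \<partial>lebn n)"
proof -
  interpret product_sigma_finite "\<lambda>_::nat. lborel :: complex measure" ..
  note sf = sigma_finite_lebn
  define G :: "(nat \<Rightarrow> complex) \<Rightarrow> ennreal" where "G x = ennreal (exp (- (\<Sum>i<n. (cmod (x i))\<^sup>2)))" for x
  have [measurable]: "(\<lambda>x. x i) \<in> lebn n \<rightarrow>\<^sub>M (borel :: complex measure)" if "i < n" for i
    using that by (intro measurable_lebn_component[of _ _ n]) simp_all
  have [measurable]: "G \<in> borel_measurable (lebn n)"
    unfolding G_def by measurable
  define c where "c = (\<integral>\<^sup>+ x. G x \<partial>lebn n)"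
  have "c = (\<integral>\<^sup>+ x. (\<Prod>i<n. ennreal (exp (- (cmod (x i))\<^sup>2))) \<partial>lebn n)"
    unfolding c_def G_def by (simp add: prod_ennreal exp_sum sum_negf[symmetric])
  also have "\<dots> = ennreal pi ^ n"
    by (subst product_nn_integral_prod) (simp_all add: nn_integral_exp_cmod_square)
  finally have c: "c \<noteq> 0" "c \<noteq> \<infinity>"
    by (simp_all add: ennreal_power)
  define pl where "pl x y = (\<lambda>i\<in>{..<n}. x i + y i)" for x y :: "nat \<Rightarrow> complex"
  define mi where "mi x y = (\<lambda>i\<in>{..<n}. x i + (- y i))" for x y :: "nat \<Rightarrow> complex"
  have [measurable]: "(\<lambda>z. pl (g z) (h z)) \<in> N \<rightarrow>\<^sub>M lebn n" "(\<lambda>z. mi (g z) (h z)) \<in> N \<rightarrow>\<^sub>M lebn n"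
    if "g \<in> N \<rightarrow>\<^sub>M lebn n" "h \<in> N \<rightarrow>\<^sub>M lebn n" for g h and N :: "'z measure"
  proof -
    have [measurable]: "(\<lambda>z. g z i) \<in> borel_measurable N" "(\<lambda>z. h z i) \<in> borel_measurable N" if "i < n" for i
      using that \<open>g \<in> _\<close> \<open>h \<in> _\<close> by (auto intro: measurable_lebn_component)
    show "(\<lambda>z. pl (g z) (h z)) \<in> N \<rightarrow>\<^sub>M lebn n" "(\<lambda>z. mi (g z) (h z)) \<in> N \<rightarrow>\<^sub>M lebn n"
      unfolding pl_def mi_def by measurable
  qed
  have R_ext: "R x \<in> extensional {..<n}" "S x \<in> space (lebn n)" if "x \<in> space (lebn n)" for x
    using measurable_space[OF R that] measurable_space[OF S that] by (simp_all add: space_lebn)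
  have tr: "(\<integral>\<^sup>+ x. \<Phi> (pl x a) \<partial>lebn n) = (\<integral>\<^sup>+ x. \<Phi> x \<partial>lebn n)"
    if "\<Phi> \<in> borel_measurable (lebn n)" for \<Phi> a
    unfolding pl_def using nn_integral_lebn_translate[OF that] .
  have R_pl: "R (pl x (S y)) = pl (R x) y" if "x \<in> space (lebn n)" "y \<in> space (lebn n)" for x y
  proof
    fix i
    have "R (pl x (S y)) \<in> extensional {..<n}"
      using that R_ext by (auto simp: pl_def space_lebn)
    then show "R (pl x (S y)) i = pl (R x) y i"
      using that R_ext add[of x "S y" i] RS[of y] by (cases "i < n") (auto simp: pl_def extensional_def)
  qed
  \<comment> \<open>Translating x by \<open>S y\<close> turns y - R x into - R x, whose Gaussian
    weight equals that of x.\<close>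
  have shift: "(\<integral>\<^sup>+ x. G (mi y (R x)) \<partial>lebn n) = c" if y: "y \<in> space (lebn n)" for y
  proof -
    have "(\<integral>\<^sup>+ x. G (mi y (R x)) \<partial>lebn n) = (\<integral>\<^sup>+ x. G (mi y (R (pl x (S y)))) \<partial>lebn n)"
      by (rule tr[symmetric]) (use y in measurable)
    also have "\<dots> = c"
      unfolding c_def
    proof (rule nn_integral_cong)
      fix x :: "nat \<Rightarrow> complex" assume x: "x \<in> space (lebn n)"
      have "mi y (R (pl x (S y))) i = - R x i" if "i < n" for i
        using that unfolding R_pl[OF x y] by (simp add: mi_def pl_def)
      then show "G (mi y (R (pl x (S y)))) = G x"
        using norm[OF x] by (simp add: G_def)
    qed
    finally show ?thesis .
  qed
  have "c * (\<integral>\<^sup>+ x. f (R x) \<partial>lebn n) = (\<integral>\<^sup>+ y. (\<integral>\<^sup>+ x. G y * f (R x) \<partial>lebn n) \<partial>lebn n)"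
    unfolding c_def by (simp add: nn_integral_cmult nn_integral_multc)
  also have "\<dots> = (\<integral>\<^sup>+ y. (\<integral>\<^sup>+ x. G y * f (pl (R x) y) \<partial>lebn n) \<partial>lebn n)"
  proof (rule nn_integral_cong)
    fix y :: "nat \<Rightarrow> complex" assume y: "y \<in> space (lebn n)"
    have "(\<integral>\<^sup>+ x. G y * f (R x) \<partial>lebn n) = (\<integral>\<^sup>+ x. G y * f (R (pl x (S y))) \<partial>lebn n)"
      by (rule tr[symmetric]) measurable
    then show "(\<integral>\<^sup>+ x. G y * f (R x) \<partial>lebn n) = (\<integral>\<^sup>+ x. G y * f (pl (R x) y) \<partial>lebn n)"
      by (simp add: R_pl[OF _ y] cong: nn_integral_cong_simp)
  qed
  also have "\<dots> = (\<integral>\<^sup>+ x. (\<integral>\<^sup>+ y. G y * f (pl (R x) y) \<partial>lebn n) \<partial>lebn n)"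
    by (rule nn_integral_swap[OF sf sf]) measurable
  also have "\<dots> = (\<integral>\<^sup>+ x. (\<integral>\<^sup>+ y. G (mi y (R x)) * f y \<partial>lebn n) \<partial>lebn n)"
  proof (rule nn_integral_cong)
    fix x :: "nat \<Rightarrow> complex" assume x [measurable]: "x \<in> space (lebn n)"
    have "(\<lambda>y. R x) \<in> lebn n \<rightarrow>\<^sub>M lebn n"
      using measurable_space[OF R x] by (rule measurable_const)
    then have "(\<integral>\<^sup>+ y. G (mi y (R x)) * f y \<partial>lebn n) = (\<integral>\<^sup>+ y. G (mi (pl y (R x)) (R x)) * f (pl y (R x)) \<partial>lebn n)"
      by (intro tr[symmetric]) measurable
    also have "\<dots> = (\<integral>\<^sup>+ y. G y * f (pl (R x) y) \<partial>lebn n)"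
      by (intro nn_integral_cong arg_cong2[where f="(*)"] arg_cong[where f=f])
        (auto simp: G_def mi_def pl_def restrict_def)
    finally show "(\<integral>\<^sup>+ y. G y * f (pl (R x) y) \<partial>lebn n) = (\<integral>\<^sup>+ y. G (mi y (R x)) * f y \<partial>lebn n)" ..
  qed
  also have "\<dots> = (\<integral>\<^sup>+ y. (\<integral>\<^sup>+ x. G (mi y (R x)) * f y \<partial>lebn n) \<partial>lebn n)"
    by (rule nn_integral_swap[OF sf sf]) measurable
  also have "\<dots> = (\<integral>\<^sup>+ y. c * f y \<partial>lebn n)"
  proof (rule nn_integral_cong)
    fix y :: "nat \<Rightarrow> complex" assume y: "y \<in> space (lebn n)"
    have "(\<lambda>x. G (mi y (R x))) \<in> borel_measurable (lebn n)" using y by measurable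
    then show "(\<integral>\<^sup>+ x. G (mi y (R x)) * f y \<partial>lebn n) = c * f y"
      by (simp add: nn_integral_multc shift[OF y])
  qed
  also have "\<dots> = c * (\<integral>\<^sup>+ y. f y \<partial>lebn n)"
    by (simp add: nn_integral_cmult)
  finally show ?thesis
    using c by (simp add: ennreal_mult_cancel_left)
qed

text \<open>Lebesgue measure is characterised by its values on boxes, and a complex box is a product
  of two intervals.\<close>

lemma nn_integral_complex:
  fixes f :: "complex \<Rightarrow> ennreal"
  assumes [measurable]: "f \<in> borel_measurable borel"
  shows "(\<integral>\<^sup>+ z. f z \<partial>lborel) = (\<integral>\<^sup>+ x. (\<integral>\<^sup>+ y. f (Complex x y) \<partial>lborel) \<partial>lborel)"
proof -
  have [measurable]: "(\<lambda>(x, y). Complex x y) \<in> lborel \<Otimes>\<^sub>M lborel \<rightarrow>\<^sub>M borel"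
    by (simp add: Complex_eq split_beta')
  have "lborel = distr (lborel \<Otimes>\<^sub>M lborel) borel (\<lambda>(x, y). Complex x y)"
  proof (rule lborel_eqI)
    fix l u :: complex
    assume le: "\<And>b. b \<in> Basis \<Longrightarrow> l \<bullet> b \<le> u \<bullet> b"
    have "(\<lambda>(x, y). Complex x y) -` box l u = {Re l<..<Re u} \<times> {Im l<..<Im u}"
      by (auto simp: mem_box Basis_complex_def)
    then show "emeasure (distr (lborel \<Otimes>\<^sub>M lborel) borel (\<lambda>(x, y). Complex x y)) (box l u) = (\<Prod>b\<in>Basis. (u - l) \<bullet> b)"
      using le[of 1] le[of \<i>]
      by (subst emeasure_distr)
         (auto simp: space_pair_measure lborel.emeasure_pair_measure_Times Basis_complex_def ennreal_mult')
  qed simp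
  then have "(\<integral>\<^sup>+ z. f z \<partial>lborel) = (\<integral>\<^sup>+ z. f z \<partial>distr (lborel \<Otimes>\<^sub>M lborel) borel (\<lambda>(x, y). Complex x y))"
    by (rule arg_cong)
  also have "\<dots> = (\<integral>\<^sup>+ p. f (Complex (fst p) (snd p)) \<partial>(lborel \<Otimes>\<^sub>M lborel))"
    by (subst nn_integral_distr) (simp_all add: split_beta')
  finally show ?thesis
    by (simp add: lborel.nn_integral_fst[symmetric])
qed

abbreviation std_normal :: "real measure" where
  "std_normal \<equiv> density lborel (\<lambda>x. ennreal (std_normal_density x))"

text \<open>In the variables a and x = (a + b) / 2 the product of the two normal densities splits
  into a function of x and a translate in a. So the average has a density proportional to exp (-
  x^2), that is, variance 1/2.\<close>

lemma std_normal_average: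
  assumes [measurable]: "\<psi> \<in> borel_measurable borel"
  shows "(\<integral>\<^sup>+ a. (\<integral>\<^sup>+ b. \<psi> ((a + b) / 2) \<partial>std_normal) \<partial>std_normal)
    = (ennreal (1 / pi) * (\<integral>\<^sup>+ a. ennreal (exp (- a\<^sup>2)) \<partial>lborel)) * (\<integral>\<^sup>+ x. \<psi> x * ennreal (exp (- x\<^sup>2)) \<partial>lborel)"
proof -
  let ?g = "std_normal_density"
  \<comment> \<open>The substitution b = 2 x - a has Jacobian 2, and a^2 / 2 + (2 x - a)^2 / 2 = x^2
    + (a - x)^2.\<close>
  have gg: "?g a * (2 * ?g (- a + 2 * x)) = 1 / pi * exp (- x\<^sup>2) * exp (- (a - x)\<^sup>2)" for a x
  proof -
    have "?g a * (2 * ?g (- a + 2 * x)) = 1 / pi * (exp (- a\<^sup>2 / 2) * exp (- (- a + 2 * x)\<^sup>2 / 2))"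
      by (simp add: std_normal_density_def field_simps)
    also have "exp (- a\<^sup>2 / 2) * exp (- (- a + 2 * x)\<^sup>2 / 2) = exp (- x\<^sup>2) * exp (- (a - x)\<^sup>2)"
      unfolding exp_add[symmetric] by (rule arg_cong[where f=exp]) (simp add: power2_eq_square field_simps)
    finally show ?thesis by simp
  qed
  have "(\<integral>\<^sup>+ a. (\<integral>\<^sup>+ b. \<psi> ((a + b) / 2) \<partial>std_normal) \<partial>std_normal)
      = (\<integral>\<^sup>+ a. ?g a * (\<integral>\<^sup>+ b. ?g b * \<psi> ((a + b) / 2) \<partial>lborel) \<partial>lborel)"
    by (simp add: nn_integral_density)
  also have "\<dots> = (\<integral>\<^sup>+ a. (\<integral>\<^sup>+ x. ennreal (1 / pi * exp (- x\<^sup>2) * exp (- (a - x)\<^sup>2)) * \<psi> x \<partial>lborel) \<partial>lborel)"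
  proof (rule nn_integral_cong)
    fix a :: real
    have "(\<integral>\<^sup>+ b. ?g b * \<psi> ((a + b) / 2) \<partial>lborel) = ennreal 2 * (\<integral>\<^sup>+ x. ?g (- a + 2 * x) * \<psi> x \<partial>lborel)"
      using nn_integral_real_affine[of "\<lambda>b. ?g b * \<psi> ((a + b) / 2)" 2 "- a"] by simp
    then have "?g a * (\<integral>\<^sup>+ b. ?g b * \<psi> ((a + b) / 2) \<partial>lborel)
        = (\<integral>\<^sup>+ x. ?g a * (ennreal 2 * (?g (- a + 2 * x) * \<psi> x)) \<partial>lborel)"
      by (simp add: nn_integral_cmult)
    also have "\<dots> = (\<integral>\<^sup>+ x. ennreal (1 / pi * exp (- x\<^sup>2) * exp (- (a - x)\<^sup>2)) * \<psi> x \<partial>lborel)"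
      unfolding gg[symmetric] by (simp only: ennreal_mult'[OF normal_density_nonneg] ennreal_mult'[OF zero_le_numeral] mult.assoc)
    finally show "?g a * (\<integral>\<^sup>+ b. ?g b * \<psi> ((a + b) / 2) \<partial>lborel)
      = (\<integral>\<^sup>+ x. ennreal (1 / pi * exp (- x\<^sup>2) * exp (- (a - x)\<^sup>2)) * \<psi> x \<partial>lborel)" .
  qed
  also have "\<dots> = (\<integral>\<^sup>+ x. (\<integral>\<^sup>+ a. ennreal (1 / pi * exp (- x\<^sup>2) * exp (- (a - x)\<^sup>2)) * \<psi> x \<partial>lborel) \<partial>lborel)"
    by (rule nn_integral_swap) (auto intro: lborel.sigma_finite_measure_axioms)
  also have "\<dots> = (\<integral>\<^sup>+ x. (ennreal (1 / pi) * (\<integral>\<^sup>+ a. ennreal (exp (- a\<^sup>2)) \<partial>lborel)) * (\<psi> x * ennreal (exp (- x\<^sup>2))) \<partial>lborel)"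
  proof (rule nn_integral_cong)
    fix x :: real
    have "(\<integral>\<^sup>+ a. ennreal (exp (- (a - x)\<^sup>2)) \<partial>lborel) = (\<integral>\<^sup>+ a. ennreal (exp (- a\<^sup>2)) \<partial>lborel)"
      using nn_integral_lborel_translate[of "\<lambda>a. ennreal (exp (- a\<^sup>2))" "- x"] by simp
    then show "(\<integral>\<^sup>+ a. ennreal (1 / pi * exp (- x\<^sup>2) * exp (- (a - x)\<^sup>2)) * \<psi> x \<partial>lborel)
      = (ennreal (1 / pi) * (\<integral>\<^sup>+ a. ennreal (exp (- a\<^sup>2)) \<partial>lborel)) * (\<psi> x * ennreal (exp (- x\<^sup>2)))"
      by (simp only: nn_integral_multc nn_integral_cmult ennreal_mult' mult_nonneg_nonneg exp_ge_zero pi_ge_zero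
        zero_le_divide_1_iff mult_ac) (simp add: nn_integral_cmult mult_ac)
  qed
  also have "\<dots> = (ennreal (1 / pi) * (\<integral>\<^sup>+ a. ennreal (exp (- a\<^sup>2)) \<partial>lborel)) * (\<integral>\<^sup>+ x. \<psi> x * ennreal (exp (- x\<^sup>2)) \<partial>lborel)"
    by (rule nn_integral_cmult) measurable
  finally show ?thesis .
qed

lemma std_normal_uminus:
  assumes [measurable]: "\<psi> \<in> borel_measurable borel"
  shows "(\<integral>\<^sup>+ a. \<psi> (- a) \<partial>std_normal) = (\<integral>\<^sup>+ a. \<psi> a \<partial>std_normal)"
  using nn_integral_lborel_reflect[of "\<lambda>a. ennreal (std_normal_density a) * \<psi> a"]
  by (simp add: nn_integral_density std_normal_density_def)

text \<open>The constant of \<open>std_normal_average\<close>, once for the real and once for the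
  imaginary part; its value is 1 / pi. It stays symbolic because the total mass fixes the final
  constant.\<close>

definition gauss_const :: ennreal where
  "gauss_const = (ennreal (1 / pi) * (\<integral>\<^sup>+ a. ennreal (exp (- a\<^sup>2)) \<partial>lborel))\<^sup>2"

text \<open>The four variables are the real and imaginary parts of G at two mirrored positions, and
  the argument of \<open>\<psi>\<close> is the Hermitian entry that they produce. The difference c -
  d comes from conjugation; symmetry of the normal law turns it into a sum, so both parts are
  averages of two normals.\<close>

lemma std_normal_hermitian_entry:
  assumes [measurable]: "\<psi> \<in> borel_measurable borel"
  shows "(\<integral>\<^sup>+ a. (\<integral>\<^sup>+ b. (\<integral>\<^sup>+ c. (\<integral>\<^sup>+ d. \<psi> (Complex ((a + b) / 2) ((c - d) / 2))
      \<partial>std_normal) \<partial>std_normal) \<partial>std_normal) \<partial>std_normal)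
    = gauss_const * (\<integral>\<^sup>+ z. \<psi> z * ennreal (exp (- (cmod z)\<^sup>2)) \<partial>lborel)"
proof -
  interpret N: prob_space std_normal
    by (rule prob_space_normal_density) simp
  define k where "k = ennreal (1 / pi) * (\<integral>\<^sup>+ a. ennreal (exp (- a\<^sup>2)) \<partial>lborel)"
  have [measurable]: "(\<lambda>p. Complex (f p) (g p)) \<in> borel_measurable N"
    if [measurable]: "f \<in> borel_measurable N" "g \<in> borel_measurable N" for f g and N :: "'z measure"
    by (simp add: Complex_eq)
  define \<psi>' where "\<psi>' x = (\<integral>\<^sup>+ y. \<psi> (Complex x y) * ennreal (exp (- y\<^sup>2)) \<partial>lborel)" for x
  have \<psi>' [measurable]: "\<psi>' \<in> borel_measurable borel"
    unfolding \<psi>'_def by measurable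
  have "(\<integral>\<^sup>+ c. (\<integral>\<^sup>+ d. \<psi> (Complex x ((c - d) / 2)) \<partial>std_normal) \<partial>std_normal) = k * \<psi>' x" for x
  proof -
    have "(\<integral>\<^sup>+ d. \<psi> (Complex x ((c - d) / 2)) \<partial>std_normal) = (\<integral>\<^sup>+ d. \<psi> (Complex x ((c + d) / 2)) \<partial>std_normal)" for c
      using std_normal_uminus[of "\<lambda>d. \<psi> (Complex x ((c + d) / 2))"] by simp
    then show ?thesis
      using std_normal_average[of "\<lambda>y. \<psi> (Complex x y)"] by (simp add: k_def \<psi>'_def)
  qed
  then have "(\<integral>\<^sup>+ a. (\<integral>\<^sup>+ b. (\<integral>\<^sup>+ c. (\<integral>\<^sup>+ d. \<psi> (Complex ((a + b) / 2) ((c - d) / 2))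
      \<partial>std_normal) \<partial>std_normal) \<partial>std_normal) \<partial>std_normal)
    = k * (\<integral>\<^sup>+ a. (\<integral>\<^sup>+ b. \<psi>' ((a + b) / 2) \<partial>std_normal) \<partial>std_normal)"
    by (simp add: nn_integral_cmult)
  also have "\<dots> = k * (k * (\<integral>\<^sup>+ x. \<psi>' x * ennreal (exp (- x\<^sup>2)) \<partial>lborel))"
    using std_normal_average[OF \<psi>'] by (simp only: k_def)
  also have "(\<integral>\<^sup>+ x. \<psi>' x * ennreal (exp (- x\<^sup>2)) \<partial>lborel)
      = (\<integral>\<^sup>+ x. (\<integral>\<^sup>+ y. \<psi> (Complex x y) * ennreal (exp (- (cmod (Complex x y))\<^sup>2)) \<partial>lborel) \<partial>lborel)"
  proof (rule nn_integral_cong)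
    fix x :: real
    have "exp (- (cmod (Complex x y))\<^sup>2) = exp (- y\<^sup>2) * exp (- x\<^sup>2)" for y
      by (simp add: cmod_power2 exp_add[symmetric])
    then show "\<psi>' x * ennreal (exp (- x\<^sup>2))
       = (\<integral>\<^sup>+ y. \<psi> (Complex x y) * ennreal (exp (- (cmod (Complex x y))\<^sup>2)) \<partial>lborel)"
      by (simp add: \<psi>'_def nn_integral_multc[symmetric] ennreal_mult' mult.assoc)
  qed
  also have "\<dots> = (\<integral>\<^sup>+ z. \<psi> z * ennreal (exp (- (cmod z)\<^sup>2)) \<partial>lborel)"
    by (rule nn_integral_complex[symmetric]) measurable
  finally show ?thesis
    by (simp add: gauss_const_def k_def power2_eq_square mult_ac)
qed

subsection \<open>Change of variables from roots to coefficients\<close>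

lemma poly_increasing_piece:
  fixes P :: "real poly"
  assumes ab: "a < b" and pos: "\<And>t. a < t \<Longrightarrow> t < b \<Longrightarrow> poly (pderiv P) t > 0"
  shows "g \<in> borel_measurable borel \<Longrightarrow>
      (\<integral>\<^sup>+ t. g (poly P t) * ennreal \<bar>poly (pderiv P) t\<bar> * indicator {a..b} t \<partial>lborel)
      = (\<integral>\<^sup>+ y. g y * indicator {poly P a..poly P b} y \<partial>lborel)" (is "_ \<Longrightarrow> ?L = ?R")
    and "y \<notin> {poly P a, poly P b} \<Longrightarrow> card {t. a < t \<and> t < b \<and> poly P t = y}
      = (if y \<in> {poly P a..poly P b} then 1 else 0)"
proof -
  \<comment> \<open>The end points may be critical. A negative derivative there would force, by the
    intermediate value theorem, a zero of the derivative strictly inside.\<close>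
  have nonneg: "poly (pderiv P) t \<ge> 0" if "t \<in> {a..b}" for t
  proof (rule ccontr)
    assume neg: "\<not> poly (pderiv P) t \<ge> 0"
    define m where "m = (a + b) / 2"
    have m: "a < m" "m < b" using ab by (auto simp: m_def)
    with pos[of m] have "poly (pderiv P) m > 0" by simp
    with neg have "t \<noteq> m" by auto
    then consider "t < m" | "m < t" by linarith
    then show False
    proof cases
      case 1
      then obtain z where "t < z" "z < m" "poly (pderiv P) z = 0"
        using poly_IVT_pos[of t m "pderiv P"] neg \<open>poly (pderiv P) m > 0\<close> by auto
      then show False using pos[of z] that m by auto
    next
      case 2
      then obtain z where "m < z" "z < t" "poly (pderiv P) z = 0"
        using poly_IVT_neg[of m t "pderiv P"] neg \<open>poly (pderiv P) m > 0\<close> by auto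
      then show False using pos[of z] that m by auto
    qed
  qed
  show "?L = ?R" if g: "g \<in> borel_measurable borel"
  proof -
    have "?R = (\<integral>\<^sup>+ t. g (poly P t) * ennreal (poly (pderiv P) t) * indicator {a..b} t \<partial>lborel)"
    proof (rule nn_integral_substitution_aux[OF g _ poly_DERIV _ nonneg ab])
      show "continuous_on {a..b} (poly (pderiv P))" by (intro continuous_intros)
    qed simp_all
    then show ?thesis
      using nonneg by (auto intro!: nn_integral_cong simp: indicator_def)
  qed
  have mono: "poly P s < poly P t" if st: "a \<le> s" "s < t" "t \<le> b" for s t
  proof -
    obtain x where x: "s < x" "x < t" "poly P t - poly P s = (t - s) * poly (pderiv P) x"
      using poly_MVT[OF st(2)] by auto
    then have "(t - s) * poly (pderiv P) x > 0" using st pos[of x] by simp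
    with x show ?thesis by simp
  qed
  show "card {t. a < t \<and> t < b \<and> poly P t = y} = (if y \<in> {poly P a..poly P b} then 1 else 0)"
    if y: "y \<notin> {poly P a, poly P b}"
  proof (cases "y \<in> {poly P a..poly P b}")
    case True
    have "continuous_on {a..b} (poly P)" by (intro continuous_intros)
    with True obtain t where t: "a \<le> t" "t \<le> b" "poly P t = y"
      using IVT'[of "poly P" a y b] ab by auto
    with y have "a < t" "t < b" by (auto simp: less_le)
    moreover have "t' = t" if "a < t'" "t' < b" "poly P t' = y" for t'
      using mono[of t t'] mono[of t' t] t that by (cases t t' rule: linorder_cases) auto
    ultimately have single: "{t. a < t \<and> t < b \<and> poly P t = y} = {t}"
      using t by blast
    show ?thesis
      unfolding single using True by simp
  next
    case False
    then have "\<not> (a < t \<and> t < b \<and> poly P t = y)" for t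
      using mono[of a t] mono[of t b] by auto
    then have empty: "{t. a < t \<and> t < b \<and> poly P t = y} = {}"
      by blast
    show ?thesis
      unfolding empty using False by auto
  qed
qed

text \<open>The interval is cut at a critical point, with induction on the number of points of
  \<open>S\<close> inside. Where there is none, the derivative has constant sign and
  \<open>poly_increasing_piece\<close> applies to P or to - P. The multiplicity
  \<open>\<kappa>\<close> is built as a sum of indicators of intervals, hence measurable; it agrees
  with the number of preimages except at finitely many levels, the values at end points of
  pieces.\<close>

lemma poly_area_interval:
  fixes P :: "real poly"
  assumes "finite S" "a < b" and "\<And>t. a < t \<Longrightarrow> t < b \<Longrightarrow> poly (pderiv P) t = 0 \<Longrightarrow> t \<in> S"
    and nz: "pderiv P \<noteq> 0"
  shows "\<exists>\<kappa> N. finite N \<and> \<kappa> \<in> borel_measurable borel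
    \<and> (\<forall>y. y \<notin> N \<longrightarrow> \<kappa> y = of_nat (card {t. a < t \<and> t < b \<and> poly P t = y}))
    \<and> (\<forall>g. g \<in> borel_measurable borel \<longrightarrow>
        (\<integral>\<^sup>+ t. g (poly P t) * ennreal \<bar>poly (pderiv P) t\<bar> * indicator {a..b} t \<partial>lborel)
        = (\<integral>\<^sup>+ y. g y * (\<kappa> y :: ennreal) \<partial>lborel))" (is "?Q a b")
  using assms(1-3)
proof (induction "card (S \<inter> {a<..<b})" arbitrary: a b rule: less_induct)
  case less
  show ?case
  proof (cases "S \<inter> {a<..<b} = {}")
    case True
    then have nz: "poly (pderiv P) t \<noteq> 0" if "a < t" "t < b" for t
      using less.prems(3)[of t] that by auto
    define m where "m = (a + b) / 2"
    have m: "a < m" "m < b" using less.prems by (auto simp: m_def)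
    have same: "poly (pderiv P) t * poly (pderiv P) m > 0" if "a < t" "t < b" for t
    proof (rule ccontr)
      assume *: "\<not> ?thesis"
      have "poly (pderiv P) t * poly (pderiv P) m \<noteq> 0" using nz[OF m] nz[OF that] by simp
      with * have neg: "poly (pderiv P) t * poly (pderiv P) m < 0" by linarith
      have "t \<noteq> m"
      proof
        assume "t = m"
        then show False using neg zero_le_square[of "poly (pderiv P) m"] by simp
      qed
      then consider "t < m" | "m < t" by linarith
      then show False
      proof cases
        case 1
        with poly_IVT[of t m "pderiv P"] neg obtain z
          where "t < z" "z < m" "poly (pderiv P) z = 0" by auto
        with nz[of z] m that show False by auto
      next
        case 2
        with poly_IVT[of m t "pderiv P"] neg obtain z
          where "m < z" "z < t" "poly (pderiv P) z = 0" by (auto simp: mult.commute)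
        with nz[of z] m that show False by auto
      qed
    qed
    show ?thesis
    proof (cases "poly (pderiv P) m > 0")
      case True
      with same have pos: "poly (pderiv P) t > 0" if "a < t" "t < b" for t
        using that by (fastforce simp: zero_less_mult_iff)
      have piece: "g \<in> borel_measurable borel \<Longrightarrow>
          (\<integral>\<^sup>+ t. g (poly P t) * ennreal \<bar>poly (pderiv P) t\<bar> * indicator {a..b} t \<partial>lborel)
          = (\<integral>\<^sup>+ y. g y * indicator {poly P a..poly P b} y \<partial>lborel)"
        "y \<notin> {poly P a, poly P b} \<Longrightarrow> card {t. a < t \<and> t < b \<and> poly P t = y}
          = (if y \<in> {poly P a..poly P b} then 1 else 0)" for g y
        using poly_increasing_piece[of a b P] less.prems(2) pos by blast+
      show ?thesis
      proof (intro exI conjI allI impI)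
        show "(\<integral>\<^sup>+ t. g (poly P t) * ennreal \<bar>poly (pderiv P) t\<bar> * indicator {a..b} t \<partial>lborel)
          = (\<integral>\<^sup>+ y. g y * indicator {poly P a..poly P b} y \<partial>lborel)" if "g \<in> borel_measurable borel" for g
          using piece(1)[OF that] .
        fix y
        show "indicator {poly P a..poly P b} y = (of_nat (card {t. a < t \<and> t < b \<and> poly P t = y}) :: ennreal)"
          if "y \<notin> {poly P a, poly P b}"
          using piece(2)[OF that] by (simp add: indicator_def)
      qed simp_all
    next
      case False
      with same have pos: "poly (pderiv (- P)) t > 0" if "a < t" "t < b" for t
        using that by (fastforce simp: zero_less_mult_iff pderiv_minus)
      have piece: "g \<in> borel_measurable borel \<Longrightarrow>
          (\<integral>\<^sup>+ t. g (poly (- P) t) * ennreal \<bar>poly (pderiv (- P)) t\<bar> * indicator {a..b} t \<partial>lborel)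
          = (\<integral>\<^sup>+ y. g y * indicator {poly (- P) a..poly (- P) b} y \<partial>lborel)"
        "y \<notin> {poly (- P) a, poly (- P) b} \<Longrightarrow> card {t. a < t \<and> t < b \<and> poly (- P) t = y}
          = (if y \<in> {poly (- P) a..poly (- P) b} then 1 else 0)" for g y
        using poly_increasing_piece[of a b "- P"] less.prems(2) pos by blast+
      have "(\<integral>\<^sup>+ t. g (poly P t) * ennreal \<bar>poly (pderiv P) t\<bar> * indicator {a..b} t \<partial>lborel)
        = (\<integral>\<^sup>+ y. g y * indicator {poly P b..poly P a} y \<partial>lborel)" if [measurable]: "g \<in> borel_measurable borel" for g
        using piece(1)[of "\<lambda>y. g (- y)"] nn_integral_lborel_reflect[of "\<lambda>y. g y * indicator {poly P b..poly P a} y"]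
        by (simp add: pderiv_minus indicator_def neg_le_iff_le minus_le_iff le_minus_iff conj_commute)
      moreover have "indicator {poly P b..poly P a} y = (of_nat (card {t. a < t \<and> t < b \<and> poly P t = y}) :: ennreal)"
        if "y \<notin> {poly P a, poly P b}" for y
        using piece(2)[of "- y"] that by (auto simp: indicator_def)
      ultimately show ?thesis
        by (intro exI[of _ "indicator {poly P b..poly P a}"] exI[of _ "{poly P a, poly P b}"]) simp
    qed
  next
    case False
    then obtain s where s: "s \<in> S" "a < s" "s < b" by auto
    have "card (S \<inter> {a<..<s}) < card (S \<inter> {a<..<b})" "card (S \<inter> {s<..<b}) < card (S \<inter> {a<..<b})"
      using s less.prems(1) by (auto intro!: psubset_card_mono)
    then have "?Q a s" "?Q s b"
      using less.hyps[of a s] less.hyps[of s b] less.prems s by auto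
    obtain \<kappa>1 N1 where "finite N1 \<and> \<kappa>1 \<in> borel_measurable borel
        \<and> (\<forall>y. y \<notin> N1 \<longrightarrow> \<kappa>1 y = of_nat (card {t. a < t \<and> t < s \<and> poly P t = y}))
        \<and> (\<forall>g. g \<in> borel_measurable borel \<longrightarrow>
          (\<integral>\<^sup>+ t. g (poly P t) * ennreal \<bar>poly (pderiv P) t\<bar> * indicator {a..s} t \<partial>lborel)
            = (\<integral>\<^sup>+ y. g y * (\<kappa>1 y :: ennreal) \<partial>lborel))"
      using \<open>?Q a s\<close> by (elim exE) (rule that)
    then have 1: "finite N1" "\<kappa>1 \<in> borel_measurable borel"
        "\<And>y. y \<notin> N1 \<Longrightarrow> \<kappa>1 y = of_nat (card {t. a < t \<and> t < s \<and> poly P t = y})"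
        "\<And>g. g \<in> borel_measurable borel \<Longrightarrow>
          (\<integral>\<^sup>+ t. g (poly P t) * ennreal \<bar>poly (pderiv P) t\<bar> * indicator {a..s} t \<partial>lborel)
            = (\<integral>\<^sup>+ y. g y * (\<kappa>1 y :: ennreal) \<partial>lborel)"
      by simp_all
    obtain \<kappa>2 N2 where "finite N2 \<and> \<kappa>2 \<in> borel_measurable borel
        \<and> (\<forall>y. y \<notin> N2 \<longrightarrow> \<kappa>2 y = of_nat (card {t. s < t \<and> t < b \<and> poly P t = y}))
        \<and> (\<forall>g. g \<in> borel_measurable borel \<longrightarrow>
          (\<integral>\<^sup>+ t. g (poly P t) * ennreal \<bar>poly (pderiv P) t\<bar> * indicator {s..b} t \<partial>lborel)
            = (\<integral>\<^sup>+ y. g y * (\<kappa>2 y :: ennreal) \<partial>lborel))"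
      using \<open>?Q s b\<close> by (elim exE) (rule that)
    then have 2: "finite N2" "\<kappa>2 \<in> borel_measurable borel"
        "\<And>y. y \<notin> N2 \<Longrightarrow> \<kappa>2 y = of_nat (card {t. s < t \<and> t < b \<and> poly P t = y})"
        "\<And>g. g \<in> borel_measurable borel \<Longrightarrow>
          (\<integral>\<^sup>+ t. g (poly P t) * ennreal \<bar>poly (pderiv P) t\<bar> * indicator {s..b} t \<partial>lborel)
            = (\<integral>\<^sup>+ y. g y * (\<kappa>2 y :: ennreal) \<partial>lborel)"
      by simp_all
    have fin: "finite {t. poly P t = y}" for y
    proof -
      have "P \<noteq> [:y:]" using nz by auto
      then have "finite {t. poly (P - [:y:]) t = 0}" by (intro poly_roots_finite) simp
      then show ?thesis by simp
    qed
    \<comment> \<open>The level P s is excluded because the cut point s belongs to neither open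
      piece.\<close>
    have "\<kappa>1 y + \<kappa>2 y = of_nat (card {t. a < t \<and> t < b \<and> poly P t = y})"
      if "y \<notin> insert (poly P s) (N1 \<union> N2)" for y
    proof -
      have eq: "{t. a < t \<and> t < b \<and> poly P t = y}
          = {t. a < t \<and> t < s \<and> poly P t = y} \<union> {t. s < t \<and> t < b \<and> poly P t = y}"
        using that s by auto (metis linorder_neqE)
      show ?thesis
        unfolding eq using that 1(3)[of y] 2(3)[of y] fin[of y]
        by (subst card_Un_disjoint) (auto intro: finite_subset[OF _ fin[of y]])
    qed
    moreover have "(\<integral>\<^sup>+ t. g (poly P t) * ennreal \<bar>poly (pderiv P) t\<bar> * indicator {a..b} t \<partial>lborel)
        = (\<integral>\<^sup>+ y. g y * (\<kappa>1 y + \<kappa>2 y) \<partial>lborel)" if [measurable]: "g \<in> borel_measurable borel" for g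
    proof -
      have [measurable]: "poly P \<in> borel_measurable borel" "poly (pderiv P) \<in> borel_measurable borel"
        by (auto intro!: borel_measurable_continuous_onI continuous_intros)
      note [measurable] = 1(2) 2(2)
      have "(\<integral>\<^sup>+ t. g (poly P t) * ennreal \<bar>poly (pderiv P) t\<bar> * indicator {a..b} t \<partial>lborel)
         = (\<integral>\<^sup>+ t. g (poly P t) * ennreal \<bar>poly (pderiv P) t\<bar> * indicator {a..s} t
            + g (poly P t) * ennreal \<bar>poly (pderiv P) t\<bar> * indicator {s..b} t \<partial>lborel)"
        using AE_lborel_singleton[of s] s by (intro nn_integral_cong_AE) (auto simp: indicator_def elim!: eventually_mono)
      also have "\<dots> = (\<integral>\<^sup>+ y. g y * \<kappa>1 y \<partial>lborel) + (\<integral>\<^sup>+ y. g y * \<kappa>2 y \<partial>lborel)"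
        using that 1(4)[of g] 2(4)[of g] by (subst nn_integral_add) simp_all
      finally show ?thesis
        by (simp add: distrib_left nn_integral_add)
    qed
    ultimately show ?thesis
      using 1(1,2) 2(1,2)
      by (intro exI[of _ "\<lambda>y. \<kappa>1 y + \<kappa>2 y"] exI[of _ "insert (poly P s) (N1 \<union> N2)"]) auto
  qed
qed

text \<open>Bounded intervals exhaust the line. A level in the support of \<open>g\<close> has n
  preimages, all of them inside some bounded interval, so the multiplicities increase to n there and
  monotone convergence gives n times the integral of \<open>g\<close>.\<close>

lemma poly_area:
  fixes P :: "real poly"
  assumes nz: "pderiv P \<noteq> 0" and g [measurable]: "g \<in> borel_measurable borel"
    and supp: "\<And>y. g y \<noteq> 0 \<Longrightarrow> card {t. poly P t = y} = n"
  shows "(\<integral>\<^sup>+ t. g (poly P t) * ennreal \<bar>poly (pderiv P) t\<bar> \<partial>lborel) = of_nat n * (\<integral>\<^sup>+ y. g y \<partial>lborel)"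
proof -
  have [measurable]: "poly P \<in> borel_measurable borel" "poly (pderiv P) \<in> borel_measurable borel"
    by (auto intro!: borel_measurable_continuous_onI continuous_intros)
  let ?I = "\<lambda>K::nat. {- real (Suc K)..real (Suc K)}"
  let ?C = "\<lambda>K y. {t. - real (Suc K) < t \<and> t < real (Suc K) \<and> poly P t = y}"
  have fin: "finite {t. poly P t = y}" for y
  proof -
    have "P \<noteq> [:y:]" using nz by auto
    then have "finite {t. poly (P - [:y:]) t = 0}" by (intro poly_roots_finite) simp
    then show ?thesis by simp
  qed
  define Q where "Q K \<kappa> N \<longleftrightarrow> finite N \<and> \<kappa> \<in> borel_measurable borel
    \<and> (\<forall>y. y \<notin> N \<longrightarrow> \<kappa> y = of_nat (card (?C K y)))
    \<and> (\<forall>g. g \<in> borel_measurable borel \<longrightarrow>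
        (\<integral>\<^sup>+ t. g (poly P t) * ennreal \<bar>poly (pderiv P) t\<bar> * indicator (?I K) t \<partial>lborel)
        = (\<integral>\<^sup>+ y. g y * (\<kappa> y :: ennreal) \<partial>lborel))" for K \<kappa> N
  have "\<exists>\<kappa> N. Q K \<kappa> N" for K
    unfolding Q_def using nz
    by (intro poly_area_interval[of "{t. poly (pderiv P) t = 0}"]) (auto simp: poly_roots_finite)
  then obtain \<kappa> N where Q: "\<And>K. Q K (\<kappa> K) (N K)"
    by metis
  then have fN: "\<And>K. finite (N K)" and [measurable]: "\<And>K. \<kappa> K \<in> borel_measurable borel"
    and \<kappa>: "\<And>K y. y \<notin> N K \<Longrightarrow> \<kappa> K y = of_nat (card (?C K y))"
    and int: "\<And>K g. g \<in> borel_measurable borel \<Longrightarrow>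
        (\<integral>\<^sup>+ t. g (poly P t) * ennreal \<bar>poly (pderiv P) t\<bar> * indicator (?I K) t \<partial>lborel)
        = (\<integral>\<^sup>+ y. g y * (\<kappa> K y :: ennreal) \<partial>lborel)"
    unfolding Q_def by blast+
  \<comment> \<open>Each interval has its own finite set of exceptional levels; their union is
    countable, hence null.\<close>
  have "countable (\<Union>K. N K)"
    using countable_finite[OF fN] by simp
  then have "AE y in lborel. y \<notin> (\<Union>K. N K)"
    by (intro AE_not_in countable_imp_null_set_lborel)
  then have ae: "AE y in lborel. \<forall>K. y \<notin> N K"
    by simp
  have "(\<integral>\<^sup>+ t. g (poly P t) * ennreal \<bar>poly (pderiv P) t\<bar> \<partial>lborel)
     = (\<integral>\<^sup>+ t. (SUP K. g (poly P t) * ennreal \<bar>poly (pderiv P) t\<bar> * indicator (?I K) t) \<partial>lborel)"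
  proof (rule nn_integral_cong)
    fix t :: real
    obtain K :: nat where "\<bar>t\<bar> \<le> real K" using real_arch_simple by blast
    then have "indicator (?I K) t = (1 :: ennreal)" by (auto simp: indicator_def)
    then have "g (poly P t) * ennreal \<bar>poly (pderiv P) t\<bar> \<le> (SUP K. g (poly P t) * ennreal \<bar>poly (pderiv P) t\<bar> * indicator (?I K) t)"
      using SUP_upper[of K UNIV "\<lambda>K. g (poly P t) * ennreal \<bar>poly (pderiv P) t\<bar> * indicator (?I K) t"] by simp
    moreover have "(SUP K. g (poly P t) * ennreal \<bar>poly (pderiv P) t\<bar> * indicator (?I K) t) \<le> g (poly P t) * ennreal \<bar>poly (pderiv P) t\<bar>"
      by (rule SUP_least) (simp add: indicator_def)
    ultimately show "g (poly P t) * ennreal \<bar>poly (pderiv P) t\<bar>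
       = (SUP K. g (poly P t) * ennreal \<bar>poly (pderiv P) t\<bar> * indicator (?I K) t)"
      by (rule antisym)
  qed
  also have "\<dots> = (SUP K. \<integral>\<^sup>+ t. g (poly P t) * ennreal \<bar>poly (pderiv P) t\<bar> * indicator (?I K) t \<partial>lborel)"
    by (rule nn_integral_monotone_convergence_SUP)
      (auto simp: incseq_def le_fun_def indicator_def)
  also have "\<dots> = (SUP K. \<integral>\<^sup>+ y. g y * \<kappa> K y \<partial>lborel)"
    by (simp only: int[OF g])
  also have "\<dots> = (\<integral>\<^sup>+ y. (SUP K. g y * \<kappa> K y) \<partial>lborel)"
  proof -
    have "AE y in lborel. g y * \<kappa> K y \<le> g y * \<kappa> (Suc K) y" for K
    proof (rule eventually_mono[OF ae])
      fix y assume "\<forall>K. y \<notin> N K"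
      moreover have "card (?C K y) \<le> card (?C (Suc K) y)"
        by (rule card_mono) (auto intro: finite_subset[OF _ fin[of y]])
      ultimately have "\<kappa> K y \<le> \<kappa> (Suc K) y" by (simp add: \<kappa>)
      then show "g y * \<kappa> K y \<le> g y * \<kappa> (Suc K) y" by (rule mult_left_mono) simp
    qed
    moreover have "(\<lambda>y. g y * \<kappa> K y) \<in> borel_measurable lborel" for K
      by simp
    ultimately show ?thesis
      by (rule nn_integral_monotone_convergence_SUP_AE[symmetric])
  qed
  also have "\<dots> = (\<integral>\<^sup>+ y. of_nat n * g y \<partial>lborel)"
  proof (rule nn_integral_cong_AE, rule eventually_mono[OF ae])
    fix y assume y: "\<forall>K. y \<notin> N K"
    show "(SUP K. g y * \<kappa> K y) = of_nat n * g y"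
    proof (cases "g y = 0")
      case False
      obtain B where B: "\<And>t. poly P t = y \<Longrightarrow> \<bar>t\<bar> \<le> B"
        using finite_imp_bounded[OF fin[of y]] unfolding bounded_iff by auto
      obtain K :: nat where K: "B \<le> real K" using real_arch_simple by blast
      have "?C K y = {t. poly P t = y}" using B K by force
      then have eq: "\<kappa> K y = of_nat n" using y supp[OF False] by (simp add: \<kappa>)
      have "\<kappa> J y \<le> of_nat n" for J
      proof -
        have "card (?C J y) \<le> n" unfolding supp[OF False, symmetric] by (rule card_mono[OF fin]) auto
        then show ?thesis using y by (simp add: \<kappa>)
      qed
      then have "(SUP K. g y * \<kappa> K y) \<le> g y * of_nat n"
        by (intro SUP_least mult_left_mono) simp_all
      moreover have "g y * of_nat n \<le> (SUP K. g y * \<kappa> K y)"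
        using SUP_upper[of K UNIV "\<lambda>K. g y * \<kappa> K y"] by (simp add: eq)
      ultimately show ?thesis by (simp add: mult.commute)
    qed simp
  qed
  also have "\<dots> = of_nat n * (\<integral>\<^sup>+ y. g y \<partial>lborel)"
    by (rule nn_integral_cmult) measurable
  finally show ?thesis .
qed

section \<open>Monic polynomials in terms of coefficients and of roots\<close>

primrec coeffs_poly :: "nat \<Rightarrow> (nat \<Rightarrow> real) \<Rightarrow> real poly" where
  "coeffs_poly 0 c = 1"
| "coeffs_poly (Suc k) c = pCons (c k) (coeffs_poly k c)"

definition roots_poly :: "nat \<Rightarrow> (nat \<Rightarrow> real) \<Rightarrow> real poly" where
  "roots_poly k x = (\<Prod>i<k. [:- x i, 1:])"

text \<open>As in \<open>coeffs_poly\<close>, index 0 is the coefficient just below the leading one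
  and index k - 1 is the constant term. In this order the coefficients of p = p(0) + x r are those
  of r with p(0) appended, which suits recursion over \<open>lebn\<close>.\<close>

definition poly_coeffs :: "nat \<Rightarrow> real poly \<Rightarrow> nat \<Rightarrow> real" where
  "poly_coeffs k p = (\<lambda>i\<in>{..<k}. coeff p (k - Suc i))"

definition vandermonde :: "nat \<Rightarrow> (nat \<Rightarrow> real) \<Rightarrow> real" where
  "vandermonde k x = (\<Prod>i<k. \<Prod>j<i. x i - x j)"

lemma vandermonde_Suc: "vandermonde (Suc k) x = vandermonde k x * (\<Prod>j<k. x k - x j)"
  by (simp add: vandermonde_def)

lemma vandermonde_cong: "(\<And>i. i < k \<Longrightarrow> x i = y i) \<Longrightarrow> vandermonde k x = vandermonde k y"
  unfolding vandermonde_def by (intro prod.cong refl) auto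

lemma vandermonde_eq_0_iff: "vandermonde k x = 0 \<longleftrightarrow> \<not> inj_on x {..<k}"
proof -
  have "vandermonde k x = 0 \<longleftrightarrow> (\<exists>i<k. \<exists>j<i. x i = x j)"
    by (auto simp: vandermonde_def)
  also have "\<dots> \<longleftrightarrow> \<not> inj_on x {..<k}"
  proof
    assume "\<exists>i<k. \<exists>j<i. x i = x j"
    then obtain i j where "i < k" "j < i" "x i = x j" by blast
    then show "\<not> inj_on x {..<k}"
      using inj_onD[of x "{..<k}" i j] by auto
  next
    assume "\<not> inj_on x {..<k}"
    then obtain i j where "i < k" "j < k" "x i = x j" "i \<noteq> j" by (auto simp: inj_on_def)
    then consider "i < j" | "j < i" by linarith
    then show "\<exists>i<k. \<exists>j<i. x i = x j"
    proof cases
      case 1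
      with \<open>j < k\<close> \<open>x i = x j\<close> show ?thesis by (intro exI[of _ j] conjI exI[of _ i]) simp_all
    next
      case 2
      with \<open>i < k\<close> \<open>x i = x j\<close> show ?thesis by (intro exI[of _ i] conjI exI[of _ j]) simp_all
    qed
  qed
  finally show ?thesis .
qed

lemma roots_poly_Suc: "roots_poly (Suc k) x = [:- x k, 1:] * roots_poly k x"
  by (simp add: roots_poly_def mult.commute)

lemma roots_poly_cong: "(\<And>i. i < k \<Longrightarrow> x i = y i) \<Longrightarrow> roots_poly k x = roots_poly k y"
  unfolding roots_poly_def by (intro prod.cong refl) auto

lemma poly_roots_poly: "poly (roots_poly k x) t = (\<Prod>i<k. t - x i)"
  by (simp add: roots_poly_def poly_prod)

lemma degree_roots_poly [simp]: "degree (roots_poly k x) = k"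
  and lead_coeff_roots_poly [simp]: "coeff (roots_poly k x) k = 1"
  and roots_poly_neq_0 [simp]: "roots_poly k x \<noteq> 0"
proof -
  show "roots_poly k x \<noteq> 0" by (simp add: roots_poly_def)
  show *: "degree (roots_poly k x) = k"
    unfolding roots_poly_def by (subst degree_prod_eq_sum_degree) auto
  have "lead_coeff (roots_poly k x) = 1"
    unfolding roots_poly_def by (subst lead_coeff_prod) simp
  then show "coeff (roots_poly k x) k = 1" using * by simp
qed

lemma coeffs_poly_cong: "(\<And>i. i < k \<Longrightarrow> c i = d i) \<Longrightarrow> coeffs_poly k c = coeffs_poly k d"
  by (induction k) auto

lemma coeffs_poly_neq_0 [simp]: "coeffs_poly k c \<noteq> 0"
  by (induction k) auto

lemma degree_coeffs_poly [simp]: "degree (coeffs_poly k c) = k"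
  by (induction k) (auto simp: degree_pCons_eq)

lemma lead_coeff_coeffs_poly [simp]: "coeff (coeffs_poly k c) k = 1"
  by (induction k) auto

lemma coeff_pCons_diff: "i < k \<Longrightarrow> coeff (pCons a p) (k - i) = coeff p (k - Suc i)"
  by (metis Suc_diff_Suc coeff_pCons_Suc)

lemma poly_coeffs_coeffs_poly: "c \<in> extensional {..<k} \<Longrightarrow> poly_coeffs k (coeffs_poly k c) = c"
proof (induction k arbitrary: c)
  case 0
  then show ?case by (auto simp: poly_coeffs_def extensional_def)
next
  case (Suc k)
  have "coeff (coeffs_poly k c) (k - Suc i) = c i" if "i < k" for i
  proof -
    have "poly_coeffs k (coeffs_poly k (restrict c {..<k})) = restrict c {..<k}"
      by (rule Suc.IH) (auto simp: extensional_def)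
    moreover have "coeffs_poly k (restrict c {..<k}) = coeffs_poly k c"
      by (rule coeffs_poly_cong) simp
    ultimately have "poly_coeffs k (coeffs_poly k c) i = restrict c {..<k} i" by simp
    then show ?thesis using that by (simp add: poly_coeffs_def)
  qed
  then have "poly_coeffs (Suc k) (coeffs_poly (Suc k) c) i = c i" if "i < Suc k" for i
    using that by (auto simp: poly_coeffs_def coeff_pCons_diff less_Suc_eq)
  moreover have "poly_coeffs (Suc k) (coeffs_poly (Suc k) c) i = c i" if "\<not> i < Suc k" for i
    using that Suc.prems by (auto simp: poly_coeffs_def extensional_def)
  ultimately show ?case by blast
qed

lemma coeffs_poly_poly_coeffs:
  "degree p = k \<Longrightarrow> coeff p k = 1 \<Longrightarrow> coeffs_poly k (poly_coeffs k p) = p"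
proof (induction k arbitrary: p)
  case 0
  then show ?case by (auto simp: one_pCons elim!: degree_eq_zeroE)
next
  case (Suc k)
  obtain a q where p: "p = pCons a q" by (cases p)
  with Suc.prems have q: "degree q = k" "coeff q k = 1" by (auto split: if_splits)
  have "coeffs_poly k (poly_coeffs (Suc k) p) = coeffs_poly k (poly_coeffs k q)"
    by (rule coeffs_poly_cong) (simp add: poly_coeffs_def p coeff_pCons_diff)
  moreover have "poly_coeffs (Suc k) p k = a" by (simp add: poly_coeffs_def p)
  ultimately show ?case using Suc.IH[OF q] p by (simp only: coeffs_poly.simps)
qed

text \<open>The coefficients of the quotient q and of the polynomial r in p = (x - t) q = p(0) + x r
  determine each other by a unipotent triangular system.\<close>

definition shift_coeffs :: "real \<Rightarrow> (nat \<Rightarrow> real) \<Rightarrow> nat \<Rightarrow> real" where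
  "shift_coeffs t c i = c i - t * (if i = 0 then 1 else c (i - 1))"

lemma linear_mult_coeffs_poly:
  "[:- t, 1:] * coeffs_poly k c = pCons (- t * coeff (coeffs_poly k c) 0) (coeffs_poly k (shift_coeffs t c))"
proof -
  \<comment> \<open>Multiplying by x - t subtracts t times the next higher coefficient from each
    one. For index 0 the next higher one is the leading coefficient 1, hence the case distinction in
    \<open>shift_coeffs\<close>.\<close>
  have *: "coeffs_poly (Suc m) c - Polynomial.smult t (coeffs_poly m c) = coeffs_poly (Suc m) (shift_coeffs t c)" for m
    by (induction m) (simp_all add: shift_coeffs_def one_pCons del: coeffs_poly.simps(2),
      simp_all add: shift_coeffs_def one_pCons)
  show ?thesis
  proof (cases k)
    case (Suc m)
    have "[:- t, 1:] * coeffs_poly k c = pCons 0 (coeffs_poly k c) - Polynomial.smult t (coeffs_poly k c)"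
      by simp
    also have "\<dots> = pCons (- t * c m) (coeffs_poly (Suc m) c - Polynomial.smult t (coeffs_poly m c))"
      unfolding Suc by simp
    finally show ?thesis
      unfolding * by (simp only: Suc coeffs_poly.simps(2)[of m c] coeff_pCons_0)
  qed (simp add: one_pCons)
qed

text \<open>Evaluating the product p at its zero t expresses its constant term through r: p(0) = - t
  r(t). So p is determined by t and r, and for fixed r its constant term is a polynomial in
  t.\<close>

lemma linear_mult_coeffs_poly':
  "[:- t, 1:] * coeffs_poly k c
    = pCons (- t * poly (coeffs_poly k (shift_coeffs t c)) t) (coeffs_poly k (shift_coeffs t c))"
proof -
  have "poly ([:- t, 1:] * coeffs_poly k c) t = 0" by simp
  then have "- t * coeff (coeffs_poly k c) 0 = - t * poly (coeffs_poly k (shift_coeffs t c)) t"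
    unfolding linear_mult_coeffs_poly poly_pCons by linarith
  then show ?thesis unfolding linear_mult_coeffs_poly by (rule arg_cong)
qed

text \<open>The shift is triangular with unit diagonal, so its Jacobian is 1 whatever t is.\<close>

lemma nn_integral_shift_coeffs:
  assumes "\<Phi> \<in> borel_measurable (lebn k)"
  shows "(\<integral>\<^sup>+ c. \<Phi> (\<lambda>i\<in>{..<k}. shift_coeffs t c i) \<partial>lebn k) = (\<integral>\<^sup>+ c. \<Phi> c \<partial>lebn k)"
proof -
  have "(\<lambda>c. - t * (if i = 0 then 1 else c (i - 1))) \<in> borel_measurable (lebn i)" for i
    using measurable_lebn_component[of "\<lambda>c. c" "lebn i" i "i - 1"] by (cases "i = 0") simp_all
  from nn_integral_lower_triangular[of k "\<lambda>_. 1", OF _ this assms]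
  have "(\<integral>\<^sup>+ c. \<Phi> c \<partial>lebn k) = (\<integral>\<^sup>+ c. \<Phi> (\<lambda>i\<in>{..<k}. 1 * c i + - t * (if i = 0 then 1 else restrict c {..<i} (i - 1))) \<partial>lebn k)"
    by simp
  also have "\<dots> = (\<integral>\<^sup>+ c. \<Phi> (\<lambda>i\<in>{..<k}. shift_coeffs t c i) \<partial>lebn k)"
    by (intro nn_integral_cong arg_cong[where f=\<Phi>] restrict_ext) (simp add: shift_coeffs_def)
  finally show ?thesis ..
qed

lemma measurable_lebn_nth [measurable]: "i < k \<Longrightarrow> (\<lambda>x. x i) \<in> lebn k \<rightarrow>\<^sub>M borel"
  by (rule measurable_lebn_component) simp_all

lemma measurable_coeff_roots_poly:
  assumes "\<And>i. i < k \<Longrightarrow> (\<lambda>x. f x i) \<in> borel_measurable N"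
  shows "(\<lambda>x. coeff (roots_poly k (f x)) j) \<in> borel_measurable N"
  using assms
proof (induction k arbitrary: j)
  case (Suc k)
  have "coeff (roots_poly (Suc k) (f x)) j
      = - f x k * coeff (roots_poly k (f x)) j + (if j = 0 then 0 else coeff (roots_poly k (f x)) (j - 1))" for x
    by (cases j) (simp_all add: roots_poly_Suc)
  with Suc show ?case by (cases j) simp_all
qed (simp add: roots_poly_def)

lemma measurable_poly_coeffs_poly:
  assumes "\<And>i. i < k \<Longrightarrow> (\<lambda>x. f x i) \<in> borel_measurable N" and [measurable]: "g \<in> borel_measurable N"
  shows "(\<lambda>x. poly (coeffs_poly k (f x)) (g x)) \<in> borel_measurable N"
    and "(\<lambda>x. poly (pderiv (coeffs_poly k (f x))) (g x)) \<in> borel_measurable N"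
proof -
  have "(\<lambda>x. poly (coeffs_poly k (f x)) (g x)) \<in> borel_measurable N
     \<and> (\<lambda>x. poly (pderiv (coeffs_poly k (f x))) (g x)) \<in> borel_measurable N"
    using assms(1)
  proof (induction k)
    case (Suc k)
    then have "(\<lambda>x. f x k) \<in> borel_measurable N" "(\<lambda>x. poly (coeffs_poly k (f x)) (g x)) \<in> borel_measurable N"
      "(\<lambda>x. poly (pderiv (coeffs_poly k (f x))) (g x)) \<in> borel_measurable N"
      by simp_all
    then show ?case
      by (simp add: pderiv_pCons borel_measurable_add borel_measurable_times)
  qed simp
  then show "(\<lambda>x. poly (coeffs_poly k (f x)) (g x)) \<in> borel_measurable N"
    "(\<lambda>x. poly (pderiv (coeffs_poly k (f x))) (g x)) \<in> borel_measurable N" by simp_all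
qed

lemma measurable_vandermonde:
  assumes "\<And>i. i < k \<Longrightarrow> (\<lambda>x. f x i) \<in> borel_measurable N"
  shows "(\<lambda>x. vandermonde k (f x)) \<in> borel_measurable N"
  unfolding vandermonde_def using assms by (intro borel_measurable_prod borel_measurable_diff) auto

text \<open>One root t is separated, p = (x - t) q, and the Vandermonde product splits off the
  factor q(t) = p'(t). For fixed t the induction hypothesis passes from the roots of q to its
  coefficients, and a unipotent shift from these to r. For fixed r the constant term - t r(t) has a
  derivative in t of modulus |p'(t)|, so \<open>poly_area\<close> trades t for the constant term;
  each polynomial is met once for every choice of t among its k + 1 roots, which turns k! into (k +
  1)!. The hypothesis confines \<open>\<Psi>\<close> to polynomials with real simple roots, where
  this number is constant.\<close>

lemma nn_integral_roots_coeffs: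
  assumes "\<Psi> \<in> borel_measurable (lebn k)"
    and "\<And>c. c \<in> space (lebn k) \<Longrightarrow> \<Psi> c \<noteq> 0 \<Longrightarrow> card {x. poly (coeffs_poly k c) x = 0} = k"
  shows "(\<integral>\<^sup>+ x. \<Psi> (poly_coeffs k (roots_poly k x)) * ennreal \<bar>vandermonde k x\<bar> \<partial>lebn k)
    = fact k * (\<integral>\<^sup>+ c. \<Psi> c \<partial>lebn k)"
  using assms
proof (induction k arbitrary: \<Psi>)
  case 0
  show ?case
    unfolding nn_integral_lebn_0 by (simp add: poly_coeffs_def vandermonde_def restrict_def)
next
  case (Suc k)
  note \<Psi> [measurable] = Suc.prems(1)
  \<comment> \<open>The integrand when the last root is t. The extra factor |q(t)| is the part of
    the Vandermonde product that involves t.\<close>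
  define \<Psi>t where "\<Psi>t t c = \<Psi> (poly_coeffs (Suc k) ([:- t, 1:] * coeffs_poly k c))
      * ennreal \<bar>poly (coeffs_poly k c) t\<bar>" for t c
  \<comment> \<open>The same integrand in the variables t and r. The weight is the derivative of x r
    at t, which equals p'(t) because p and x r differ by a constant.\<close>
  define \<Theta> where "\<Theta> t r = \<Psi> (r(k := - t * poly (coeffs_poly k r) t))
      * ennreal \<bar>poly (pderiv (pCons 0 (coeffs_poly k r))) t\<bar>" for t r
  have upd: "(\<lambda>p. (fst p)(k := - snd p * poly (coeffs_poly k (fst p)) (snd p))) \<in> lebn k \<Otimes>\<^sub>M lborel \<rightarrow>\<^sub>M lebn (Suc k)"
    by (intro measurable_lebn_upd borel_measurable_times borel_measurable_uminus measurable_poly_coeffs_poly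
         measurable_compose[OF measurable_fst measurable_lebn_nth]) simp_all
  have \<Theta>_meas: "(\<lambda>(r, t). \<Theta> t r) \<in> borel_measurable (lebn k \<Otimes>\<^sub>M lborel)"
  proof -
    have "(\<lambda>p. poly (coeffs_poly k (fst p)) (snd p)) \<in> borel_measurable (lebn k \<Otimes>\<^sub>M lborel)"
      "(\<lambda>p. poly (pderiv (coeffs_poly k (fst p))) (snd p)) \<in> borel_measurable (lebn k \<Otimes>\<^sub>M lborel)"
      by (simp_all add: measurable_poly_coeffs_poly measurable_compose[OF measurable_fst measurable_lebn_nth])
    then show ?thesis
      unfolding \<Theta>_def split_beta' pderiv_pCons
      using measurable_compose[OF upd \<Psi>] by simp
  qed
  have \<Theta>_t [measurable]: "\<Theta> t \<in> borel_measurable (lebn k)" for t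
  proof -
    have "(\<lambda>r. (r, t)) \<in> lebn k \<rightarrow>\<^sub>M lebn k \<Otimes>\<^sub>M lborel" by simp
    from measurable_compose[OF this \<Theta>_meas] show ?thesis by simp
  qed
  have pc_Suc: "poly_coeffs (Suc k) (pCons a (coeffs_poly k r)) = r(k := a)" if "r \<in> space (lebn k)" for a r
  proof -
    have "poly_coeffs (Suc k) (coeffs_poly (Suc k) (r(k := a))) = r(k := a)"
      using that by (intro poly_coeffs_coeffs_poly) (auto simp: space_lebn extensional_def)
    moreover have "coeffs_poly k (r(k := a)) = coeffs_poly k r"
      by (rule coeffs_poly_cong) simp
    ultimately show ?thesis by simp
  qed
  have \<Psi>t_\<Theta>: "\<Psi>t t c = \<Theta> t (\<lambda>i\<in>{..<k}. shift_coeffs t c i)" for t c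
  proof -
    let ?r = "\<lambda>i\<in>{..<k}. shift_coeffs t c i"
    have r: "coeffs_poly k ?r = coeffs_poly k (shift_coeffs t c)"
      by (rule coeffs_poly_cong) simp
    have p: "[:- t, 1:] * coeffs_poly k c = pCons (- t * poly (coeffs_poly k ?r) t) (coeffs_poly k ?r)"
      unfolding linear_mult_coeffs_poly' r ..
    have "poly (coeffs_poly k c) t = poly (pderiv ([:- t, 1:] * coeffs_poly k c)) t"
      by (simp add: pderiv_mult pderiv_pCons del: mult_pCons_left)
    also have "\<dots> = poly (pderiv (pCons 0 (coeffs_poly k ?r))) t"
      unfolding p by (simp add: pderiv_pCons)
    finally have d: "poly (coeffs_poly k c) t = poly (pderiv (pCons 0 (coeffs_poly k ?r))) t" .
    show ?thesis
      unfolding \<Psi>t_def \<Theta>_def d unfolding p by (subst pc_Suc) (simp_all add: space_lebn)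
  qed
  have meas_shift: "(\<lambda>c. \<lambda>i\<in>{..<k}. shift_coeffs t c i) \<in> lebn k \<rightarrow>\<^sub>M lebn k" for t
  proof (rule measurable_lebnI)
    fix i assume "i < k"
    then show "(\<lambda>c. shift_coeffs t c i) \<in> borel_measurable (lebn k)"
      unfolding shift_coeffs_def by (cases i) simp_all
  qed
  have \<Psi>t_meas: "\<Psi>t t \<in> borel_measurable (lebn k)" for t
    using measurable_compose[OF meas_shift \<Theta>_t] by (simp add: \<Psi>t_\<Theta>[abs_def])
  \<comment> \<open>On the support the weight q(t) is nonzero. So t is not a root of q, and removing
    it from the k + 1 distinct roots of p leaves k.\<close>
  have \<Psi>t_supp: "card {x. poly (coeffs_poly k c) x = 0} = k" if "c \<in> space (lebn k)" "\<Psi>t t c \<noteq> 0" for t c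
  proof -
    let ?p = "[:- t, 1:] * coeffs_poly k c"
    let ?d = "poly_coeffs (Suc k) ?p"
    have dp: "coeffs_poly (Suc k) ?d = ?p"
      by (rule coeffs_poly_poly_coeffs) (simp_all add: degree_mult_eq coeff_eq_0 del: mult_pCons_left, simp add: coeff_eq_0)
    have "?d \<in> space (lebn (Suc k))" by (simp add: space_lebn poly_coeffs_def)
    with that Suc.prems(2)[of ?d] have card: "card {x. poly ?p x = 0} = Suc k"
      unfolding dp by (auto simp: \<Psi>t_def)
    have "poly (coeffs_poly k c) t \<noteq> 0" using that by (auto simp: \<Psi>t_def)
    then have eq: "{x. poly (coeffs_poly k c) x = 0} = {x. poly ?p x = 0} - {t}"
      by auto
    have "t \<in> {x. poly ?p x = 0}" by simp
    then show ?thesis unfolding eq by (simp only: card_Diff_singleton card diff_Suc_1)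
  qed
  have "(\<integral>\<^sup>+ x. \<Psi> (poly_coeffs (Suc k) (roots_poly (Suc k) x)) * ennreal \<bar>vandermonde (Suc k) x\<bar> \<partial>lebn (Suc k))
     = (\<integral>\<^sup>+ t. (\<integral>\<^sup>+ x. \<Psi>t t (poly_coeffs k (roots_poly k x)) * ennreal \<bar>vandermonde k x\<bar> \<partial>lebn k) \<partial>lborel)"
  proof -
    have "(\<lambda>x. poly_coeffs (Suc k) (roots_poly (Suc k) x)) \<in> lebn (Suc k) \<rightarrow>\<^sub>M lebn (Suc k)"
      unfolding poly_coeffs_def by (intro measurable_lebnI measurable_coeff_roots_poly) simp
    then have "(\<lambda>x. \<Psi> (poly_coeffs (Suc k) (roots_poly (Suc k) x)) * ennreal \<bar>vandermonde (Suc k) x\<bar>)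
       \<in> borel_measurable (lebn (Suc k))"
      by (intro borel_measurable_times_ennreal measurable_compose[OF _ \<Psi>] measurable_compose[OF _ measurable_ennreal]
           borel_measurable_abs measurable_vandermonde) simp_all
    moreover have "\<Psi> (poly_coeffs (Suc k) (roots_poly (Suc k) (x(k := t)))) * ennreal \<bar>vandermonde (Suc k) (x(k := t))\<bar>
       = \<Psi>t t (poly_coeffs k (roots_poly k x)) * ennreal \<bar>vandermonde k x\<bar>" for x t
    proof -
      have 1: "roots_poly (Suc k) (x(k := t)) = [:- t, 1:] * roots_poly k x"
        unfolding roots_poly_Suc by (simp add: roots_poly_cong[of k "x(k := t)" x] del: mult_pCons_left)
      have 2: "vandermonde (Suc k) (x(k := t)) = vandermonde k x * poly (roots_poly k x) t"
        unfolding vandermonde_Suc poly_roots_poly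
        by (simp add: vandermonde_cong[of k "x(k := t)" x])
      have 3: "coeffs_poly k (poly_coeffs k (roots_poly k x)) = roots_poly k x"
        by (rule coeffs_poly_poly_coeffs) simp_all
      show ?thesis
        unfolding 1 2 \<Psi>t_def 3 by (simp add: abs_mult ennreal_mult' mult_ac del: mult_pCons_left)
    qed
    ultimately show ?thesis
      by (subst nn_integral_lebn_Suc_rev) (simp_all del: fun_upd_apply)
  qed
  also have "\<dots> = (\<integral>\<^sup>+ t. fact k * (\<integral>\<^sup>+ c. \<Psi>t t c \<partial>lebn k) \<partial>lborel)"
    by (intro nn_integral_cong Suc.IH \<Psi>t_meas \<Psi>t_supp)
  also have "\<dots> = (\<integral>\<^sup>+ t. fact k * (\<integral>\<^sup>+ r. \<Theta> t r \<partial>lebn k) \<partial>lborel)"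
    unfolding \<Psi>t_\<Theta> by (simp only: nn_integral_shift_coeffs[OF \<Theta>_t])
  also have "\<dots> = fact k * (\<integral>\<^sup>+ t. (\<integral>\<^sup>+ r. \<Theta> t r \<partial>lebn k) \<partial>lborel)"
  proof (rule nn_integral_cmult)
    have "(\<lambda>(t, r). \<Theta> t r) \<in> borel_measurable (lborel \<Otimes>\<^sub>M lebn k)"
      using measurable_compose[OF measurable_pair_swap' \<Theta>_meas] by (simp add: split_beta')
    from measurable_nn_integral[OF sigma_finite_lebn this]
    show "(\<lambda>t. \<integral>\<^sup>+ r. \<Theta> t r \<partial>lebn k) \<in> borel_measurable lborel" .
  qed
  also have "(\<integral>\<^sup>+ t. (\<integral>\<^sup>+ r. \<Theta> t r \<partial>lebn k) \<partial>lborel) = (\<integral>\<^sup>+ r. (\<integral>\<^sup>+ t. \<Theta> t r \<partial>lborel) \<partial>lebn k)"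
    using nn_integral_swap[OF sigma_finite_lebn lborel.sigma_finite_measure_axioms \<Theta>_meas] by simp
  also have "\<dots> = (\<integral>\<^sup>+ r. of_nat (Suc k) * (\<integral>\<^sup>+ y. \<Psi> (r(k := y)) \<partial>lborel) \<partial>lebn k)"
  proof (rule nn_integral_cong)
    fix r :: "nat \<Rightarrow> real" assume r: "r \<in> space (lebn k)"
    \<comment> \<open>The level set of - x r at height y is the zero set of y + x r, whose size is
      known from the support hypothesis.\<close>
    let ?P = "- pCons 0 (coeffs_poly k r)"
    have "(\<integral>\<^sup>+ t. \<Psi> (r(k := poly ?P t)) * ennreal \<bar>poly (pderiv ?P) t\<bar> \<partial>lborel)
       = of_nat (Suc k) * (\<integral>\<^sup>+ y. \<Psi> (r(k := y)) \<partial>lborel)"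
    proof (rule poly_area)
      show "pderiv ?P \<noteq> 0"
        by (simp add: pderiv_minus pderiv_eq_0_iff)
      show "(\<lambda>y. \<Psi> (r(k := y))) \<in> borel_measurable borel"
        using r by measurable
      fix y assume y: "\<Psi> (r(k := y)) \<noteq> 0"
      have "r(k := y) \<in> space (lebn (Suc k))"
        using r by (auto simp: space_lebn extensional_def)
      from Suc.prems(2)[OF this y] have "card {x. poly (pCons y (coeffs_poly k (r(k := y)))) x = 0} = Suc k"
        by (simp only: coeffs_poly.simps fun_upd_same)
      also have "coeffs_poly k (r(k := y)) = coeffs_poly k r"
        by (rule coeffs_poly_cong) simp
      also have "{x. poly (pCons y (coeffs_poly k r)) x = 0} = {t. poly ?P t = y}"
        by (auto simp: algebra_simps)
      finally show "card {t. poly ?P t = y} = Suc k" .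
    qed
    then show "(\<integral>\<^sup>+ t. \<Theta> t r \<partial>lborel) = of_nat (Suc k) * (\<integral>\<^sup>+ y. \<Psi> (r(k := y)) \<partial>lborel)"
      unfolding \<Theta>_def pderiv_minus poly_minus abs_minus_cancel poly_pCons by simp
  qed
  also have "\<dots> = of_nat (Suc k) * (\<integral>\<^sup>+ r. (\<integral>\<^sup>+ y. \<Psi> (r(k := y)) \<partial>lborel) \<partial>lebn k)"
    by (rule nn_integral_cmult) measurable
  also have "(\<integral>\<^sup>+ r. (\<integral>\<^sup>+ y. \<Psi> (r(k := y)) \<partial>lborel) \<partial>lebn k) = (\<integral>\<^sup>+ c. \<Psi> c \<partial>lebn (Suc k))"
    by (rule nn_integral_lebn_Suc[symmetric]) measurable
  finally show ?case by (simp add: mult_ac)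
qed

subsection \<open>Secular equation and interlacing\<close>

text \<open>The Lagrange denominators: for i < k, the derivative of \<open>roots_poly k x\<close> at
  its root x i.\<close>

definition node :: "nat \<Rightarrow> (nat \<Rightarrow> real) \<Rightarrow> nat \<Rightarrow> real" where
  "node k x i = (\<Prod>j\<in>{..<k} - {i}. x i - x j)"

definition cofactor_poly :: "nat \<Rightarrow> (nat \<Rightarrow> real) \<Rightarrow> nat \<Rightarrow> real poly" where
  "cofactor_poly k x i = (\<Prod>j\<in>{..<k} - {i}. [:- x j, 1:])"

lemma poly_cofactor_poly: "poly (cofactor_poly k x i) t = (\<Prod>j\<in>{..<k} - {i}. t - x j)"
  by (simp add: cofactor_poly_def poly_prod)

lemma poly_cofactor_poly_node:
  "poly (cofactor_poly k x i) (x i) = node k x i"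
  "j < k \<Longrightarrow> j \<noteq> i \<Longrightarrow> poly (cofactor_poly k x i) (x j) = 0"
  by (auto simp: poly_cofactor_poly node_def)

lemma poly_roots_poly_node: "i < k \<Longrightarrow> poly (roots_poly k x) (x i) = 0"
  by (auto simp: poly_roots_poly)

lemma node_neq_0: "inj_on x {..<k} \<Longrightarrow> i < k \<Longrightarrow> node k x i \<noteq> 0"
  by (auto simp: node_def inj_on_def)

lemma roots_poly_cofactor: "i < k \<Longrightarrow> roots_poly k x = [:- x i, 1:] * cofactor_poly k x i"
  unfolding roots_poly_def cofactor_poly_def by (subst prod.remove[of _ i]) auto

lemma degree_cofactor_poly: "i < k \<Longrightarrow> degree (cofactor_poly k x i) = k - 1"
  unfolding cofactor_poly_def by (subst degree_prod_eq_sum_degree) auto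

lemma lead_coeff_cofactor_poly: "i < k \<Longrightarrow> coeff (cofactor_poly k x i) (k - 1) = 1"
  using lead_coeff_prod[of "\<lambda>j. [:- x j, 1:]" "{..<k} - {i}"] degree_cofactor_poly[of i k x]
  by (simp add: cofactor_poly_def)

lemma pderiv_roots_poly: "pderiv (roots_poly k x) = (\<Sum>i<k. cofactor_poly k x i)"
  unfolding roots_poly_def cofactor_poly_def pderiv_prod by (intro sum.cong) (auto simp: pderiv_pCons one_pCons)

lemma poly_pderiv_roots_poly_node:
  assumes "i < k"
  shows "poly (pderiv (roots_poly k x)) (x i) = node k x i"
proof -
  have "poly (pderiv (roots_poly k x)) (x i) = (\<Sum>j<k. poly (cofactor_poly k x j) (x i))"
    by (simp add: pderiv_roots_poly poly_sum)
  also have "\<dots> = (\<Sum>j<k. if j = i then node k x i else 0)"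
    using assms by (intro sum.cong) (auto simp: poly_cofactor_poly_node)
  finally show ?thesis using assms by simp
qed

text \<open>Each unordered pair contributes its difference twice, with opposite signs. Squaring
  removes the resulting sign, which depends on k.\<close>

lemma prod_node: "(\<Prod>i<k. node k x i) ^ 2 = vandermonde k x ^ 4"
proof (induction k)
  case (Suc k)
  have "node (Suc k) x i = node k x i * (x i - x k)" if "i < k" for i
  proof -
    have "{..<Suc k} - {i} = insert k ({..<k} - {i})" using that by auto
    then show ?thesis by (simp add: node_def mult.commute)
  qed
  moreover have "node (Suc k) x k = (\<Prod>j<k. x k - x j)"
    unfolding node_def by (rule prod.cong) auto
  moreover have "(\<Prod>i<k. x i - x k) ^ 2 = (\<Prod>i<k. x k - x i) ^ 2"
    by (simp add: prod_power_distrib power2_commute)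
  ultimately show ?case
    using Suc by (simp add: prod.distrib vandermonde_Suc power_mult_distrib power4_eq_xxxx power2_eq_square mult_ac)
qed (simp add: vandermonde_def)

lemma prod_abs_node: "(\<Prod>i<k. \<bar>node k x i\<bar>) = \<bar>vandermonde k x\<bar> ^ 2"
proof -
  have "(\<Prod>i<k. \<bar>node k x i\<bar>) ^ 2 = (\<bar>vandermonde k x\<bar> ^ 2) ^ 2"
    using prod_node[of k x] by (simp add: abs_prod[symmetric] flip: power_mult)
  then show ?thesis
    by (rule power2_eq_imp_eq) (simp_all add: prod_nonneg)
qed

text \<open>The denominator of node k is left out. The differences of the other nodes to node k
  enlarge one of the two Vandermonde products by one point.\<close>

lemma prod_abs_node_Suc:
  "(\<Prod>i<k. \<bar>node (Suc k) x i\<bar>) = \<bar>vandermonde k x\<bar> * \<bar>vandermonde (Suc k) x\<bar>"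
proof -
  have "node (Suc k) x i = node k x i * (x i - x k)" if "i < k" for i
  proof -
    have "{..<Suc k} - {i} = insert k ({..<k} - {i})" using that by auto
    then show ?thesis by (simp add: node_def mult.commute)
  qed
  moreover have "(\<Prod>i<k. \<bar>x i - x k\<bar>) = (\<Prod>i<k. \<bar>x k - x i\<bar>)"
    by (simp add: abs_minus_commute)
  ultimately show ?thesis
    using prod_abs_node[of k x]
    by (simp add: abs_mult prod.distrib vandermonde_Suc power2_eq_square mult_ac abs_prod)
qed

lemma measurable_node:
  assumes "\<And>i. i < k \<Longrightarrow> (\<lambda>x. f x i) \<in> borel_measurable N" "i < k"
  shows "(\<lambda>x. node k (f x) i) \<in> borel_measurable N"
  unfolding node_def using assms by (intro borel_measurable_prod borel_measurable_diff) auto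

text \<open>The condition on the coefficients forces a nonzero \<open>D\<close> to have degree below
  k, and k distinct zeros are too many for that.\<close>

lemma poly_eq_0_on_nodes:
  fixes D :: "real poly"
  assumes inj: "inj_on x {..<k}" and "\<And>i. i < k \<Longrightarrow> poly D (x i) = 0" and "\<And>i. k \<le> i \<Longrightarrow> coeff D i = 0"
  shows "D = 0"
proof (rule ccontr)
  assume "D \<noteq> 0"
  then have "degree D < k" using assms(3)[of "degree D"] by (cases "degree D < k") auto
  moreover have "k \<le> card {t. poly D t = 0}"
    using card_mono[OF poly_roots_finite[OF \<open>D \<noteq> 0\<close>], of "x ` {..<k}"] assms(2) card_image[OF inj] by auto
  ultimately show False using card_poly_roots_bound[OF \<open>D \<noteq> 0\<close>] by simp
qed

lemma coeff_roots_poly_second: "coeff (roots_poly (Suc m) x) m = - (\<Sum>i<Suc m. x i)"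
proof (induction m)
  case (Suc m)
  show ?case unfolding roots_poly_Suc[of "Suc m"] using Suc by simp
qed (simp add: roots_poly_def)

text \<open>Partial fractions of P / Q and of Q / P, for monic P of degree k + 1 and Q of degree k.\<close>

lemma secular_equation:
  assumes inj: "inj_on x {..<k}" and P: "degree P = Suc k" "coeff P (Suc k) = 1"
  shows "P = [:- (- coeff P k - (\<Sum>i<k. x i)), 1:] * roots_poly k x
    - (\<Sum>i<k. Polynomial.smult (- poly P (x i) / node k x i) (cofactor_poly k x i))" (is "P = ?R")
proof -
  let ?d = "- coeff P k - (\<Sum>i<k. x i)" and ?w = "\<lambda>i. - poly P (x i) / node k x i"
  let ?S = "\<Sum>i<k. Polynomial.smult (?w i) (cofactor_poly k x i)"
  have S0: "coeff ?S i = 0" if "k \<le> i" for i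
    using that degree_cofactor_poly[of _ k x]
    unfolding coeff_sum coeff_smult by (intro sum.neutral ballI) (simp add: coeff_eq_0)
  have "P - ?R = 0"
  proof (rule poly_eq_0_on_nodes[OF inj])
    fix i assume i: "i < k"
    have "poly ?S (x i) = (\<Sum>j<k. if j = i then ?w i * node k x i else 0)"
      unfolding poly_sum poly_smult
      using i by (intro sum.cong) (auto simp: poly_cofactor_poly_node)
    also have "\<dots> = - poly P (x i)"
      using i node_neq_0[OF inj i] by simp
    finally have "poly ?S (x i) = - poly P (x i)" .
    moreover have "poly (roots_poly k x) (x i) = 0"
      using i by (auto simp: poly_roots_poly)
    ultimately show "poly (P - ?R) (x i) = 0" by simp
  next
    fix i assume i: "k \<le> i"
    \<comment> \<open>The constant ?d is chosen to match this coefficient. The difference of the two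
      sides then has degree below k and vanishes at k nodes.\<close>
    have second: "coeff ([:- ?d, 1:] * roots_poly k x) k = coeff P k"
    proof (cases k)
      case (Suc m)
      then show ?thesis
        using coeff_roots_poly_second[of m x] lead_coeff_roots_poly[of "Suc m" x]
        by (simp del: sum.lessThan_Suc lead_coeff_roots_poly)
    qed (simp add: roots_poly_def)
    consider "i = k" | "i = Suc k" | "i > Suc k" using i by linarith
    then show "coeff (P - ?R) i = 0"
    proof cases
      case 1
      then show ?thesis using second S0[OF i] by (simp only: coeff_diff)
    next
      case 2
      then show ?thesis using P S0[OF i] by (simp add: coeff_eq_0)
    next
      case 3
      then obtain i' where "i = Suc i'" "i' > k" by (cases i) auto
      with 3 show ?thesis using P S0[OF i] by (simp add: coeff_eq_0)
    qed
  qed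
  then show ?thesis by simp
qed

lemma lagrange_equation:
  assumes inj: "inj_on x {..<Suc k}" and Q: "degree Q = k" "coeff Q k = 1"
  shows "Q = (\<Sum>i<Suc k. Polynomial.smult (poly Q (x i) / node (Suc k) x i) (cofactor_poly (Suc k) x i))" (is "Q = ?R")
    and "(\<Sum>i<Suc k. poly Q (x i) / node (Suc k) x i) = 1"
proof -
  let ?w = "\<lambda>i. poly Q (x i) / node (Suc k) x i"
  have "Q - ?R = 0"
  proof (rule poly_eq_0_on_nodes[OF inj])
    fix i assume i: "i < Suc k"
    have "poly ?R (x i) = (\<Sum>j<Suc k. if j = i then ?w i * node (Suc k) x i else 0)"
      unfolding poly_sum poly_smult
      using i by (intro sum.cong) (auto simp: poly_cofactor_poly_node)
    also have "\<dots> = poly Q (x i)"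
      using i node_neq_0[OF inj i] by (simp del: sum.lessThan_Suc)
    finally show "poly (Q - ?R) (x i) = 0" by simp
  next
    fix i assume i: "Suc k \<le> i"
    have "coeff ?R i = 0"
      using i degree_cofactor_poly[of _ "Suc k" x]
      unfolding coeff_sum coeff_smult by (intro sum.neutral ballI) (simp add: coeff_eq_0)
    then show "coeff (Q - ?R) i = 0" using i Q by (simp add: coeff_eq_0)
  qed
  then show eq: "Q = ?R" by simp
  \<comment> \<open>The leading coefficients are compared: all cofactors and Q are monic of degree
    k.\<close>
  have "coeff ?R k = (\<Sum>i<Suc k. ?w i)"
    unfolding coeff_sum coeff_smult
    using lead_coeff_cofactor_poly[of _ "Suc k" x] by (intro sum.cong) simp_all
  moreover have "coeff Q k = coeff ?R k" using eq by (rule arg_cong)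
  ultimately show "(\<Sum>i<Suc k. ?w i) = 1" using Q by (simp only:)
qed

text \<open>The numerator of \<alpha> (t - d) - \<Sum> w i / (t - x i) over the common denominator
  \<open>roots_poly k x\<close>. The case \<alpha> = 1 gives the characteristic polynomial of a
  bordered diagonal matrix; the case \<alpha> = 0 gives minus the polynomial of the minor, over the
  nodes of the whole matrix.\<close>

definition herglotz_poly :: "real \<Rightarrow> real \<Rightarrow> nat \<Rightarrow> (nat \<Rightarrow> real) \<Rightarrow> (nat \<Rightarrow> real) \<Rightarrow> real poly" where
  "herglotz_poly \<alpha> d k x w = Polynomial.smult \<alpha> ([:- d, 1:] * roots_poly k x)
    - (\<Sum>i<k. Polynomial.smult (w i) (cofactor_poly k x i))"

text \<open>This is Q^2 times the derivative of the quotient P / Q, which is \<alpha> + \<Sum> w i /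
  (t - x i)^2. Since \<open>cofactor_poly k x i\<close> is Q / (t - x i), the identity holds without
  denominators and includes the nodes.\<close>

lemma herglotz_wronskian:
  "poly (pderiv (herglotz_poly \<alpha> d k x w)) t * poly (roots_poly k x) t
      - poly (herglotz_poly \<alpha> d k x w) t * poly (pderiv (roots_poly k x)) t
    = \<alpha> * (poly (roots_poly k x) t)\<^sup>2 + (\<Sum>i<k. w i * (poly (cofactor_poly k x i) t)\<^sup>2)"
proof -
  let ?Q = "roots_poly k x" and ?C = "cofactor_poly k x"
  have C: "poly (pderiv (?C i)) t * poly ?Q t - poly (?C i) t * poly (pderiv ?Q) t = - (poly (?C i) t)\<^sup>2"
    if "i < k" for i
  proof -
    have "pderiv [:- x i, 1:] = 1" by (simp add: pderiv_pCons one_pCons)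
    then have "pderiv ?Q = ?C i + [:- x i, 1:] * pderiv (?C i)"
      unfolding roots_poly_cofactor[OF that] by (simp add: pderiv_mult del: mult_pCons_left)
    then have 1: "poly (pderiv ?Q) t = poly (?C i) t + (t - x i) * poly (pderiv (?C i)) t"
      by (simp del: mult_pCons_left)
    have 2: "poly ?Q t = (t - x i) * poly (?C i) t"
      unfolding roots_poly_cofactor[OF that] by (simp del: mult_pCons_left)
    show ?thesis unfolding 1 2 by (simp add: power2_eq_square algebra_simps)
  qed
  have "poly (pderiv (herglotz_poly \<alpha> d k x w)) t * poly ?Q t - poly (herglotz_poly \<alpha> d k x w) t * poly (pderiv ?Q) t
    = \<alpha> * (poly ?Q t)\<^sup>2 - (\<Sum>i<k. w i * (poly (pderiv (?C i)) t * poly ?Q t - poly (?C i) t * poly (pderiv ?Q) t))"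
    unfolding herglotz_poly_def
    by (simp add: pderiv_diff pderiv_smult pderiv_mult pderiv_sum pderiv_pCons poly_sum sum_distrib_left
       sum_distrib_right sum_subtractf power2_eq_square algebra_simps)
  also have "(\<Sum>i<k. w i * (poly (pderiv (?C i)) t * poly ?Q t - poly (?C i) t * poly (pderiv ?Q) t))
    = - (\<Sum>i<k. w i * (poly (?C i) t)\<^sup>2)"
    using C by (simp add: sum_negf[symmetric])
  finally show ?thesis by simp
qed

text \<open>At a node x i the i-th cofactor does not vanish, away from the nodes none does. Strict
  positivity at every real t shows that real zeros of the numerator are simple and are not
  nodes.\<close>

lemma herglotz_wronskian_pos:
  assumes inj: "inj_on x {..<k}" and w: "\<And>i. i < k \<Longrightarrow> w i > 0" and \<alpha>: "\<alpha> \<ge> 0" "\<alpha> > 0 \<or> k > 0"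
  shows "poly (pderiv (herglotz_poly \<alpha> d k x w)) t * poly (roots_poly k x) t
      - poly (herglotz_poly \<alpha> d k x w) t * poly (pderiv (roots_poly k x)) t > 0"
proof -
  have nn: "0 \<le> w i * (poly (cofactor_poly k x i) t)\<^sup>2" if "i < k" for i
    using w[OF that] by simp
  show ?thesis
  proof (cases "k = 0")
    case True
    then show ?thesis unfolding herglotz_wronskian using \<alpha> by (simp add: roots_poly_def)
  next
    case False
    have "\<exists>i<k. poly (cofactor_poly k x i) t \<noteq> 0"
    proof (cases "\<exists>i<k. t = x i")
      case True
      then show ?thesis using node_neq_0[OF inj] by (auto simp: poly_cofactor_poly_node)
    next
      case no: False
      then show ?thesis using False by (intro exI[of _ 0]) (auto simp: poly_cofactor_poly)
    qed
    then obtain i where "i < k" "poly (cofactor_poly k x i) t \<noteq> 0" by blast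
    then have "0 < (\<Sum>i<k. w i * (poly (cofactor_poly k x i) t)\<^sup>2)"
      using w nn by (intro sum_pos2[of _ i]) auto
    then show ?thesis unfolding herglotz_wronskian using \<alpha>(1)
      by (intro add_nonneg_pos) simp_all
  qed
qed

text \<open>A rational function that maps the upper half-plane to itself has only real zeros.\<close>

lemma herglotz_card_roots:
  assumes inj: "inj_on x {..<k}" and w: "\<And>i. i < k \<Longrightarrow> w i > 0" and \<alpha>: "\<alpha> \<ge> 0" "\<alpha> > 0 \<or> k > 0"
  shows "card {t. poly (herglotz_poly \<alpha> d k x w) t = 0} = degree (herglotz_poly \<alpha> d k x w)"
proof -
  let ?P = "herglotz_poly \<alpha> d k x w"
  interpret h: map_poly_idom_hom "of_real :: real \<Rightarrow> complex" ..
  define Pc where "Pc = map_poly complex_of_real ?P"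
  have poly_real: "poly Pc (of_real t) = of_real (poly ?P t)" for t
    unfolding Pc_def by simp
  have pderiv_real: "poly (pderiv Pc) (of_real t) = of_real (poly (pderiv ?P) t)" for t
    unfolding Pc_def of_real_hom.map_poly_pderiv[symmetric] by simp
  have poly_Pc: "poly Pc z = of_real \<alpha> * ((z - of_real d) * (\<Prod>i<k. z - of_real (x i)))
      - (\<Sum>i<k. of_real (w i) * (\<Prod>j\<in>{..<k} - {i}. z - of_real (x j)))" for z
    unfolding Pc_def herglotz_poly_def roots_poly_def cofactor_poly_def
    by (simp add: h.hom_minus h.hom_mult h.hom_sum h.hom_prod of_real_hom.map_poly_hom_smult
      of_real_hom.map_poly_pCons_hom poly_prod poly_sum del: mult_pCons_left)
  have nonreal: "poly Pc z \<noteq> 0" if "Im z \<noteq> 0" for z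
  proof
    assume z0: "poly Pc z = 0"
    have nz: "z - of_real r \<noteq> 0" for r using that by (metis Im_complex_of_real eq_iff_diff_eq_0)
    define q where "q = (\<Prod>i<k. z - of_real (x i))"
    have "q \<noteq> 0" using nz by (simp add: q_def)
    have cof: "(\<Prod>j\<in>{..<k} - {i}. z - of_real (x j)) = q / (z - of_real (x i))" if "i < k" for i
      using that nz[of "x i"] by (simp add: q_def prod.remove[of "{..<k}" i] field_simps)
    have "0 = q * (of_real \<alpha> * (z - of_real d) - (\<Sum>i<k. of_real (w i) / (z - of_real (x i))))"
      using z0 unfolding poly_Pc q_def[symmetric]
      by (simp add: cof algebra_simps sum_distrib_left)
    with \<open>q \<noteq> 0\<close> have "0 = of_real \<alpha> * (z - of_real d) - (\<Sum>i<k. of_real (w i) / (z - of_real (x i)))"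
      by simp
    \<comment> \<open>Each term - w / (z - x) with w > 0 has an imaginary part of the sign of Im z,
      and \<alpha> (z - d) does not oppose it. So a nonreal zero is impossible.\<close>
    then have "0 = Im (of_real \<alpha> * (z - of_real d) - (\<Sum>i<k. of_real (w i) / (z - of_real (x i))))"
      by simp
    also have "\<dots> = \<alpha> * Im z + (\<Sum>i<k. w i * Im z / (cmod (z - of_real (x i)))\<^sup>2)"
      by (simp add: Im_divide sum_negf[symmetric] cmod_power2 Im_sum)
    also have "\<dots> = Im z * (\<alpha> + (\<Sum>i<k. w i / (cmod (z - of_real (x i)))\<^sup>2))"
      by (simp add: algebra_simps sum_distrib_left)
    finally have "\<alpha> + (\<Sum>i<k. w i / (cmod (z - of_real (x i)))\<^sup>2) = 0"
      using that by simp
    moreover have pos: "w i / (cmod (z - of_real (x i)))\<^sup>2 > 0" if "i < k" for i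
      using w[OF that] nz[of "x i"] by simp
    moreover have "\<alpha> + (\<Sum>i<k. w i / (cmod (z - of_real (x i)))\<^sup>2) > 0"
    proof (cases "k = 0")
      case False
      then have "(\<Sum>i<k. w i / (cmod (z - of_real (x i)))\<^sup>2) > 0"
        using pos by (intro sum_pos) auto
      then show ?thesis using \<alpha>(1) by linarith
    qed (use \<alpha> in simp)
    ultimately show False by simp
  qed
  \<comment> \<open>A multiple root would be real and would make the Wronskian vanish. Without
    multiple roots the degree counts the distinct complex roots.\<close>
  have "rsquarefree Pc"
    unfolding rsquarefree_roots
  proof (intro allI notI, elim conjE)
    fix a assume a: "poly Pc a = 0" "poly (pderiv Pc) a = 0"
    with nonreal[of a] have "a = of_real (Re a)" by (auto simp: complex_eq_iff)
    then obtain t where t: "a = of_real t" by blast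
    have "poly (pderiv ?P) t * poly (roots_poly k x) t - poly ?P t * poly (pderiv (roots_poly k x)) t > 0"
      by (rule herglotz_wronskian_pos[OF inj _ \<alpha>]) (rule w)
    then show False
      using a unfolding t poly_real pderiv_real by simp
  qed
  from complex_poly_decompose_rsquarefree[OF this]
  have "degree Pc = degree (Polynomial.smult (lead_coeff Pc) (\<Prod>z|poly Pc z = 0. [:-z, 1:]))"
    by simp
  moreover have "Pc \<noteq> 0" using \<open>rsquarefree Pc\<close> by (auto simp: rsquarefree_def)
  ultimately have "degree Pc = card {z. poly Pc z = 0}"
    by (simp add: degree_prod_eq_sum_degree)
  also have "{z. poly Pc z = 0} = of_real ` {t. poly ?P t = 0}"
  proof (intro equalityI subsetI)
    fix z assume "z \<in> {z. poly Pc z = 0}"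
    then have z: "poly Pc z = 0" by simp
    with nonreal[of z] have zr: "z = of_real (Re z)" by (auto simp: complex_eq_iff)
    with z poly_real[of "Re z"] have "poly ?P (Re z) = 0" by simp
    with zr show "z \<in> of_real ` {t. poly ?P t = 0}" by blast
  qed (auto simp: poly_real)
  also have "card \<dots> = card {t. poly ?P t = 0}"
    by (intro card_image inj_onI) simp
  also have "degree Pc = degree ?P"
    unfolding Pc_def by simp
  finally show ?thesis ..
qed

text \<open>Both positivity conditions say that the x i and the y j strictly interlace.\<close>

lemma interlacing_weights:
  assumes injx: "inj_on x {..<k}" and injy: "inj_on y {..<Suc k}"
  defines "P \<equiv> roots_poly (Suc k) y" and "Q \<equiv> roots_poly k x"
  shows "(\<forall>i<k. - poly P (x i) / node k x i > 0) \<longleftrightarrow> (\<forall>j<Suc k. poly Q (y j) / node (Suc k) y j > 0)"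
proof
  assume pos: "\<forall>i<k. - poly P (x i) / node k x i > 0"
  let ?w = "\<lambda>i. - poly P (x i) / node k x i"
  define d where "d = - coeff P k - (\<Sum>i<k. x i)"
  \<comment> \<open>At a root y j of P the Wronskian reduces to P'(y j) Q(y j). Its positivity says
    that the quotient of Q(y j) by P'(y j) is positive.\<close>
  have P: "P = herglotz_poly 1 d k x ?w"
    using secular_equation[OF injx, of P] unfolding herglotz_poly_def d_def P_def by simp
  show "\<forall>j<Suc k. poly Q (y j) / node (Suc k) y j > 0"
  proof (intro allI impI)
    fix j assume j: "j < Suc k"
    have "poly (pderiv P) (y j) * poly Q (y j) - poly P (y j) * poly (pderiv Q) (y j) > 0"
      using herglotz_wronskian_pos[OF injx, of ?w 1 d "y j"] pos unfolding P[symmetric] Q_def by simp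
    moreover have "poly P (y j) = 0" unfolding P_def by (rule poly_roots_poly_node[OF j])
    moreover have "poly (pderiv P) (y j) = node (Suc k) y j"
      unfolding P_def by (rule poly_pderiv_roots_poly_node[OF j])
    ultimately show "poly Q (y j) / node (Suc k) y j > 0"
      by (simp add: zero_less_divide_iff zero_less_mult_iff) auto
  qed
next
  assume pos: "\<forall>j<Suc k. poly Q (y j) / node (Suc k) y j > 0"
  let ?r = "\<lambda>j. poly Q (y j) / node (Suc k) y j"
  \<comment> \<open>The roles are exchanged through - Q / P, which tends to 0 at infinity; hence
    \<alpha> = 0.\<close>
  have Q: "- Q = herglotz_poly 0 0 (Suc k) y ?r"
    using lagrange_equation(1)[OF injy, of Q] unfolding herglotz_poly_def Q_def by simp
  show "\<forall>i<k. - poly P (x i) / node k x i > 0"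
  proof (intro allI impI)
    fix i assume i: "i < k"
    have "poly (pderiv (- Q)) (x i) * poly P (x i) - poly (- Q) (x i) * poly (pderiv P) (x i) > 0"
      using herglotz_wronskian_pos[OF injy, of ?r 0 0 "x i"] pos unfolding Q[symmetric] P_def by simp
    moreover have "poly Q (x i) = 0" unfolding Q_def by (rule poly_roots_poly_node[OF i])
    moreover have "poly (pderiv Q) (x i) = node k x i"
      unfolding Q_def by (rule poly_pderiv_roots_poly_node[OF i])
    ultimately show "- poly P (x i) / node k x i > 0"
      by (simp add: pderiv_minus zero_less_divide_iff zero_less_mult_iff divide_less_0_iff mult_less_0_iff) auto
  qed
qed

section \<open>Jacobians from coefficients to values and to border data\<close>

lemma nn_integral_scale_lebn:
  fixes a b :: "nat \<Rightarrow> real"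
  assumes "\<And>i. i < k \<Longrightarrow> a i \<noteq> 0" "\<Phi> \<in> borel_measurable (lebn k)"
  shows "(\<Prod>i<k. ennreal \<bar>a i\<bar>) * (\<integral>\<^sup>+ x. \<Phi> (\<lambda>i\<in>{..<k}. a i * x i + b i) \<partial>lebn k) = (\<integral>\<^sup>+ x. \<Phi> x \<partial>lebn k)"
  using nn_integral_lower_triangular[of k a "\<lambda>i _. b i" \<Phi>] assms by simp

text \<open>Evaluation at the nodes is affine in the coefficients, with a Vandermonde matrix as
  linear part. At the last node t the value y = p(t) replaces the constant term, which is a
  translation. The other values are y + (x i - t) q(x i), where q is the quotient of p - y by x - t;
  so the induction hypothesis applies to q, and its values are then scaled by x i - t.\<close>

lemma nn_integral_eval_coeffs_poly:
  assumes "inj_on x {..<m}" and "\<Phi> \<in> borel_measurable (lebn m)"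
  shows "ennreal \<bar>vandermonde m x\<bar> * (\<integral>\<^sup>+ c. \<Phi> (\<lambda>i\<in>{..<m}. poly (coeffs_poly m c) (x i)) \<partial>lebn m)
    = (\<integral>\<^sup>+ y. \<Phi> y \<partial>lebn m)"
  using assms
proof (induction m arbitrary: \<Phi>)
  case 0
  show ?case unfolding nn_integral_lebn_0 by (simp add: vandermonde_def restrict_def)
next
  case (Suc m)
  note \<Phi> [measurable] = Suc.prems(2)
  define t where "t = x m"
  have inj: "inj_on x {..<m}"
    using Suc.prems(1) by (auto simp: lessThan_Suc)
  have neq: "x i \<noteq> t" if "i < m" for i
    using inj_onD[OF Suc.prems(1), of i m] that by (auto simp: t_def)
  \<comment> \<open>The values of p = a + x r at all nodes, with a chosen such that p(t) =
    y.\<close>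
  define R where "R r y = (\<lambda>i\<in>{..<Suc m}. y + (x i * poly (coeffs_poly m r) (x i) - t * poly (coeffs_poly m r) t))" for r y
  have pc: "(\<lambda>p. poly (coeffs_poly m (fst p)) s) \<in> borel_measurable (lebn m \<Otimes>\<^sub>M lborel)" for s
    by (intro measurable_poly_coeffs_poly) (simp_all add: measurable_compose[OF measurable_fst measurable_lebn_nth])
  have R_meas: "(\<lambda>(r, y). R r y) \<in> lebn m \<Otimes>\<^sub>M lborel \<rightarrow>\<^sub>M lebn (Suc m)"
    unfolding R_def split_beta'
    by (intro measurable_lebnI borel_measurable_add borel_measurable_diff borel_measurable_times pc) simp_all
  have \<Phi>R_meas: "(\<lambda>(r, y). \<Phi> (R r y)) \<in> borel_measurable (lebn m \<Otimes>\<^sub>M lborel)"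
    using measurable_compose[OF R_meas \<Phi>] by (simp add: split_beta')
  then have \<Xi>: "(\<lambda>r. \<integral>\<^sup>+ y. \<Phi> (R r y) \<partial>lborel) \<in> borel_measurable (lebn m)"
    by (intro measurable_nn_integral[OF lborel.sigma_finite_measure_axioms])
  \<comment> \<open>The same values in terms of the values z of the quotient q at the first m
    nodes.\<close>
  define S where "S y z = (\<lambda>i\<in>{..<m}. (x i - t) * z i + y)(m := y)" for y and z :: "nat \<Rightarrow> real"
  have S_meas: "(\<lambda>(y, z). S y z) \<in> lborel \<Otimes>\<^sub>M lebn m \<rightarrow>\<^sub>M lebn (Suc m)"
    unfolding S_def split_beta'
    by (intro measurable_lebn_upd measurable_lebnI)
       (simp_all add: measurable_compose[OF measurable_snd measurable_lebn_nth])
  have \<Phi>S_meas: "(\<lambda>(y, z). \<Phi> (S y z)) \<in> borel_measurable (lborel \<Otimes>\<^sub>M lebn m)"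
    using measurable_compose[OF S_meas \<Phi>] by (simp add: split_beta')
  have \<Phi>S: "(\<lambda>z. \<Phi> (S y z)) \<in> borel_measurable (lebn m)" for y
  proof -
    have "(\<lambda>z. (y, z)) \<in> lebn m \<rightarrow>\<^sub>M lborel \<Otimes>\<^sub>M lebn m" by simp
    from measurable_compose[OF this \<Phi>S_meas] show ?thesis by simp
  qed
  define E where "E c = (\<lambda>i\<in>{..<m}. poly (coeffs_poly m c) (x i))" for c
  have E_meas: "E \<in> lebn m \<rightarrow>\<^sub>M lebn m"
    unfolding E_def by (intro measurable_lebnI measurable_poly_coeffs_poly) simp_all
  have RS: "R (\<lambda>i\<in>{..<m}. shift_coeffs t q i) y = S y (E q)" for q y
  proof -
    let ?r = "\<lambda>i\<in>{..<m}. shift_coeffs t q i"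
    have "coeffs_poly m ?r = coeffs_poly m (shift_coeffs t q)"
      by (rule coeffs_poly_cong) simp
    then have "poly ([:- t, 1:] * coeffs_poly m q) s = - t * poly (coeffs_poly m ?r) t + s * poly (coeffs_poly m ?r) s" for s
      unfolding linear_mult_coeffs_poly' by simp
    then have *: "s * poly (coeffs_poly m ?r) s - t * poly (coeffs_poly m ?r) t = (s - t) * poly (coeffs_poly m q) s" for s
      by (simp add: algebra_simps)
    show ?thesis
      unfolding R_def S_def E_def * by (auto simp: t_def restrict_def less_Suc_eq)
  qed
  have "(\<integral>\<^sup>+ c. \<Phi> (\<lambda>i\<in>{..<Suc m}. poly (coeffs_poly (Suc m) c) (x i)) \<partial>lebn (Suc m))
      = (\<integral>\<^sup>+ r. (\<integral>\<^sup>+ a. \<Phi> (\<lambda>i\<in>{..<Suc m}. a + x i * poly (coeffs_poly m r) (x i)) \<partial>lborel) \<partial>lebn m)"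
  proof -
    have "(\<lambda>c. \<Phi> (\<lambda>i\<in>{..<Suc m}. poly (coeffs_poly (Suc m) c) (x i))) \<in> borel_measurable (lebn (Suc m))"
      by (intro measurable_compose[OF _ \<Phi>] measurable_lebnI measurable_poly_coeffs_poly) simp_all
    moreover have "coeffs_poly m (r(m := a)) = coeffs_poly m r" for r a
      by (rule coeffs_poly_cong) simp
    ultimately show ?thesis by (subst nn_integral_lebn_Suc) simp_all
  qed
  also have "\<dots> = (\<integral>\<^sup>+ r. (\<integral>\<^sup>+ y. \<Phi> (R r y) \<partial>lborel) \<partial>lebn m)"
  proof (rule nn_integral_cong)
    fix r :: "nat \<Rightarrow> real"
    let ?f = "\<lambda>a. \<Phi> (\<lambda>i\<in>{..<Suc m}. a + x i * poly (coeffs_poly m r) (x i))"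
    have "?f \<in> borel_measurable borel"
      by (intro measurable_compose[OF _ \<Phi>] measurable_lebnI) simp_all
    from nn_integral_lborel_translate[OF this, of "- t * poly (coeffs_poly m r) t"]
    show "(\<integral>\<^sup>+ a. ?f a \<partial>lborel) = (\<integral>\<^sup>+ y. \<Phi> (R r y) \<partial>lborel)"
      by (simp add: R_def algebra_simps)
  qed
  also have "\<dots> = (\<integral>\<^sup>+ q. (\<integral>\<^sup>+ y. \<Phi> (S y (E q)) \<partial>lborel) \<partial>lebn m)"
    using nn_integral_shift_coeffs[OF \<Xi>, of t] by (simp only: RS)
  also have "\<dots> = (\<integral>\<^sup>+ y. (\<integral>\<^sup>+ q. \<Phi> (S y (E q)) \<partial>lebn m) \<partial>lborel)"
  proof (rule nn_integral_swap[OF sigma_finite_lebn lborel.sigma_finite_measure_axioms])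
    have "(\<lambda>p. (snd p, E (fst p))) \<in> lebn m \<Otimes>\<^sub>M lborel \<rightarrow>\<^sub>M lborel \<Otimes>\<^sub>M lebn m"
      by (intro measurable_Pair measurable_snd measurable_compose[OF measurable_fst E_meas])
    from measurable_compose[OF this \<Phi>S_meas]
    show "(\<lambda>(q, y). \<Phi> (S y (E q))) \<in> borel_measurable (lebn m \<Otimes>\<^sub>M lborel)"
      by (simp add: split_beta')
  qed
  finally have "ennreal \<bar>vandermonde (Suc m) x\<bar>
      * (\<integral>\<^sup>+ c. \<Phi> (\<lambda>i\<in>{..<Suc m}. poly (coeffs_poly (Suc m) c) (x i)) \<partial>lebn (Suc m))
    = (\<Prod>i<m. ennreal \<bar>x i - t\<bar>) * (ennreal \<bar>vandermonde m x\<bar> * (\<integral>\<^sup>+ y. (\<integral>\<^sup>+ q. \<Phi> (S y (E q)) \<partial>lebn m) \<partial>lborel))"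
    by (simp add: vandermonde_Suc abs_mult abs_prod ennreal_mult' prod_ennreal[symmetric] t_def abs_minus_commute mult_ac)
  also have "ennreal \<bar>vandermonde m x\<bar> * (\<integral>\<^sup>+ y. (\<integral>\<^sup>+ q. \<Phi> (S y (E q)) \<partial>lebn m) \<partial>lborel)
      = (\<integral>\<^sup>+ y. ennreal \<bar>vandermonde m x\<bar> * (\<integral>\<^sup>+ q. \<Phi> (S y (E q)) \<partial>lebn m) \<partial>lborel)"
  proof (rule nn_integral_cmult[symmetric])
    have "(\<lambda>p. (fst p, E (snd p))) \<in> lborel \<Otimes>\<^sub>M lebn m \<rightarrow>\<^sub>M lborel \<Otimes>\<^sub>M lebn m"
      by (intro measurable_Pair measurable_fst measurable_compose[OF measurable_snd E_meas])
    from measurable_compose[OF this \<Phi>S_meas]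
    have "(\<lambda>(y, q). \<Phi> (S y (E q))) \<in> borel_measurable (lborel \<Otimes>\<^sub>M lebn m)"
      by (simp add: split_beta')
    then show "(\<lambda>y. \<integral>\<^sup>+ q. \<Phi> (S y (E q)) \<partial>lebn m) \<in> borel_measurable lborel"
      by (intro measurable_nn_integral[OF sigma_finite_lebn])
  qed
  also have "\<dots> = (\<integral>\<^sup>+ y. (\<integral>\<^sup>+ z. \<Phi> (S y z) \<partial>lebn m) \<partial>lborel)"
    unfolding E_def by (simp only: Suc.IH[OF inj \<Phi>S])
  also have "(\<Prod>i<m. ennreal \<bar>x i - t\<bar>) * \<dots> = (\<integral>\<^sup>+ y. (\<Prod>i<m. ennreal \<bar>x i - t\<bar>) * (\<integral>\<^sup>+ z. \<Phi> (S y z) \<partial>lebn m) \<partial>lborel)"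
    by (rule nn_integral_cmult[symmetric]) (use measurable_nn_integral[OF sigma_finite_lebn \<Phi>S_meas] in simp)
  also have "\<dots> = (\<integral>\<^sup>+ y. (\<integral>\<^sup>+ z. \<Phi> (z(m := y)) \<partial>lebn m) \<partial>lborel)"
  proof (rule nn_integral_cong)
    fix y :: real
    have "(\<lambda>z. \<Phi> (z(m := y))) \<in> borel_measurable (lebn m)" by measurable
    then show "(\<Prod>i<m. ennreal \<bar>x i - t\<bar>) * (\<integral>\<^sup>+ z. \<Phi> (S y z) \<partial>lebn m) = (\<integral>\<^sup>+ z. \<Phi> (z(m := y)) \<partial>lebn m)"
      unfolding S_def using neq by (intro nn_integral_scale_lebn) simp_all
  qed
  also have "\<dots> = (\<integral>\<^sup>+ y. \<Phi> y \<partial>lebn (Suc m))"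
    by (rule nn_integral_lebn_Suc_rev[symmetric]) measurable
  finally show ?case .
qed

lemma ennreal_mult_inverse: "r \<ge> 0 \<Longrightarrow> r \<noteq> 0 \<Longrightarrow> ennreal r * ennreal (inverse r) = 1"
  by (simp flip: ennreal_mult)

lemma ennreal_cancel_real:
  fixes A B :: ennreal
  assumes "r \<noteq> 0" "ennreal \<bar>r\<bar> * A = ennreal \<bar>r\<bar> * B"
  shows "A = B"
  using assms by (simp add: ennreal_mult_cancel_left)

text \<open>The entries of a bordered diagonal matrix as functions of the coefficients c of its
  characteristic polynomial: for i < k the squared modulus of the i-th border entry, and for
  i = k the corner entry.\<close>

definition arrow_data :: "nat \<Rightarrow> (nat \<Rightarrow> real) \<Rightarrow> (nat \<Rightarrow> real) \<Rightarrow> nat \<Rightarrow> real" where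
  "arrow_data k x c = (\<lambda>i\<in>{..<Suc k}. if i < k then - poly (coeffs_poly (Suc k) c) (x i) / node k x i
    else - c 0 - (\<Sum>j<k. x j))"

lemma measurable_arrow_data: "arrow_data k x \<in> lebn (Suc k) \<rightarrow>\<^sub>M lebn (Suc k)"
  unfolding arrow_data_def
proof (rule measurable_lebnI)
  fix i assume "i < Suc k"
  then show "(\<lambda>c. if i < k then - poly (coeffs_poly (Suc k) c) (x i) / node k x i
      else - c 0 - (\<Sum>j<k. x j)) \<in> borel_measurable (lebn (Suc k))"
    using measurable_poly_coeffs_poly(1)[of "Suc k" "\<lambda>c. c" "lebn (Suc k)" "\<lambda>_. x i"]
    by (cases "i < k") (simp_all del: coeffs_poly.simps)
qed

text \<open>The data consist of k scaled values and one coefficient. An auxiliary node z trades this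
  coefficient for the value at z: given the other values, the secular equation at z makes the corner
  affine in it, so the passage from k + 1 values to the data is triangular. With V the Vandermonde
  product of x, evaluation contributes the factor V qz on the left and the triangular map V^2 qz on
  the right; one V remains.\<close>

lemma nn_integral_arrow_data:
  assumes inj: "inj_on x {..<k}" and \<phi> [measurable]: "\<phi> \<in> borel_measurable (lebn (Suc k))"
  shows "(\<integral>\<^sup>+ c. \<phi> (arrow_data k x c) \<partial>lebn (Suc k)) = ennreal \<bar>vandermonde k x\<bar> * (\<integral>\<^sup>+ w. \<phi> w \<partial>lebn (Suc k))"
proof -
  \<comment> \<open>Larger than every |x j|, so z is a further node distinct from the given
    ones.\<close>
  define z where "z = 1 + (\<Sum>j<k. \<bar>x j\<bar>)"
  have z: "z \<noteq> x i" if "i < k" for i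
  proof -
    have "\<bar>x i\<bar> \<le> (\<Sum>j<k. \<bar>x j\<bar>)" using that by (intro member_le_sum) auto
    then show ?thesis unfolding z_def by linarith
  qed
  define x' where "x' = x(k := z)"
  define qz where "qz = (\<Prod>j<k. z - x j)"
  have qz: "qz \<noteq> 0" using z by (auto simp: qz_def)
  have inj': "inj_on x' {..<Suc k}"
    using inj z by (auto simp: x'_def lessThan_Suc inj_on_def)
  have V': "vandermonde (Suc k) x' = vandermonde k x * qz"
    by (simp add: vandermonde_Suc x'_def qz_def vandermonde_cong[of k "x(k := z)" x])
  have V: "vandermonde k x \<noteq> 0" using inj by (simp add: vandermonde_eq_0_iff)
  define a where "a i = (if i < k then - 1 / node k x i else - 1 / qz)" for i
  \<comment> \<open>Solving p(z) = (z - d) qz - S for the corner gives d = z - S / qz - p(z) / qz,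
    where S depends on the first k values only. The last term is the diagonal entry - 1 / qz of
    \<open>a\<close>.\<close>
  define b where "b i y = (if i < k then 0 else z - (\<Sum>j<k. - y j / node k x j * poly (cofactor_poly k x j) z) / qz)"
    for i and y :: "nat \<Rightarrow> real"
  have a: "a i \<noteq> 0" for i
    using node_neq_0[OF inj, of i] qz by (simp add: a_def)
  have b: "b i \<in> borel_measurable (lebn i)" if "i < Suc k" for i
    using that unfolding b_def by (cases "i < k") auto
  define T where "T y = (\<lambda>i\<in>{..<Suc k}. a i * y i + b i (restrict y {..<i}))" for y
  have T: "(\<Prod>i<Suc k. ennreal \<bar>a i\<bar>) * (\<integral>\<^sup>+ y. \<phi> (T y) \<partial>lebn (Suc k)) = (\<integral>\<^sup>+ w. \<phi> w \<partial>lebn (Suc k))"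
    unfolding T_def using a b \<phi> by (intro nn_integral_lower_triangular) auto
  have prod_a: "(\<Prod>i<Suc k. ennreal \<bar>a i\<bar>) = ennreal (inverse (\<bar>vandermonde k x\<bar> ^ 2 * \<bar>qz\<bar>))"
  proof -
    have "(\<Prod>i<k. \<bar>a i\<bar>) = inverse (\<Prod>i<k. \<bar>node k x i\<bar>)"
      unfolding prod_inversef[symmetric] by (intro prod.cong) (simp_all add: a_def divide_inverse abs_mult)
    then have "(\<Prod>i<Suc k. \<bar>a i\<bar>) = inverse (\<bar>vandermonde k x\<bar> ^ 2 * \<bar>qz\<bar>)"
      by (simp add: prod_abs_node a_def divide_inverse)
    then show ?thesis by (simp only: prod_ennreal abs_ge_zero)
  qed
  have T_meas: "T \<in> lebn (Suc k) \<rightarrow>\<^sub>M lebn (Suc k)"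
    unfolding T_def
  proof (rule measurable_lebnI)
    fix i assume i: "i < Suc k"
    have "(\<lambda>y. restrict y {..<i}) \<in> lebn (Suc k) \<rightarrow>\<^sub>M (lebn i :: (nat \<Rightarrow> real) measure)"
      using i by (intro measurable_restrict_subset) auto
    from measurable_compose[OF this b[OF i]] i
    show "(\<lambda>y. a i * y i + b i (restrict y {..<i})) \<in> borel_measurable (lebn (Suc k))" by simp
  qed
  have T_eval: "T (\<lambda>i\<in>{..<Suc k}. poly (coeffs_poly (Suc k) c) (x' i)) = arrow_data k x c" (is "T ?y = _") for c
  proof
    fix i
    let ?P = "coeffs_poly (Suc k) c"
    consider "i < k" | "i = k" | "i > k" by linarith
    then show "T ?y i = arrow_data k x c i"
    proof cases
      case 1
      then show ?thesis by (simp add: T_def a_def b_def arrow_data_def x'_def del: coeffs_poly.simps)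
    next
      case 2
      define d where "d = - coeff ?P k - (\<Sum>j<k. x j)"
      define S where "S = (\<Sum>j<k. - poly ?P (x j) / node k x j * poly (cofactor_poly k x j) z)"
      have ck: "coeff ?P k = c 0"
      proof -
        have "poly_coeffs (Suc k) (coeffs_poly (Suc k) (restrict c {..<Suc k})) 0 = c 0"
          by (subst poly_coeffs_coeffs_poly) auto
        moreover have "coeffs_poly (Suc k) (restrict c {..<Suc k}) = ?P"
          by (rule coeffs_poly_cong) simp
        ultimately show ?thesis by (simp add: poly_coeffs_def del: coeffs_poly.simps)
      qed
      have "poly ?P z = poly ([:- d, 1:] * roots_poly k x
         - (\<Sum>i<k. Polynomial.smult (- poly ?P (x i) / node k x i) (cofactor_poly k x i))) z"
        unfolding d_def
        by (rule arg_cong[where f="\<lambda>p. poly p z"], rule secular_equation[OF inj]) (simp_all del: coeffs_poly.simps)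
      also have "\<dots> = (z - d) * qz - S"
        by (simp add: poly_sum S_def poly_roots_poly qz_def algebra_simps)
      finally have "S + poly ?P z = (z - d) * qz" by linarith
      then have "(S + poly ?P z) / qz = z - d" using qz by (metis nonzero_mult_div_cancel_right)
      then have "d = z - S / qz - poly ?P z / qz"
        unfolding add_divide_distrib by linarith
      moreover have "(\<Sum>j<k. - restrict ?y {..<k} j / node k x j * poly (cofactor_poly k x j) z) = S"
        unfolding S_def by (intro sum.cong) (auto simp: x'_def simp del: coeffs_poly.simps)
      ultimately show ?thesis
        using 2 by (simp add: T_def a_def b_def arrow_data_def d_def ck x'_def del: coeffs_poly.simps)
    qed (simp add: T_def arrow_data_def)
  qed
  have "ennreal \<bar>vandermonde (Suc k) x'\<bar> * (\<integral>\<^sup>+ c. \<phi> (arrow_data k x c) \<partial>lebn (Suc k))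
      = (\<integral>\<^sup>+ y. \<phi> (T y) \<partial>lebn (Suc k))"
    using nn_integral_eval_coeffs_poly[OF inj' measurable_compose[OF T_meas \<phi>]]
    unfolding T_eval .
  then have "ennreal \<bar>vandermonde k x * qz\<bar> * (\<integral>\<^sup>+ c. \<phi> (arrow_data k x c) \<partial>lebn (Suc k))
      = (\<integral>\<^sup>+ y. \<phi> (T y) \<partial>lebn (Suc k))"
    unfolding V' .
  also have "\<dots> = ennreal (\<bar>vandermonde k x\<bar> ^ 2 * \<bar>qz\<bar>) * (\<integral>\<^sup>+ w. \<phi> w \<partial>lebn (Suc k))"
  proof -
    have "ennreal (\<bar>vandermonde k x\<bar> ^ 2 * \<bar>qz\<bar>) * ennreal (inverse (\<bar>vandermonde k x\<bar> ^ 2 * \<bar>qz\<bar>)) = 1"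
      using V qz by (intro ennreal_mult_inverse) simp_all
    then show ?thesis
      unfolding T[symmetric] prod_a by (simp flip: mult.assoc)
  qed
  also have "\<dots> = ennreal \<bar>vandermonde k x * qz\<bar> * (ennreal \<bar>vandermonde k x\<bar> * (\<integral>\<^sup>+ w. \<phi> w \<partial>lebn (Suc k)))"
  proof -
    have "\<bar>vandermonde k x\<bar> ^ 2 * \<bar>qz\<bar> = \<bar>vandermonde k x * qz\<bar> * \<bar>vandermonde k x\<bar>"
      by (simp add: power2_eq_square abs_mult mult_ac)
    then show ?thesis by (simp only: ennreal_mult'[OF abs_ge_zero] mult.assoc)
  qed
  finally have eq: "ennreal \<bar>vandermonde k x * qz\<bar> * (\<integral>\<^sup>+ c. \<phi> (arrow_data k x c) \<partial>lebn (Suc k))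
    = ennreal \<bar>vandermonde k x * qz\<bar> * (ennreal \<bar>vandermonde k x\<bar> * (\<integral>\<^sup>+ w. \<phi> w \<partial>lebn (Suc k)))" .
  have "vandermonde k x * qz \<noteq> 0" using V qz by simp
  then show ?thesis using eq by (rule ennreal_cancel_real)
qed

text \<open>The integral is the volume of the open standard simplex, so the constant equals 1; like
  \<open>gauss_const\<close> it is carried along symbolically.\<close>

definition interlacing_const :: "nat \<Rightarrow> ennreal" where
  "interlacing_const k = fact k * (\<integral>\<^sup>+ r. indicator {r. (\<forall>j<k. r j > 0) \<and> (\<Sum>j<k. r j) < 1} (r :: nat \<Rightarrow> real) \<partial>lebn k)"

text \<open>Let P and Q be the monic polynomials with roots y and x. Interlacing means that the k +
  1 residues of Q / P at the y j are positive; they add up to 1, so the first k of them range over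
  the open simplex. Passing from coefficients of Q to its values at the first k points brings in the
  Vandermonde product of k points, and dividing by the nodes the products of k and of k + 1 points;
  the latter is left over.\<close>

lemma nn_integral_interlacing:
  assumes inj: "inj_on y {..<Suc k}"
  shows "(\<integral>\<^sup>+ x. indicator {x. \<forall>i<k. - poly (roots_poly (Suc k) y) (x i) / node k x i > 0} x
      * ennreal \<bar>vandermonde k x\<bar> \<partial>lebn k) = interlacing_const k * ennreal \<bar>vandermonde (Suc k) y\<bar>"
proof -
  define \<phi> :: "(nat \<Rightarrow> real) \<Rightarrow> ennreal" where
    "\<phi> = indicator {r. (\<forall>j<k. r j > 0) \<and> (\<Sum>j<k. r j) < 1}"
  have \<phi> [measurable]: "\<phi> \<in> borel_measurable (lebn k)"
  proof -
    have "{r \<in> space (lebn k). (\<forall>j\<in>{..<k}. r j > 0) \<and> (\<Sum>j<k. r j) < (1::real)} \<in> sets (lebn k)"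
      by measurable
    then have "indicator {r \<in> space (lebn k). (\<forall>j\<in>{..<k}. r j > 0) \<and> (\<Sum>j<k. r j) < (1::real)} \<in> borel_measurable (lebn k)"
      by (rule borel_measurable_indicator)
    then show ?thesis
      unfolding \<phi>_def by (rule measurable_cong[THEN iffD1, rotated]) (auto simp: indicator_def)
  qed
  define W where "W c = (\<lambda>j\<in>{..<k}. poly (coeffs_poly k c) (y j) / node (Suc k) y j)" for c
  have W_meas: "W \<in> lebn k \<rightarrow>\<^sub>M lebn k"
    unfolding W_def
  proof (rule measurable_lebnI)
    fix j
    show "(\<lambda>c. poly (coeffs_poly k c) (y j) / node (Suc k) y j) \<in> borel_measurable (lebn k)"
      using measurable_poly_coeffs_poly(1)[of k "\<lambda>c. c" "lebn k" "\<lambda>_. y j"] by simp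
  qed
  have \<phi>W: "\<phi> (W c) = indicator {c. \<forall>j<Suc k. poly (coeffs_poly k c) (y j) / node (Suc k) y j > 0} c" for c
  proof -
    \<comment> \<open>The last residue is 1 minus the sum of the others, so its positivity is the
      inequality that bounds the simplex.\<close>
    have "(\<Sum>j<k. W c j) < 1 \<longleftrightarrow> poly (coeffs_poly k c) (y k) / node (Suc k) y k > 0"
    proof -
      have "(\<Sum>j<k. W c j) = (\<Sum>j<k. poly (coeffs_poly k c) (y j) / node (Suc k) y j)"
        by (intro sum.cong) (simp_all add: W_def)
      moreover have "(\<Sum>j<k. poly (coeffs_poly k c) (y j) / node (Suc k) y j)
          + poly (coeffs_poly k c) (y k) / node (Suc k) y k = 1"
        using lagrange_equation(2)[OF inj degree_coeffs_poly lead_coeff_coeffs_poly] by simp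
      ultimately show ?thesis by linarith
    qed
    then show ?thesis by (auto simp: \<phi>_def indicator_def W_def less_Suc_eq)
  qed
  \<comment> \<open>Positive residues make - Q a Herglotz numerator over the nodes y, hence its
    roots are real and simple.\<close>
  have supp: "card {t. poly (coeffs_poly k c) t = 0} = k" if "\<phi> (W c) \<noteq> 0" for c
  proof -
    let ?Q = "coeffs_poly k c" and ?r = "\<lambda>j. poly (coeffs_poly k c) (y j) / node (Suc k) y j"
    have pos: "?r j > 0" if "j < Suc k" for j
      using that \<open>\<phi> (W c) \<noteq> 0\<close> by (auto simp: \<phi>W indicator_def split: if_splits)
    have Q: "- ?Q = herglotz_poly 0 0 (Suc k) y ?r"
      using lagrange_equation(1)[OF inj, of ?Q] unfolding herglotz_poly_def by simp
    have "card {t. poly (- ?Q) t = 0} = degree (- ?Q)"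
      unfolding Q by (rule herglotz_card_roots[OF inj pos]) simp_all
    then show ?thesis by simp
  qed
  have "(\<integral>\<^sup>+ x. indicator {x. \<forall>i<k. - poly (roots_poly (Suc k) y) (x i) / node k x i > 0} x
      * ennreal \<bar>vandermonde k x\<bar> \<partial>lebn k)
    = (\<integral>\<^sup>+ x. \<phi> (W (poly_coeffs k (roots_poly k x))) * ennreal \<bar>vandermonde k x\<bar> \<partial>lebn k)"
  proof (rule nn_integral_cong)
    fix x :: "nat \<Rightarrow> real"
    show "indicator {x. \<forall>i<k. - poly (roots_poly (Suc k) y) (x i) / node k x i > 0} x * ennreal \<bar>vandermonde k x\<bar>
      = \<phi> (W (poly_coeffs k (roots_poly k x))) * ennreal \<bar>vandermonde k x\<bar>"
    proof (cases "inj_on x {..<k}")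
      case True
      have "coeffs_poly k (poly_coeffs k (roots_poly k x)) = roots_poly k x"
        by (rule coeffs_poly_poly_coeffs) simp_all
      then have "indicator {x. \<forall>i<k. - poly (roots_poly (Suc k) y) (x i) / node k x i > 0} x
        = \<phi> (W (poly_coeffs k (roots_poly k x)))"
        unfolding \<phi>W indicator_def mem_Collect_eq using interlacing_weights[OF True inj] by (simp only:)
      then show ?thesis by (simp only:)
    qed (simp add: vandermonde_eq_0_iff[THEN iffD2])
  qed
  also have "\<dots> = fact k * (\<integral>\<^sup>+ c. \<phi> (W c) \<partial>lebn k)"
    by (rule nn_integral_roots_coeffs) (use supp in \<open>auto intro: measurable_compose[OF W_meas \<phi>]\<close>)
  also have "(\<integral>\<^sup>+ c. \<phi> (W c) \<partial>lebn k) = ennreal \<bar>vandermonde (Suc k) y\<bar> * (\<integral>\<^sup>+ r. \<phi> r \<partial>lebn k)"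
  proof -
    have inj': "inj_on y {..<k}" using inj by (auto simp: inj_on_def)
    have V: "vandermonde k y \<noteq> 0" "vandermonde (Suc k) y \<noteq> 0"
      using inj inj' by (simp_all add: vandermonde_eq_0_iff)
    define T where "T z = (\<lambda>j\<in>{..<k}. (1 / node (Suc k) y j) * z j + 0)" for z
    have n0: "1 / node (Suc k) y j \<noteq> 0" if "j < k" for j
      using node_neq_0[OF inj, of j] that by simp
    have T_meas: "T \<in> lebn k \<rightarrow>\<^sub>M lebn k"
      unfolding T_def by measurable
    have T: "(\<Prod>j<k. ennreal \<bar>1 / node (Suc k) y j\<bar>) * (\<integral>\<^sup>+ z. \<phi> (T z) \<partial>lebn k) = (\<integral>\<^sup>+ r. \<phi> r \<partial>lebn k)"
      unfolding T_def using n0 by (intro nn_integral_scale_lebn) simp_all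
    have prod_n: "(\<Prod>j<k. ennreal \<bar>1 / node (Suc k) y j\<bar>) = ennreal (inverse (\<bar>vandermonde k y\<bar> * \<bar>vandermonde (Suc k) y\<bar>))"
    proof -
      have "(\<Prod>j<k. \<bar>1 / node (Suc k) y j\<bar>) = inverse (\<Prod>j<k. \<bar>node (Suc k) y j\<bar>)"
        unfolding prod_inversef[symmetric] by (intro prod.cong) (simp_all add: divide_inverse)
      then show ?thesis by (simp only: prod_ennreal abs_ge_zero prod_abs_node_Suc)
    qed
    have TW: "T (\<lambda>i\<in>{..<k}. poly (coeffs_poly k c) (y i)) = W c" for c
      by (auto simp: T_def W_def)
    have "ennreal \<bar>vandermonde k y\<bar> * (\<integral>\<^sup>+ c. \<phi> (W c) \<partial>lebn k) = (\<integral>\<^sup>+ z. \<phi> (T z) \<partial>lebn k)"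
      using nn_integral_eval_coeffs_poly[OF inj' measurable_compose[OF T_meas \<phi>]] unfolding TW .
    also have "\<dots> = ennreal (\<bar>vandermonde k y\<bar> * \<bar>vandermonde (Suc k) y\<bar>) * (\<integral>\<^sup>+ r. \<phi> r \<partial>lebn k)"
    proof -
      have "ennreal (\<bar>vandermonde k y\<bar> * \<bar>vandermonde (Suc k) y\<bar>)
          * ennreal (inverse (\<bar>vandermonde k y\<bar> * \<bar>vandermonde (Suc k) y\<bar>)) = 1"
        using V by (intro ennreal_mult_inverse) simp_all
      then show ?thesis
        unfolding T[symmetric] prod_n by (simp flip: mult.assoc)
    qed
    also have "\<dots> = ennreal \<bar>vandermonde k y\<bar> * (ennreal \<bar>vandermonde (Suc k) y\<bar> * (\<integral>\<^sup>+ r. \<phi> r \<partial>lebn k))"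
      by (simp only: ennreal_mult'[OF abs_ge_zero] mult.assoc)
    finally have eq: "ennreal \<bar>vandermonde k y\<bar> * (\<integral>\<^sup>+ c. \<phi> (W c) \<partial>lebn k)
      = ennreal \<bar>vandermonde k y\<bar> * (ennreal \<bar>vandermonde (Suc k) y\<bar> * (\<integral>\<^sup>+ r. \<phi> r \<partial>lebn k))" .
    from V(1) eq show ?thesis by (rule ennreal_cancel_real)
  qed
  finally show ?thesis
    by (simp add: interlacing_const_def \<phi>_def mult_ac)
qed

subsection \<open>Unitary invariance and bordered matrices\<close>

lemma index_mult_mat_sum:
  assumes "A \<in> carrier_mat n m" "B \<in> carrier_mat m k" "i < n" "j < k"
  shows "(A * B) $$ (i, j) = (\<Sum>l<m. A $$ (i, l) * B $$ (l, j))"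
  using assms by (simp add: scalar_prod_def atLeast0LessThan)

lemma mat_adjoint_carrier: "A \<in> carrier_mat n m \<Longrightarrow> mat_adjoint A \<in> carrier_mat m n"
  by (auto simp: mat_adjoint_def mat_of_rows_def)

lemma mat_adjoint_index:
  fixes A :: "complex mat"
  assumes "A \<in> carrier_mat n m" "i < m" "j < n"
  shows "mat_adjoint A $$ (i, j) = cnj (A $$ (j, i))"
  using assms by (auto simp: mat_adjoint_def mat_of_rows_def)

definition unitary_mat :: "nat \<Rightarrow> complex mat \<Rightarrow> bool" where
  "unitary_mat n U \<longleftrightarrow> U \<in> carrier_mat n n \<and> mat_adjoint U * U = 1\<^sub>m n"

lemma unitary_mat_carrier: "unitary_mat n U \<Longrightarrow> U \<in> carrier_mat n n"
  by (simp add: unitary_mat_def)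

lemma unitary_mat_right: "unitary_mat n U \<Longrightarrow> U * mat_adjoint U = 1\<^sub>m n"
  unfolding unitary_mat_def
  by (rule mat_mult_left_right_inverse[of _ n]) (auto intro: mat_adjoint_carrier)

lemma unitary_mat_cols:
  assumes "unitary_mat n U" "j < n" "k < n"
  shows "(\<Sum>i<n. cnj (U $$ (i, j)) * U $$ (i, k)) = (if j = k then 1 else 0)"
proof -
  have U: "U \<in> carrier_mat n n" "mat_adjoint U * U = 1\<^sub>m n" using assms by (auto simp: unitary_mat_def)
  have "(\<Sum>i<n. cnj (U $$ (i, j)) * U $$ (i, k)) = (mat_adjoint U * U) $$ (j, k)"
    using assms(2,3) U(1) by (subst index_mult_mat_sum[OF mat_adjoint_carrier[OF U(1)] U(1)]) (auto simp: mat_adjoint_index)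
  then show ?thesis using U(2) assms by simp
qed

lemma unitary_mat_rows:
  assumes "unitary_mat n U" "i < n" "k < n"
  shows "(\<Sum>j<n. U $$ (i, j) * cnj (U $$ (k, j))) = (if i = k then 1 else 0)"
proof -
  have U: "U \<in> carrier_mat n n" "U * mat_adjoint U = 1\<^sub>m n"
    using assms unitary_mat_right by (auto simp: unitary_mat_def)
  have "(\<Sum>j<n. U $$ (i, j) * cnj (U $$ (k, j))) = (U * mat_adjoint U) $$ (i, k)"
    using assms(2,3) U(1) by (subst index_mult_mat_sum[OF U(1) mat_adjoint_carrier[OF U(1)]]) (auto simp: mat_adjoint_index)
  then show ?thesis using U(2) assms by simp
qed

lemma unitary_matI:
  assumes "U \<in> carrier_mat n n"
    and "\<And>j k. j < n \<Longrightarrow> k < n \<Longrightarrow> (\<Sum>i<n. cnj (U $$ (i, j)) * U $$ (i, k)) = (if j = k then 1 else 0)"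
  shows "unitary_mat n U"
proof -
  have "mat_adjoint U * U = 1\<^sub>m n"
  proof (rule eq_matI)
    fix i j assume "i < dim_row (1\<^sub>m n :: complex mat)" "j < dim_col (1\<^sub>m n :: complex mat)"
    then have ij: "i < n" "j < n" by auto
    then show "(mat_adjoint U * U) $$ (i, j) = 1\<^sub>m n $$ (i, j)"
      using assms by (subst index_mult_mat_sum[OF mat_adjoint_carrier[OF assms(1)] assms(1)]) (auto simp: mat_adjoint_index)
  qed (use mat_adjoint_carrier[OF assms(1)] assms(1) in auto)
  with assms(1) show ?thesis by (simp add: unitary_mat_def)
qed

lemma sum_cmod_square_unitary:
  assumes U: "unitary_mat n U"
  shows "(\<Sum>i<n. (cmod (\<Sum>j<n. U $$ (i, j) * v j))\<^sup>2) = (\<Sum>j<n. (cmod (v j))\<^sup>2)"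
proof -
  have "complex_of_real (\<Sum>i<n. (cmod (\<Sum>j<n. U $$ (i, j) * v j))\<^sup>2)
      = (\<Sum>i<n. (\<Sum>j<n. U $$ (i, j) * v j) * (\<Sum>k<n. cnj (U $$ (i, k)) * cnj (v k)))"
    by (simp add: complex_norm_square del: of_real_power)
  also have "\<dots> = (\<Sum>i<n. \<Sum>j<n. \<Sum>k<n. (v j * cnj (v k)) * (cnj (U $$ (i, k)) * U $$ (i, j)))"
    by (simp add: sum_product mult_ac)
  also have "\<dots> = (\<Sum>j<n. \<Sum>k<n. (v j * cnj (v k)) * (\<Sum>i<n. cnj (U $$ (i, k)) * U $$ (i, j)))"
    unfolding sum_distrib_left
    by (subst sum.swap) (rule sum.cong[OF refl], rule sum.swap)
  also have "\<dots> = (\<Sum>j<n. \<Sum>k<n. if k = j then v j * cnj (v k) else 0)"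
    by (intro sum.cong refl) (simp add: unitary_mat_cols[OF U])
  also have "\<dots> = complex_of_real (\<Sum>j<n. (cmod (v j))\<^sup>2)"
    by (simp add: complex_norm_square del: of_real_power)
  finally show ?thesis by (simp only: of_real_eq_iff)
qed

definition unitarily_invariant :: "nat \<Rightarrow> (complex mat \<Rightarrow> 'a) \<Rightarrow> bool" where
  "unitarily_invariant n f \<longleftrightarrow>
    (\<forall>A\<in>carrier_mat n n. \<forall>U. unitary_mat n U \<longrightarrow> f (U * A * mat_adjoint U) = f A)"

lemma unitarily_invariantD:
  "unitarily_invariant n f \<Longrightarrow> A \<in> carrier_mat n n \<Longrightarrow> unitary_mat n U \<Longrightarrow> f (U * A * mat_adjoint U) = f A"
  by (simp add: unitarily_invariant_def)

definition frobenius :: "nat \<Rightarrow> complex mat \<Rightarrow> real" where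
  "frobenius n A = (\<Sum>i<n. \<Sum>j<n. (cmod (A $$ (i, j)))\<^sup>2)"

text \<open>The right factor preserves the norm of each row of \<open>U * A\<close>, the left factor
  the norm of each column of \<open>A\<close>.\<close>

lemma frobenius_unitary:
  assumes A: "A \<in> carrier_mat n n" and U: "unitary_mat n U"
  shows "frobenius n (U * A * mat_adjoint U) = frobenius n A"
proof -
  note Uc = unitary_mat_carrier[OF U]
  have UA: "U * A \<in> carrier_mat n n" using Uc A by simp
  have "frobenius n (U * A * mat_adjoint U) = (\<Sum>i<n. \<Sum>j<n. (cmod (\<Sum>k<n. U $$ (j, k) * cnj ((U * A) $$ (i, k))))\<^sup>2)"
    unfolding frobenius_def
  proof (intro sum.cong refl)
    fix i j assume ij: "i \<in> {..<n}" "j \<in> {..<n}"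
    have "(U * A * mat_adjoint U) $$ (i, j) = (\<Sum>k<n. (U * A) $$ (i, k) * cnj (U $$ (j, k)))"
      using ij by (subst index_mult_mat_sum[OF UA mat_adjoint_carrier[OF Uc]])
        (auto simp: mat_adjoint_index[OF Uc] intro!: sum.cong)
    also have "\<dots> = cnj (\<Sum>k<n. U $$ (j, k) * cnj ((U * A) $$ (i, k)))"
      by (simp add: mult.commute)
    finally show "(cmod ((U * A * mat_adjoint U) $$ (i, j)))\<^sup>2 = (cmod (\<Sum>k<n. U $$ (j, k) * cnj ((U * A) $$ (i, k))))\<^sup>2"
      by (simp only: complex_mod_cnj)
  qed
  also have "\<dots> = (\<Sum>i<n. \<Sum>k<n. (cmod ((U * A) $$ (i, k)))\<^sup>2)"
    by (simp add: sum_cmod_square_unitary[OF U])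
  also have "\<dots> = (\<Sum>k<n. \<Sum>i<n. (cmod (\<Sum>l<n. U $$ (i, l) * A $$ (l, k)))\<^sup>2)"
    by (subst sum.swap) (intro sum.cong refl, simp add: index_mult_mat_sum[OF Uc A])
  also have "\<dots> = (\<Sum>k<n. \<Sum>l<n. (cmod (A $$ (l, k)))\<^sup>2)"
    by (simp add: sum_cmod_square_unitary[OF U])
  also have "\<dots> = frobenius n A"
    unfolding frobenius_def by (rule sum.swap)
  finally show ?thesis .
qed

section \<open>Bordered matrices under unitary conjugation\<close>

definition real_diag :: "nat \<Rightarrow> (nat \<Rightarrow> real) \<Rightarrow> complex mat" where
  "real_diag n x = mat n n (\<lambda>(i, j). if i = j then complex_of_real (x i) else 0)"

lemma real_diag_carrier [simp]: "real_diag n x \<in> carrier_mat n n"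
  by (simp add: real_diag_def)

definition border :: "nat \<Rightarrow> complex mat \<Rightarrow> (nat \<Rightarrow> complex) \<Rightarrow> real \<Rightarrow> complex mat" where
  "border n A v d = mat (Suc n) (Suc n) (\<lambda>(i, j).
    if i < n \<and> j < n then A $$ (i, j) else if i < n then v i else if j < n then cnj (v j) else complex_of_real d)"

definition extend_unitary :: "nat \<Rightarrow> complex mat \<Rightarrow> complex mat" where
  "extend_unitary n U = mat (Suc n) (Suc n) (\<lambda>(i, j). if i < n \<and> j < n then U $$ (i, j) else if i = j then 1 else 0)"

lemma border_carrier [simp]: "border n A v d \<in> carrier_mat (Suc n) (Suc n)"
  by (simp add: border_def)

lemma extend_unitary_carrier [simp]: "extend_unitary n U \<in> carrier_mat (Suc n) (Suc n)"
  by (simp add: extend_unitary_def)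

lemma unitary_extend: "unitary_mat n U \<Longrightarrow> unitary_mat (Suc n) (extend_unitary n U)"
  by (rule unitary_matI) (auto simp: extend_unitary_def unitary_mat_cols less_Suc_eq)

text \<open>Conjugation by the block matrix diag(U, 1) conjugates the minor by \<open>U\<close>,
  applies \<open>U\<close> to the border and fixes the corner. A rotation of the minor can thus be
  traded for a rotation of the border vector.\<close>

lemma border_conj:
  assumes A: "A \<in> carrier_mat n n" and U: "U \<in> carrier_mat n n"
  shows "extend_unitary n U * border n A v d * mat_adjoint (extend_unitary n U)
    = border n (U * A * mat_adjoint U) (\<lambda>i. \<Sum>j<n. U $$ (i, j) * v j) d" (is "?E * ?B * mat_adjoint ?E = ?R")
proof (rule eq_matI)
  fix i j assume "i < dim_row ?R" "j < dim_col ?R"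
  then have ij: "i < Suc n" "j < Suc n" by (simp_all add: border_def)
  have EB: "?E * ?B \<in> carrier_mat (Suc n) (Suc n)" by (rule mult_carrier_mat[OF extend_unitary_carrier border_carrier])
  have EBi: "(?E * ?B) $$ (i, k) = (if i < n then (\<Sum>l<n. U $$ (i, l) * ?B $$ (l, k)) else ?B $$ (n, k))" if "k < Suc n" for k
  proof -
    have "(?E * ?B) $$ (i, k) = (\<Sum>l<Suc n. ?E $$ (i, l) * ?B $$ (l, k))"
      by (rule index_mult_mat_sum[OF extend_unitary_carrier border_carrier ij(1) that])
    then show ?thesis using ij by (auto simp: extend_unitary_def less_Suc_eq intro!: sum.neutral)
  qed
  define M where "M = ?E * ?B"
  have M: "M $$ (i, k) = (if i < n then if k < n then (\<Sum>l<n. U $$ (i, l) * A $$ (l, k)) else (\<Sum>l<n. U $$ (i, l) * v l)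
      else if k < n then cnj (v k) else complex_of_real d)" if "k < Suc n" for k
    unfolding M_def EBi[OF that] using that ij by (auto simp: border_def)
  have "(?E * ?B * mat_adjoint ?E) $$ (i, j) = (\<Sum>k<Suc n. (?E * ?B) $$ (i, k) * cnj (?E $$ (j, k)))"
    using ij by (subst index_mult_mat_sum[OF EB mat_adjoint_carrier])
      (auto simp: mat_adjoint_index[of _ "Suc n" "Suc n"] intro!: sum.cong)
  also have "\<dots> = (if j < n then (\<Sum>k<n. (?E * ?B) $$ (i, k) * cnj (U $$ (j, k))) else (?E * ?B) $$ (i, n))"
    using ij by (auto simp: extend_unitary_def less_Suc_eq intro!: sum.neutral)
  finally have *: "(?E * ?B * mat_adjoint ?E) $$ (i, j)
     = (if j < n then (\<Sum>k<n. (?E * ?B) $$ (i, k) * cnj (U $$ (j, k))) else (?E * ?B) $$ (i, n))" .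
  have UA: "U * A \<in> carrier_mat n n" using U A by simp
  have UAU: "(U * A * mat_adjoint U) $$ (i, j) = (\<Sum>k<n. (\<Sum>l<n. U $$ (i, l) * A $$ (l, k)) * cnj (U $$ (j, k)))"
    if "i < n" "j < n"
    using that by (subst index_mult_mat_sum[OF UA mat_adjoint_carrier[OF U]])
      (auto simp: mat_adjoint_index[OF U] index_mult_mat_sum[OF U A] intro!: sum.cong)
  show "(?E * ?B * mat_adjoint ?E) $$ (i, j) = ?R $$ (i, j)"
    unfolding * unfolding M_def[symmetric] using ij M
    by (cases "i < n"; cases "j < n") (simp_all add: UAU border_def mult.commute)
qed (simp_all add: border_def extend_unitary_def mat_adjoint_def)

text \<open>The vector \<open>w\<close> has the format of \<open>arrow_data\<close>: its entries
  below n are squared moduli of the border, its entry n is the corner.\<close>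

definition arrow :: "nat \<Rightarrow> (nat \<Rightarrow> real) \<Rightarrow> (nat \<Rightarrow> real) \<Rightarrow> complex mat" where
  "arrow n x w = border n (real_diag n x) (\<lambda>i. complex_of_real (sqrt (w i))) (w n)"

text \<open>A diagonal unitary matrix commutes with the diagonal minor and can be chosen to remove
  the phases of the border entries.\<close>

lemma border_real_diag_phases:
  assumes f: "unitarily_invariant (Suc n) f"
  shows "f (border n (real_diag n x) v d) = f (border n (real_diag n x) (\<lambda>i. complex_of_real (cmod (v i))) d)"
proof -
  \<comment> \<open>A vanishing entry gets the phase 1, since \<open>sgn\<close> would give 0 and
    destroy unitarity.\<close>
  define s where "s i = (if v i = 0 then 1 else sgn (v i))" for i
  have s: "cmod (s i) = 1" "s i * complex_of_real (cmod (v i)) = v i" for i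
    by (simp_all add: s_def norm_sgn) (simp add: sgn_div_norm scaleR_conv_of_real)
  have s': "cnj (s i) * s i = 1" for i
    using s(1)[of i] by (simp add: complex_norm_square[symmetric] mult.commute)
  define U where "U = mat n n (\<lambda>(i, j). if i = j then s i else 0)"
  have U: "U \<in> carrier_mat n n" by (simp add: U_def)
  have uni: "unitary_mat n U"
  proof (rule unitary_matI[OF U])
    fix j k assume jk: "j < n" "k < n"
    have "(\<Sum>i<n. cnj (U $$ (i, j)) * U $$ (i, k)) = (\<Sum>i<n. if i = j then (if j = k then 1 else 0) else 0)"
      using jk s' by (intro sum.cong) (auto simp: U_def)
    then show "(\<Sum>i<n. cnj (U $$ (i, j)) * U $$ (i, k)) = (if j = k then 1 else 0)" using jk by simp
  qed
  have "U * real_diag n x * mat_adjoint U = real_diag n x"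
  proof (rule eq_matI)
    fix i j assume "i < dim_row (real_diag n x)" "j < dim_col (real_diag n x)"
    then have ij: "i < n" "j < n" by (simp_all add: real_diag_def)
    have UD: "U * real_diag n x \<in> carrier_mat n n" using U by simp
    have 1: "(U * real_diag n x) $$ (i, k) = (if i = k then s i * of_real (x i) else 0)" if "k < n" for k
    proof -
      have "(U * real_diag n x) $$ (i, k) = (\<Sum>l<n. U $$ (i, l) * real_diag n x $$ (l, k))"
        by (rule index_mult_mat_sum[OF U real_diag_carrier ij(1) that])
      also have "\<dots> = (\<Sum>l<n. if l = i then (if i = k then s i * of_real (x i) else 0) else 0)"
        using ij that by (intro sum.cong refl) (auto simp: U_def real_diag_def)
      finally show ?thesis using ij by simp
    qed
    have 2: "mat_adjoint U $$ (k, j) = (if k = j then cnj (s j) else 0)" if "k < n" for k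
      unfolding mat_adjoint_index[OF U that ij(2)] using that ij by (simp add: U_def)
    have "(U * real_diag n x * mat_adjoint U) $$ (i, j) = (\<Sum>k<n. (U * real_diag n x) $$ (i, k) * mat_adjoint U $$ (k, j))"
      by (rule index_mult_mat_sum[OF UD mat_adjoint_carrier[OF U] ij])
    also have "\<dots> = (\<Sum>k<n. if k = i then (if i = j then s i * of_real (x i) * cnj (s i) else 0) else 0)"
      by (intro sum.cong refl) (simp add: 1 2)
    also have "\<dots> = (if i = j then (cnj (s i) * s i) * of_real (x i) else 0)"
      using ij by (simp add: mult_ac)
    finally show "(U * real_diag n x * mat_adjoint U) $$ (i, j) = real_diag n x $$ (i, j)"
      using ij by (simp add: s' real_diag_def)
  qed (use U in \<open>simp_all add: real_diag_def mat_adjoint_def\<close>)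
  moreover have "border n (real_diag n x) (\<lambda>i. \<Sum>j<n. U $$ (i, j) * complex_of_real (cmod (v j))) d = border n (real_diag n x) v d"
  proof -
    have "(\<Sum>j<n. U $$ (i, j) * complex_of_real (cmod (v j))) = v i" if "i < n" for i
    proof -
      have "(\<Sum>j<n. U $$ (i, j) * complex_of_real (cmod (v j))) = (\<Sum>j<n. if j = i then v i else 0)"
        using that s by (intro sum.cong) (auto simp: U_def)
      then show ?thesis using that by simp
    qed
    then show ?thesis by (intro eq_matI) (auto simp: border_def)
  qed
  ultimately have "extend_unitary n U * border n (real_diag n x) (\<lambda>i. complex_of_real (cmod (v i))) d
      * mat_adjoint (extend_unitary n U) = border n (real_diag n x) v d"
    using border_conj[OF real_diag_carrier U, of x "\<lambda>i. complex_of_real (cmod (v i))" d] by simp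
  then show ?thesis
    using unitarily_invariantD[OF f border_carrier unitary_extend[OF uni]] by metis
qed

text \<open>The eigenvector for the eigenvalue y j is proportional to (sqrt w i / (y j - x i), 1).\<close>

lemma arrow_diagonalisation:
  assumes injx: "inj_on x {..<n}" and injy: "inj_on y {..<Suc n}"
  defines "w \<equiv> arrow_data n x (poly_coeffs (Suc n) (roots_poly (Suc n) y))"
  assumes pos: "\<And>i. i < n \<Longrightarrow> w i > 0"
  obtains U where "unitary_mat (Suc n) U" "arrow n x w = U * real_diag (Suc n) y * mat_adjoint U"
proof -
  let ?P = "roots_poly (Suc n) y" and ?Q = "roots_poly n x"
  define d where "d = - coeff ?P n - (\<Sum>i<n. x i)"
  have cp: "coeffs_poly (Suc n) (poly_coeffs (Suc n) ?P) = ?P"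
    by (rule coeffs_poly_poly_coeffs) simp_all
  have wi: "w i = - poly ?P (x i) / node n x i" if "i < n" for i
    using that cp by (simp add: w_def arrow_data_def del: coeffs_poly.simps)
  have wn: "w n = d"
    by (simp add: w_def arrow_data_def d_def poly_coeffs_def)
  have "?P = [:- d, 1:] * ?Q - (\<Sum>i<n. Polynomial.smult (- poly ?P (x i) / node n x i) (cofactor_poly n x i))"
    unfolding d_def by (rule secular_equation[OF injx]) simp_all
  also have "(\<Sum>i<n. Polynomial.smult (- poly ?P (x i) / node n x i) (cofactor_poly n x i))
     = (\<Sum>i<n. Polynomial.smult (w i) (cofactor_poly n x i))"
    by (intro sum.cong) (simp_all add: wi)
  finally have P: "?P = herglotz_poly 1 d n x w" by (simp add: herglotz_poly_def)
  \<comment> \<open>The residue of Q / P at y j. It will be the squared last component of the unit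
    eigenvector.\<close>
  define \<rho> where "\<rho> j = poly ?Q (y j) / node (Suc n) y j" for j
  have \<rho>: "\<rho> j > 0" if "j < Suc n" for j
  proof -
    have "\<forall>i<n. - poly ?P (x i) / node n x i > 0" using pos wi by simp
    then show ?thesis using interlacing_weights[OF injx injy] that by (auto simp: \<rho>_def)
  qed
  have Q0: "poly ?Q (y j) \<noteq> 0" if "j < Suc n" for j
    using \<rho>[OF that] by (auto simp: \<rho>_def)
  then have yx: "y j - x i \<noteq> 0" if "j < Suc n" "i < n" for i j
    using that by (auto simp: poly_roots_poly)
  have cof: "poly (cofactor_poly n x i) (y j) = poly ?Q (y j) / (y j - x i)" if "j < Suc n" "i < n" for i j
  proof -
    have "poly ?Q (y j) = (y j - x i) * poly (cofactor_poly n x i) (y j)"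
      unfolding roots_poly_cofactor[OF that(2)] by (simp del: mult_pCons_left)
    then show ?thesis using yx[OF that] by (simp add: field_simps)
  qed
  have secular: "(\<Sum>i<n. w i / (y j - x i)) = y j - d" if j: "j < Suc n" for j
  proof -
    have "0 = poly ?P (y j)" using poly_roots_poly_node[OF j] by simp
    also have "\<dots> = (y j - d) * poly ?Q (y j) - (\<Sum>i<n. w i * poly (cofactor_poly n x i) (y j))"
      unfolding P herglotz_poly_def by (simp add: poly_sum del: mult_pCons_left)
    also have "(\<Sum>i<n. w i * poly (cofactor_poly n x i) (y j)) = poly ?Q (y j) * (\<Sum>i<n. w i / (y j - x i))"
      unfolding sum_distrib_left using j by (intro sum.cong) (simp_all add: cof)
    finally have "poly ?Q (y j) * ((y j - d) - (\<Sum>i<n. w i / (y j - x i))) = 0"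
      by (simp add: algebra_simps)
    then show ?thesis using Q0[OF j] by simp
  qed
  \<comment> \<open>At y j the Wronskian identity reads P'(y j) Q(y j) = Q(y j)^2 (1 + \<Sum> w i /
    (y j - x i)^2), which gives the squared length of the unnormalised eigenvector.\<close>
  have norm1: "1 + (\<Sum>i<n. w i / ((y j - x i) * (y j - x i))) = 1 / \<rho> j" if j: "j < Suc n" for j
  proof -
    let ?q = "poly ?Q (y j)"
    have "poly (pderiv ?P) (y j) * ?q - poly ?P (y j) * poly (pderiv ?Q) (y j)
      = 1 * ?q\<^sup>2 + (\<Sum>i<n. w i * (poly (cofactor_poly n x i) (y j))\<^sup>2)"
      unfolding P by (rule herglotz_wronskian)
    also have "(\<Sum>i<n. w i * (poly (cofactor_poly n x i) (y j))\<^sup>2) = ?q\<^sup>2 * (\<Sum>i<n. w i / ((y j - x i) * (y j - x i)))"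
      unfolding sum_distrib_left using j by (intro sum.cong) (simp_all add: cof power2_eq_square)
    finally have "node (Suc n) y j * ?q = ?q * (?q * (1 + (\<Sum>i<n. w i / ((y j - x i) * (y j - x i)))))"
      by (simp add: poly_roots_poly_node[OF j] poly_pderiv_roots_poly_node[OF j] power2_eq_square algebra_simps)
    then have "node (Suc n) y j = ?q * (1 + (\<Sum>i<n. w i / ((y j - x i) * (y j - x i))))"
      using Q0[OF j] by (simp add: mult.commute)
    then show ?thesis using Q0[OF j] by (simp add: \<rho>_def)
  qed
  \<comment> \<open>The secular equations at y j and y k are subtracted, and the common factor y k -
    y j is cancelled.\<close>
  have orth: "1 + (\<Sum>i<n. w i / ((y j - x i) * (y k - x i))) = 0" if jk: "j < Suc n" "k < Suc n" "j \<noteq> k" for j k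
  proof -
    have "y j \<noteq> y k" using inj_onD[OF injy, of j k] jk by auto
    have "(y k - y j) * (\<Sum>i<n. w i / ((y j - x i) * (y k - x i))) = (\<Sum>i<n. w i / (y j - x i)) - (\<Sum>i<n. w i / (y k - x i))"
      unfolding sum_distrib_left sum_subtractf[symmetric]
      using yx jk by (intro sum.cong) (simp_all add: field_simps)
    also have "\<dots> = y j - y k" using secular jk by simp
    finally have "(y k - y j) * (1 + (\<Sum>i<n. w i / ((y j - x i) * (y k - x i)))) = 0"
      by (simp add: algebra_simps)
    then show ?thesis using \<open>y j \<noteq> y k\<close> by simp
  qed
  define u where "u i j = sqrt (\<rho> j) * (if i < n then sqrt (w i) / (y j - x i) else 1)" for i j
  have uu: "(\<Sum>i<Suc n. u i j * u i k) = (if j = k then 1 else 0)" if jk: "j < Suc n" "k < Suc n" for j k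
  proof -
    have "(\<Sum>i<Suc n. u i j * u i k) = sqrt (\<rho> j) * sqrt (\<rho> k) * (1 + (\<Sum>i<n. w i / ((y j - x i) * (y k - x i))))"
    proof -
      have "u i j * u i k = sqrt (\<rho> j) * sqrt (\<rho> k) * (w i / ((y j - x i) * (y k - x i)))" if "i < n" for i
      proof -
        have "sqrt (w i) * sqrt (w i) = w i" using pos[OF that] by simp
        then have "w i / ((y j - x i) * (y k - x i)) = (sqrt (w i) / (y j - x i)) * (sqrt (w i) / (y k - x i))"
          by simp
        then show ?thesis using that by (simp only: u_def if_True mult_ac)
      qed
      then show ?thesis
        by (simp add: u_def[of n] distrib_left sum_distrib_left add.commute)
    qed
    then show ?thesis
      using norm1[of j] orth[of j k] jk \<rho>[of j] by (cases "j = k") simp_all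
  qed
  define U where "U = mat (Suc n) (Suc n) (\<lambda>(i, j). complex_of_real (u i j))"
  have Uc: "U \<in> carrier_mat (Suc n) (Suc n)" by (simp add: U_def)
  have uni: "unitary_mat (Suc n) U"
  proof (rule unitary_matI[OF Uc])
    fix j k assume jk: "j < Suc n" "k < Suc n"
    have "(\<Sum>i<Suc n. cnj (U $$ (i, j)) * U $$ (i, k)) = complex_of_real (\<Sum>i<Suc n. u i j * u i k)"
      unfolding of_real_sum using jk by (intro sum.cong) (auto simp: U_def)
    then show "(\<Sum>i<Suc n. cnj (U $$ (i, j)) * U $$ (i, k)) = (if j = k then 1 else 0)"
      unfolding uu[OF jk] by simp
  qed
  have ev: "arrow n x w * U = U * real_diag (Suc n) y"
  proof (rule eq_matI)
    fix i j assume "i < dim_row (U * real_diag (Suc n) y)" "j < dim_col (U * real_diag (Suc n) y)"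
    then have ij: "i < Suc n" "j < Suc n" by (simp_all add: U_def real_diag_def)
    have "(arrow n x w * U) $$ (i, j) = (\<Sum>k<Suc n. arrow n x w $$ (i, k) * U $$ (k, j))"
      by (rule index_mult_mat_sum[OF _ Uc]) (use ij in \<open>simp_all add: arrow_def\<close>)
    also have "\<dots> = complex_of_real (u i j * y j)"
    proof (cases "i < n")
      case True
      have "(\<Sum>k<n. arrow n x w $$ (i, k) * U $$ (k, j)) = (\<Sum>k<n. if k = i then complex_of_real (x i * u i j) else 0)"
        using True ij by (intro sum.cong) (auto simp: arrow_def border_def real_diag_def U_def)
      then have "(\<Sum>k<Suc n. arrow n x w $$ (i, k) * U $$ (k, j)) = complex_of_real (x i * u i j + sqrt (w i) * u n j)"
        using True ij by (simp add: arrow_def border_def U_def)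
      also have "x i * u i j + sqrt (w i) * u n j = u i j * y j"
        using True yx[OF ij(2) True] by (simp add: u_def field_simps)
      finally show ?thesis .
    next
      case False
      with ij have i: "i = n" by simp
      have "(\<Sum>k<Suc n. arrow n x w $$ (i, k) * U $$ (k, j)) = complex_of_real ((\<Sum>k<n. sqrt (w k) * u k j) + d * u n j)"
        using ij i by (simp add: arrow_def border_def U_def wn)
      also have "(\<Sum>k<n. sqrt (w k) * u k j) = sqrt (\<rho> j) * (\<Sum>k<n. w k / (y j - x k))"
        unfolding sum_distrib_left
      proof (intro sum.cong refl)
        fix k assume "k \<in> {..<n}"
        then have k: "k < n" by simp
        have "sqrt (w k) * sqrt (w k) = w k" using pos[OF k] by simp
        then have "w k / (y j - x k) = sqrt (w k) * (sqrt (w k) / (y j - x k))" by simp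
        then show "sqrt (w k) * u k j = sqrt (\<rho> j) * (w k / (y j - x k))"
          using k by (simp only: u_def if_True mult_ac)
      qed
      also have "sqrt (\<rho> j) * (\<Sum>k<n. w k / (y j - x k)) + d * u n j = u i j * y j"
        unfolding secular[OF ij(2)] i by (simp add: u_def algebra_simps)
      finally show ?thesis .
    qed
    also have "\<dots> = (\<Sum>k<Suc n. if k = j then complex_of_real (u i j * y j) else 0)"
      using ij by (simp del: sum.lessThan_Suc)
    also have "\<dots> = (\<Sum>k<Suc n. U $$ (i, k) * real_diag (Suc n) y $$ (k, j))"
      using ij by (intro sum.cong) (auto simp: U_def real_diag_def)
    also have "\<dots> = (U * real_diag (Suc n) y) $$ (i, j)"
      by (rule index_mult_mat_sum[OF Uc real_diag_carrier ij, symmetric])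
    finally show "(arrow n x w * U) $$ (i, j) = (U * real_diag (Suc n) y) $$ (i, j)" .
  qed (simp_all add: arrow_def border_def U_def real_diag_def)
  have ac: "arrow n x w \<in> carrier_mat (Suc n) (Suc n)" by (simp add: arrow_def)
  have "arrow n x w = arrow n x w * (U * mat_adjoint U)"
    using ac unitary_mat_right[OF uni] by simp
  also have "\<dots> = (arrow n x w * U) * mat_adjoint U"
    by (rule assoc_mult_mat[OF ac Uc mat_adjoint_carrier[OF Uc], symmetric])
  finally show ?thesis
    using that[OF uni] unfolding ev by blast
qed

subsection \<open>Recursion for the GUE integral\<close>

lemma space_mat_borel [simp]: "space (mat_borel n) = carrier_mat n n"
  by (simp add: mat_borel_def)

lemma measurable_mat_entry:
  assumes "i < n" "j < n"
  shows "(\<lambda>A. A $$ (i, j)) \<in> mat_borel n \<rightarrow>\<^sub>M borel"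
proof -
  let ?g = "\<lambda>A :: complex mat. \<lambda>ij\<in>{..<n} \<times> {..<n}. A $$ ij"
  have "?g \<in> mat_borel n \<rightarrow>\<^sub>M (\<Pi>\<^sub>M ij\<in>{..<n} \<times> {..<n}. borel)"
    unfolding mat_borel_def by (rule measurable_vimage_algebra1) (auto simp: space_PiM)
  from measurable_compose[OF this measurable_component_singleton[of "(i, j)"]] assms
  show ?thesis by simp
qed

lemma measurable_mat_entry':
  "f \<in> N \<rightarrow>\<^sub>M mat_borel n \<Longrightarrow> i < n \<Longrightarrow> j < n \<Longrightarrow> (\<lambda>x. f x $$ (i, j)) \<in> N \<rightarrow>\<^sub>M borel"
  by (rule measurable_compose[OF _ measurable_mat_entry])

lemma measurable_mat_borelI:
  assumes "\<And>x. x \<in> space N \<Longrightarrow> f x \<in> carrier_mat n n"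
    and "\<And>i j. i < n \<Longrightarrow> j < n \<Longrightarrow> (\<lambda>x. f x $$ (i, j)) \<in> N \<rightarrow>\<^sub>M borel"
  shows "f \<in> N \<rightarrow>\<^sub>M mat_borel n"
  unfolding mat_borel_def
proof (rule measurable_vimage_algebra2)
  show "(\<lambda>x. \<lambda>ij\<in>{..<n} \<times> {..<n}. f x $$ ij) \<in> N \<rightarrow>\<^sub>M (\<Pi>\<^sub>M ij\<in>{..<n} \<times> {..<n}. borel)"
    using assms(2) by (intro measurable_restrict) auto
qed (use assms(1) in auto)

lemma measurable_border:
  assumes "A \<in> N \<rightarrow>\<^sub>M mat_borel n" "\<And>i. i < n \<Longrightarrow> (\<lambda>x. v x i) \<in> N \<rightarrow>\<^sub>M borel" "d \<in> N \<rightarrow>\<^sub>M borel"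
  shows "(\<lambda>x. border n (A x) (v x) (d x)) \<in> N \<rightarrow>\<^sub>M mat_borel (Suc n)"
proof (rule measurable_mat_borelI)
  fix i j assume ij: "i < Suc n" "j < Suc n"
  have cnj: "(\<lambda>x. cnj (v x j)) \<in> borel_measurable N" if "j < n"
    by (rule measurable_compose[OF assms(2)[OF that]]) (intro borel_measurable_continuous_onI continuous_intros)
  have d: "(\<lambda>x. complex_of_real (d x)) \<in> borel_measurable N"
    using assms(3) by simp
  show "(\<lambda>x. border n (A x) (v x) (d x) $$ (i, j)) \<in> borel_measurable N"
    using ij assms(1,2) cnj d by (cases "i < n"; cases "j < n") (auto simp: border_def intro: measurable_mat_entry')
qed simp

lemma measurable_real_diag:
  assumes "\<And>i. i < n \<Longrightarrow> (\<lambda>x. f x i) \<in> borel_measurable N"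
  shows "(\<lambda>x. real_diag n (f x)) \<in> N \<rightarrow>\<^sub>M mat_borel n"
proof (rule measurable_mat_borelI)
  fix i j assume "i < n" "j < n"
  then show "(\<lambda>x. real_diag n (f x) $$ (i, j)) \<in> borel_measurable N"
    using assms[of i] by (cases "i = j") (simp_all add: real_diag_def)
qed simp

lemma measurable_frobenius: "frobenius n \<in> borel_measurable (mat_borel n)"
  unfolding frobenius_def
proof (intro borel_measurable_sum borel_measurable_power)
  fix i j assume "i \<in> {..<n}" "j \<in> {..<n}"
  then have "(\<lambda>A. A $$ (i, j)) \<in> borel_measurable (mat_borel n)"
    by (intro measurable_mat_entry) simp_all
  then show "(\<lambda>A. cmod (A $$ (i, j))) \<in> borel_measurable (mat_borel n)"
    by (rule measurable_compose) (intro borel_measurable_continuous_onI continuous_intros)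
qed

lemma sigma_finite_std_normal: "sigma_finite_measure std_normal"
  by (intro prob_space_imp_sigma_finite prob_space_normal_density) simp

lemma emeasure_std_normal_UNIV: "emeasure std_normal UNIV = 1"
proof -
  interpret prob_space std_normal by (rule prob_space_normal_density) simp
  show ?thesis using emeasure_space_1 by simp
qed

section \<open>Splitting the Gaussian matrix into minor and border\<close>

definition hermitise :: "nat \<Rightarrow> ((nat \<times> nat) \<times> bool \<Rightarrow> real) \<Rightarrow> complex mat" where
  "hermitise n g = (1 / 2) \<cdot>\<^sub>m (gauss_mat n g + mat_adjoint (gauss_mat n g))"

definition border_entry :: "nat \<Rightarrow> ((nat \<times> nat) \<times> bool \<Rightarrow> real) \<Rightarrow> nat \<Rightarrow> complex" where
  "border_entry n g i = Complex ((g ((i, n), False) + g ((n, i), False)) / 2) ((g ((i, n), True) - g ((n, i), True)) / 2)"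

lemma hermitise_carrier [simp]: "hermitise n g \<in> carrier_mat n n"
proof -
  have "gauss_mat n g \<in> carrier_mat n n" by (simp add: gauss_mat_def)
  then show ?thesis
    unfolding hermitise_def by (intro smult_carrier_mat add_carrier_mat mat_adjoint_carrier)
qed

lemma dim_hermitise [simp]: "dim_row (hermitise n g) = n" "dim_col (hermitise n g) = n"
  by (rule carrier_matD[OF hermitise_carrier])+

lemma hermitise_index:
  assumes "i < n" "j < n"
  shows "hermitise n g $$ (i, j) =
    Complex ((g ((i, j), False) + g ((j, i), False)) / 2) ((g ((i, j), True) - g ((j, i), True)) / 2)"
proof -
  have G: "gauss_mat n g \<in> carrier_mat n n" by (simp add: gauss_mat_def)
  have "hermitise n g $$ (i, j) = 1 / 2 * (gauss_mat n g $$ (i, j) + cnj (gauss_mat n g $$ (j, i)))"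
    using assms G mat_adjoint_carrier[OF G] unfolding hermitise_def
    by (simp add: mat_adjoint_index[OF G])
  then show ?thesis using assms by (simp add: gauss_mat_def complex_eq_iff)
qed

text \<open>At the corner the imaginary part cancels against its conjugate, so only the real
  variable at (n, n) remains.\<close>

lemma hermitise_Suc: "hermitise (Suc n) g = border n (hermitise n g) (border_entry n g) (g ((n, n), False))"
proof (rule eq_matI)
  fix i j assume "i < dim_row (border n (hermitise n g) (border_entry n g) (g ((n, n), False)))"
    "j < dim_col (border n (hermitise n g) (border_entry n g) (g ((n, n), False)))"
  then have ij: "i < Suc n" "j < Suc n" by (simp_all add: border_def)
  then show "hermitise (Suc n) g $$ (i, j) = border n (hermitise n g) (border_entry n g) (g ((n, n), False)) $$ (i, j)"
    unfolding hermitise_index[OF ij]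
    by (cases "i < n"; cases "j < n")
      (auto simp: border_def border_entry_def hermitise_index less_Suc_eq complex_eq_iff field_simps)
qed (simp_all add: border_def)

lemma nn_integral_GUE:
  assumes "f \<in> borel_measurable (mat_borel n)"
  shows "(\<integral>\<^sup>+ A. f A \<partial>GUE n) = (\<integral>\<^sup>+ g. f (hermitise n g) \<partial>(\<Pi>\<^sub>M k\<in>({..<n} \<times> {..<n}) \<times> UNIV. std_normal))"
proof -
  have "f \<in> borel_measurable (distr (gauss_parts n) (mat_borel n)
      (\<lambda>g. (1 / 2) \<cdot>\<^sub>m (gauss_mat n g + mat_adjoint (gauss_mat n g))))"
    using assms by simp
  from nn_integral_distr[OF GUE_map_measurable this] show ?thesis
    unfolding GUE_def hermitise_def gauss_parts_def .
qed

text \<open>Each step of the recursion adds the four real variables that form one border entry, in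
  the order in which \<open>std_normal_hermitian_entry\<close> integrates them.\<close>

primrec border_indices :: "nat \<Rightarrow> nat \<Rightarrow> ((nat \<times> nat) \<times> bool) set" where
  "border_indices n 0 = {}"
| "border_indices n (Suc k) = insert ((n, k), True) (insert ((k, n), True)
    (insert ((n, k), False) (insert ((k, n), False) (border_indices n k))))"

lemma border_indices_eq:
  "border_indices n k = {((i, j), b). (i = n \<and> j < k) \<or> (j = n \<and> i < k)}"
  by (induction k) (auto simp: less_Suc_eq)

lemma finite_border_indices [simp]: "finite (border_indices n k)"
  by (induction k) auto

text \<open>Different border entries use disjoint sets of four variables. They are therefore
  independent, each with density proportional to exp (- |z|^2), and are split off one by
  one.\<close>

lemma nn_integral_border_entries:
  assumes "k \<le> n" "\<phi> \<in> borel_measurable (lebn k)"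
  shows "(\<integral>\<^sup>+ b. \<phi> (\<lambda>i\<in>{..<k}. border_entry n b i) \<partial>(\<Pi>\<^sub>M p\<in>border_indices n k. std_normal))
    = gauss_const ^ k * (\<integral>\<^sup>+ v. \<phi> v * ennreal (exp (- (\<Sum>i<k. (cmod (v i))\<^sup>2))) \<partial>lebn k)"
  using assms
proof (induction k arbitrary: \<phi>)
  case 0
  show ?case by (simp add: PiM_empty nn_integral_count_space_finite restrict_def)
next
  case (Suc k)
  note \<phi> [measurable] = Suc.prems(2)
  interpret S: sigma_finite_measure std_normal by (rule sigma_finite_std_normal)
  interpret P: product_sigma_finite "\<lambda>_::(nat \<times> nat) \<times> bool. std_normal" ..
  let ?PM = "\<lambda>I :: ((nat \<times> nat) \<times> bool) set. \<Pi>\<^sub>M p\<in>I. std_normal"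
  have ins: "(\<integral>\<^sup>+ b. f b \<partial>?PM (insert p I)) = (\<integral>\<^sup>+ b. (\<integral>\<^sup>+ y. f (b(p := y)) \<partial>std_normal) \<partial>?PM I)"
    and ins_meas: "(\<lambda>b. \<integral>\<^sup>+ y. f (b(p := y)) \<partial>std_normal) \<in> borel_measurable (?PM I)"
    if "finite I" "p \<notin> I" "f \<in> borel_measurable (?PM (insert p I))" for f p I
  proof -
    show "(\<integral>\<^sup>+ b. f b \<partial>?PM (insert p I)) = (\<integral>\<^sup>+ b. (\<integral>\<^sup>+ y. f (b(p := y)) \<partial>std_normal) \<partial>?PM I)"
      using that by (rule P.product_nn_integral_insert)
    have "(\<lambda>q. (fst q)(p := snd q)) \<in> ?PM I \<Otimes>\<^sub>M std_normal \<rightarrow>\<^sub>M ?PM (insert p I)"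
      by (rule measurable_fun_upd[where J=I]) auto
    from measurable_compose[OF this that(3)]
    have "(\<lambda>(b, y). f (b(p := y))) \<in> borel_measurable (?PM I \<Otimes>\<^sub>M std_normal)"
      by (simp add: split_beta')
    then show "(\<lambda>b. \<integral>\<^sup>+ y. f (b(p := y)) \<partial>std_normal) \<in> borel_measurable (?PM I)"
      by (rule measurable_nn_integral[OF sigma_finite_std_normal])
  qed
  have k: "k < n" using Suc.prems by simp
  let ?V = "\<lambda>b. \<lambda>i\<in>{..<k}. border_entry n b i"
  define f where "f b = \<phi> (\<lambda>i\<in>{..<Suc k}. border_entry n b i)" for b
  have comp: "(\<lambda>b. b p) \<in> ?PM I \<rightarrow>\<^sub>M borel" if "p \<in> I" for p I
    using measurable_component_singleton[of p I "\<lambda>_. std_normal"] that by simp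
  have entry: "(\<lambda>b. border_entry n b i) \<in> borel_measurable (?PM (border_indices n m))" if "i < m" for i m
  proof -
    have "((i, n), c) \<in> border_indices n m" "((n, i), c) \<in> border_indices n m" for c
      using that by (auto simp: border_indices_eq)
    from comp[OF this(1)] comp[OF this(2)] show ?thesis
      unfolding border_entry_def Complex_eq by (simp add: borel_measurable_add borel_measurable_diff borel_measurable_divide)
  qed
  have fm: "f \<in> borel_measurable (?PM (border_indices n (Suc k)))"
    unfolding f_def by (intro measurable_compose[OF _ \<phi>] measurable_lebnI entry)
  have notin: "((k, n), c) \<notin> border_indices n k" "((n, k), c) \<notin> border_indices n k" for c
    using k by (auto simp: border_indices_eq)
  have f_upd: "f (b(((k, n), False) := x1, ((n, k), False) := x2, ((k, n), True) := x3, ((n, k), True) := x4))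
      = \<phi> ((?V b)(k := Complex ((x1 + x2) / 2) ((x3 - x4) / 2)))" for b x1 x2 x3 x4
    unfolding f_def using k by (intro arg_cong[where f=\<phi>] ext) (auto simp: border_entry_def restrict_def)
  define \<phi>' where "\<phi>' v = (\<integral>\<^sup>+ z. \<phi> (v(k := z)) * ennreal (exp (- (cmod z)\<^sup>2)) \<partial>lborel)" for v
  have \<phi>'_meas: "\<phi>' \<in> borel_measurable (lebn k)"
    unfolding \<phi>'_def by measurable
  have "(\<integral>\<^sup>+ b. f b \<partial>?PM (border_indices n (Suc k)))
    = (\<integral>\<^sup>+ b. (\<integral>\<^sup>+ x1. (\<integral>\<^sup>+ x2. (\<integral>\<^sup>+ x3. (\<integral>\<^sup>+ x4. f (b(((k, n), False) := x1, ((n, k), False) := x2, ((k, n), True) := x3, ((n, k), True) := x4))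
       \<partial>std_normal) \<partial>std_normal) \<partial>std_normal) \<partial>std_normal) \<partial>?PM (border_indices n k))"
    (is "_ = ?R")
  proof -
    note fm' = fm[unfolded border_indices.simps(2)]
    let ?p1 = "((n, k), True)" and ?p2 = "((k, n), True)" and ?p3 = "((n, k), False)" and ?p4 = "((k, n), False)"
    have n1: "?p1 \<notin> insert ?p2 (insert ?p3 (insert ?p4 (border_indices n k)))"
      and n2: "?p2 \<notin> insert ?p3 (insert ?p4 (border_indices n k))"
      and n3: "?p3 \<notin> insert ?p4 (border_indices n k)"
      using k notin by auto
    have fin: "finite (insert ?p4 (border_indices n k))" "finite (insert ?p3 (insert ?p4 (border_indices n k)))"
      "finite (insert ?p2 (insert ?p3 (insert ?p4 (border_indices n k))))" by simp_all
    note m1 = ins_meas[OF fin(3) n1 fm']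
    note m2 = ins_meas[OF fin(2) n2 m1]
    note m3 = ins_meas[OF fin(1) n3 m2]
    have "(\<integral>\<^sup>+ b. f b \<partial>?PM (border_indices n (Suc k)))
        = (\<integral>\<^sup>+ b. (\<integral>\<^sup>+ x4. f (b(?p1 := x4)) \<partial>std_normal)
           \<partial>?PM (insert ?p2 (insert ?p3 (insert ?p4 (border_indices n k)))))"
      unfolding border_indices.simps(2) by (rule ins[OF _ n1 fm']) simp
    also have "\<dots> = (\<integral>\<^sup>+ b. (\<integral>\<^sup>+ x3. (\<integral>\<^sup>+ x4. f (b(?p2 := x3, ?p1 := x4)) \<partial>std_normal) \<partial>std_normal)
           \<partial>?PM (insert ?p3 (insert ?p4 (border_indices n k))))"
      by (rule ins[OF _ n2 m1]) simp
    also have "\<dots> = (\<integral>\<^sup>+ b. (\<integral>\<^sup>+ x2. (\<integral>\<^sup>+ x3. (\<integral>\<^sup>+ x4. f (b(?p3 := x2, ?p2 := x3, ?p1 := x4))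
           \<partial>std_normal) \<partial>std_normal) \<partial>std_normal) \<partial>?PM (insert ?p4 (border_indices n k)))"
      by (rule ins[OF _ n3 m2]) simp
    also have "\<dots> = ?R"
      by (rule ins[OF _ notin(1) m3]) simp
    finally show ?thesis .
  qed
  also have "?R = (\<integral>\<^sup>+ b. gauss_const * \<phi>' (?V b) \<partial>?PM (border_indices n k))"
    unfolding f_upd
  proof (rule nn_integral_cong)
    fix b
    have "?V b \<in> space (lebn k)" by (simp add: space_lebn)
    then have "(\<lambda>z. \<phi> ((?V b)(k := z))) \<in> borel_measurable borel" by measurable
    from std_normal_hermitian_entry[OF this]
    show "(\<integral>\<^sup>+ x1. (\<integral>\<^sup>+ x2. (\<integral>\<^sup>+ x3. (\<integral>\<^sup>+ x4. \<phi> ((?V b)(k := Complex ((x1 + x2) / 2) ((x3 - x4) / 2)))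
       \<partial>std_normal) \<partial>std_normal) \<partial>std_normal) \<partial>std_normal) = gauss_const * \<phi>' (?V b)"
      unfolding \<phi>'_def .
  qed
  also have "\<dots> = gauss_const * (\<integral>\<^sup>+ b. \<phi>' (?V b) \<partial>?PM (border_indices n k))"
    by (intro nn_integral_cmult measurable_compose[OF _ \<phi>'_meas] measurable_lebnI entry)
  also have "(\<integral>\<^sup>+ b. \<phi>' (?V b) \<partial>?PM (border_indices n k))
      = gauss_const ^ k * (\<integral>\<^sup>+ v. \<phi>' v * ennreal (exp (- (\<Sum>i<k. (cmod (v i))\<^sup>2))) \<partial>lebn k)"
    using Suc.prems by (intro Suc.IH \<phi>'_meas) simp
  also have "(\<integral>\<^sup>+ v. \<phi>' v * ennreal (exp (- (\<Sum>i<k. (cmod (v i))\<^sup>2))) \<partial>lebn k)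
     = (\<integral>\<^sup>+ v. \<phi> v * ennreal (exp (- (\<Sum>i<Suc k. (cmod (v i))\<^sup>2))) \<partial>lebn (Suc k))"
  proof -
    have "(\<lambda>v. \<phi> v * ennreal (exp (- (\<Sum>i<Suc k. (cmod (v i))\<^sup>2)))) \<in> borel_measurable (lebn (Suc k))"
      by measurable
    then have "(\<integral>\<^sup>+ v. \<phi> v * ennreal (exp (- (\<Sum>i<Suc k. (cmod (v i))\<^sup>2))) \<partial>lebn (Suc k))
       = (\<integral>\<^sup>+ v. (\<integral>\<^sup>+ z. \<phi> (v(k := z)) * ennreal (exp (- (\<Sum>i<Suc k. (cmod ((v(k := z)) i))\<^sup>2))) \<partial>lborel) \<partial>lebn k)"
      by (rule nn_integral_lebn_Suc)
    also have "\<dots> = (\<integral>\<^sup>+ v. \<phi>' v * ennreal (exp (- (\<Sum>i<k. (cmod (v i))\<^sup>2))) \<partial>lebn k)"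
    proof (rule nn_integral_cong)
      fix v :: "nat \<Rightarrow> complex" assume v: "v \<in> space (lebn k)"
      have "ennreal (exp (- (\<Sum>i<Suc k. (cmod ((v(k := z)) i))\<^sup>2)))
        = ennreal (exp (- (cmod z)\<^sup>2)) * ennreal (exp (- (\<Sum>i<k. (cmod (v i))\<^sup>2)))" for z
        by (simp add: ennreal_mult'[symmetric] exp_add[symmetric])
      moreover have "(\<lambda>z. \<phi> (v(k := z))) \<in> borel_measurable borel" using v by measurable
      ultimately show "(\<integral>\<^sup>+ z. \<phi> (v(k := z)) * ennreal (exp (- (\<Sum>i<Suc k. (cmod ((v(k := z)) i))\<^sup>2))) \<partial>lborel)
        = \<phi>' v * ennreal (exp (- (\<Sum>i<k. (cmod (v i))\<^sup>2)))"
        unfolding \<phi>'_def by (simp only: mult.assoc[symmetric]) (rule nn_integral_multc, simp)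
    qed
    finally show ?thesis ..
  qed
  finally show ?case by (simp only: f_def power_Suc mult.assoc)
qed

text \<open>Up to the factor \<open>gauss_const ^ n\<close>, the conditional expectation of
  \<open>f\<close> given that the minor is \<open>A\<close>: the corner keeps its normal law, the
  border has an unnormalised Gaussian weight.\<close>

definition border_mean :: "nat \<Rightarrow> (complex mat \<Rightarrow> ennreal) \<Rightarrow> complex mat \<Rightarrow> ennreal" where
  "border_mean n f A = (\<integral>\<^sup>+ v. (\<integral>\<^sup>+ d. f (border n A v d) \<partial>std_normal)
     * ennreal (exp (- (\<Sum>i<n. (cmod (v i))\<^sup>2))) \<partial>lebn n)"

lemma measurable_border_inner:
  assumes f: "f \<in> borel_measurable (mat_borel (Suc n))"
  shows "(\<lambda>(A, v). \<integral>\<^sup>+ d. f (border n A v d) \<partial>std_normal) \<in> borel_measurable (mat_borel n \<Otimes>\<^sub>M lebn n)"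
proof -
  have "(\<lambda>q. border n (fst (fst q)) (snd (fst q)) (snd q)) \<in> (mat_borel n \<Otimes>\<^sub>M lebn n) \<Otimes>\<^sub>M std_normal \<rightarrow>\<^sub>M mat_borel (Suc n)"
  proof (rule measurable_border)
    fix i assume "i < n"
    then show "(\<lambda>q. snd (fst q) i) \<in> (mat_borel n \<Otimes>\<^sub>M lebn n) \<Otimes>\<^sub>M std_normal \<rightarrow>\<^sub>M (borel :: complex measure)"
      by (intro measurable_compose[OF measurable_compose[OF measurable_fst measurable_snd] measurable_lebn_nth])
  qed simp_all
  from measurable_compose[OF this f]
  have "(\<lambda>(p, d). f (border n (fst p) (snd p) d)) \<in> borel_measurable ((mat_borel n \<Otimes>\<^sub>M lebn n) \<Otimes>\<^sub>M std_normal)"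
    by (simp add: split_beta')
  from measurable_nn_integral[OF sigma_finite_std_normal this]
  show ?thesis by (simp add: split_beta')
qed

lemma measurable_border_mean:
  assumes f: "f \<in> borel_measurable (mat_borel (Suc n))"
  shows "border_mean n f \<in> borel_measurable (mat_borel n)"
proof -
  have "(\<lambda>v. ennreal (exp (- (\<Sum>i<n. (cmod (v i))\<^sup>2)))) \<in> borel_measurable (lebn n)"
    by measurable
  from measurable_compose[OF measurable_snd this]
  have "(\<lambda>(A, v). (\<integral>\<^sup>+ d. f (border n A v d) \<partial>std_normal) * ennreal (exp (- (\<Sum>i<n. (cmod (v i))\<^sup>2))))
      \<in> borel_measurable (mat_borel n \<Otimes>\<^sub>M lebn n)"
    using measurable_border_inner[OF f] by (simp add: split_beta')
  from measurable_nn_integral[OF sigma_finite_lebn this]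
  show ?thesis by (simp add: border_mean_def[abs_def])
qed

lemma measurable_border_inner':
  assumes f: "f \<in> borel_measurable (mat_borel (Suc n))" and A: "A \<in> carrier_mat n n"
  shows "(\<lambda>v. \<integral>\<^sup>+ d. f (border n A v d) \<partial>std_normal) \<in> borel_measurable (lebn n)"
proof -
  have "(\<lambda>v. (A, v)) \<in> lebn n \<rightarrow>\<^sub>M mat_borel n \<Otimes>\<^sub>M lebn n"
    using A by (intro measurable_Pair measurable_const) simp_all
  from measurable_compose[OF this measurable_border_inner[OF f]] show ?thesis by simp
qed

lemma nn_integral_GUE_Suc:
  assumes f: "f \<in> borel_measurable (mat_borel (Suc n))"
  shows "(\<integral>\<^sup>+ A. f A \<partial>GUE (Suc n)) = gauss_const ^ n * (\<integral>\<^sup>+ A. border_mean n f A \<partial>GUE n)"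
proof -
  interpret S: sigma_finite_measure std_normal by (rule sigma_finite_std_normal)
  interpret P: product_sigma_finite "\<lambda>_::(nat \<times> nat) \<times> bool. std_normal" ..
  let ?PM = "\<lambda>I :: ((nat \<times> nat) \<times> bool) set. \<Pi>\<^sub>M p\<in>I. std_normal"
  let ?I = "\<lambda>n. ({..<n} \<times> {..<n}) \<times> (UNIV :: bool set)"
  let ?J = "insert ((n, n), False) (insert ((n, n), True) (border_indices n n))"
  have IJ: "?I (Suc n) = ?I n \<union> ?J" and disj: "?I n \<inter> ?J = {}"
    by (auto simp: border_indices_eq less_Suc_eq)
  have meas: "(\<lambda>g. f (hermitise (Suc n) g)) \<in> borel_measurable (?PM (?I (Suc n)))"
    using measurable_compose[OF GUE_map_measurable f] by (simp add: hermitise_def gauss_parts_def)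
  have "(\<integral>\<^sup>+ A. f A \<partial>GUE (Suc n)) = (\<integral>\<^sup>+ g. (\<integral>\<^sup>+ b. f (hermitise (Suc n) (merge (?I n) ?J (g, b))) \<partial>?PM ?J) \<partial>?PM (?I n))"
    unfolding nn_integral_GUE[OF f] using meas unfolding IJ
    by (intro P.product_nn_integral_fold[OF disj]) simp_all
  also have "\<dots> = (\<integral>\<^sup>+ g. gauss_const ^ n * border_mean n f (hermitise n g) \<partial>?PM (?I n))"
  proof (rule nn_integral_cong)
    fix g
    let ?A = "hermitise n g"
    let ?V = "\<lambda>b. \<lambda>i\<in>{..<n}. border_entry n b i"
    have A: "?A \<in> carrier_mat n n" by simp
    have split: "hermitise (Suc n) (merge (?I n) ?J (g, b)) = border n ?A (?V b) (b ((n, n), False))" for b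
    proof -
      have 1: "hermitise n (merge (?I n) ?J (g, b)) = ?A"
        by (rule eq_matI) (simp_all add: hermitise_index, simp add: merge_def)
      have 2: "border_entry n (merge (?I n) ?J (g, b)) i = ?V b i" if "i < n" for i
        using that by (simp add: border_entry_def merge_def border_indices_eq)
      have 3: "merge (?I n) ?J (g, b) ((n, n), False) = b ((n, n), False)"
        by (simp add: merge_def)
      show ?thesis
        unfolding hermitise_Suc 1 3 by (rule eq_matI) (auto simp: border_def 2)
    qed
    have comp: "(\<lambda>b. b p) \<in> ?PM I \<rightarrow>\<^sub>M borel" if "p \<in> I" for p I
      using measurable_component_singleton[of p I "\<lambda>_. std_normal"] that by simp
    have entry: "(\<lambda>b. border_entry n b i) \<in> borel_measurable (?PM I)" if "i < n" "border_indices n n \<subseteq> I" for i I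
    proof -
      have "((i, n), c) \<in> I" "((n, i), c) \<in> I" for c
        using that by (auto simp: border_indices_eq)
      from comp[OF this(1)] comp[OF this(2)] show ?thesis
        unfolding border_entry_def Complex_eq by (simp add: borel_measurable_add borel_measurable_diff borel_measurable_divide)
    qed
    have V: "?V \<in> ?PM I \<rightarrow>\<^sub>M lebn n" if "border_indices n n \<subseteq> I" for I
      by (intro measurable_lebnI entry that)
    have bm: "(\<lambda>(v, d). f (border n ?A v d)) \<in> borel_measurable (lebn n \<Otimes>\<^sub>M borel)"
    proof -
      have "(\<lambda>q. border n ?A (fst q) (snd q)) \<in> lebn n \<Otimes>\<^sub>M borel \<rightarrow>\<^sub>M mat_borel (Suc n)"
        by (intro measurable_border measurable_const measurable_compose[OF measurable_fst measurable_lebn_nth]) simp_all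
      from measurable_compose[OF this f] show ?thesis by (simp add: split_beta')
    qed
    have m1: "(\<lambda>b. f (border n ?A (?V b) (b ((n, n), False)))) \<in> borel_measurable (?PM ?J)"
    proof -
      have "(\<lambda>b. (?V b, b ((n, n), False))) \<in> ?PM ?J \<rightarrow>\<^sub>M lebn n \<Otimes>\<^sub>M borel"
        by (intro measurable_Pair V comp) auto
      from measurable_compose[OF this bm] show ?thesis by simp
    qed
    have m2: "(\<lambda>b. \<integral>\<^sup>+ d. f (border n ?A (?V b) d) \<partial>std_normal) \<in> borel_measurable (?PM I)"
      if "border_indices n n \<subseteq> I" for I
      by (rule measurable_compose[OF V[OF that] measurable_border_inner'[OF f A]])
    have Vupd: "?V (b(((n, n), c) := y)) = ?V b" for b c y
      by (auto simp: border_entry_def restrict_def)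
    have "(\<integral>\<^sup>+ b. f (hermitise (Suc n) (merge (?I n) ?J (g, b))) \<partial>?PM ?J)
      = (\<integral>\<^sup>+ b. (\<integral>\<^sup>+ d. f (border n ?A (?V b) d) \<partial>std_normal) \<partial>?PM (insert ((n, n), True) (border_indices n n)))"
      unfolding split
      by (subst P.product_nn_integral_insert[OF _ _ m1]) (simp_all only: Vupd fun_upd_same, auto simp: border_indices_eq finite_border_indices[unfolded border_indices_eq])
    also have "\<dots> = (\<integral>\<^sup>+ b. (\<integral>\<^sup>+ y. (\<integral>\<^sup>+ d. f (border n ?A (?V b) d) \<partial>std_normal) \<partial>std_normal) \<partial>?PM (border_indices n n))"
      by (subst P.product_nn_integral_insert[OF _ _ m2]) (simp_all only: Vupd, auto simp: border_indices_eq finite_border_indices[unfolded border_indices_eq])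
    \<comment> \<open>The imaginary variable at the corner has cancelled from the matrix, so its
      integral is that of a constant over a probability measure.\<close>
    also have "\<dots> = (\<integral>\<^sup>+ b. (\<integral>\<^sup>+ d. f (border n ?A (?V b) d) \<partial>std_normal) \<partial>?PM (border_indices n n))"
      using emeasure_std_normal_UNIV by (simp add: nn_integral_const)
    also have "\<dots> = gauss_const ^ n * border_mean n f ?A"
      unfolding border_mean_def
      by (rule nn_integral_border_entries[OF order_refl measurable_border_inner'[OF f A]])
    finally show "(\<integral>\<^sup>+ b. f (hermitise (Suc n) (merge (?I n) ?J (g, b))) \<partial>?PM ?J) = gauss_const ^ n * border_mean n f ?A" .
  qed
  also have "\<dots> = gauss_const ^ n * (\<integral>\<^sup>+ g. border_mean n f (hermitise n g) \<partial>?PM (?I n))"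
  proof (rule nn_integral_cmult)
    show "(\<lambda>g. border_mean n f (hermitise n g)) \<in> borel_measurable (?PM (?I n))"
      using measurable_compose[OF GUE_map_measurable measurable_border_mean[OF f]]
      by (simp add: hermitise_def gauss_parts_def)
  qed
  also have "\<dots> = gauss_const ^ n * (\<integral>\<^sup>+ A. border_mean n f A \<partial>GUE n)"
    by (simp only: nn_integral_GUE[OF measurable_border_mean[OF f]])
  finally show ?thesis .
qed

text \<open>Conjugation of the minor by \<open>U\<close> extends to conjugation by diag(U, 1) if the
  border vector is rotated by \<open>U\<close> too. The rotation preserves both Lebesgue measure and
  the Gaussian weight of the border.\<close>

lemma border_mean_invariant:
  assumes f: "f \<in> borel_measurable (mat_borel (Suc n))" and inv: "unitarily_invariant (Suc n) f"
  shows "unitarily_invariant n (border_mean n f)"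
  unfolding unitarily_invariant_def
proof (intro ballI allI impI)
  fix A U :: "complex mat" assume A: "A \<in> carrier_mat n n" and U: "unitary_mat n U"
  note Uc = unitary_mat_carrier[OF U]
  let ?B = "U * A * mat_adjoint U"
  have B: "?B \<in> carrier_mat n n" using A Uc mat_adjoint_carrier[OF Uc] by simp
  define R where "R v = (\<lambda>i\<in>{..<n}. \<Sum>j<n. U $$ (i, j) * v j)" for v
  \<comment> \<open>The adjoint of \<open>U\<close>, which inverts \<open>R\<close> from the right
    by orthonormality of the rows.\<close>
  define S where "S v = (\<lambda>i\<in>{..<n}. \<Sum>j<n. cnj (U $$ (j, i)) * v j)" for v
  define \<Psi> where "\<Psi> v = (\<integral>\<^sup>+ d. f (border n ?B v d) \<partial>std_normal) * ennreal (exp (- (\<Sum>i<n. (cmod (v i))\<^sup>2)))" for v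
  have "(\<integral>\<^sup>+ v. \<Psi> (R v) \<partial>lebn n) = (\<integral>\<^sup>+ v. \<Psi> v \<partial>lebn n)"
  proof (rule nn_integral_isometry_complex[where S=S])
    show "R \<in> lebn n \<rightarrow>\<^sub>M lebn n" "S \<in> lebn n \<rightarrow>\<^sub>M lebn n"
      unfolding R_def S_def
      by (intro measurable_lebnI borel_measurable_sum borel_measurable_times borel_measurable_const measurable_lebn_nth; simp)+
    show "\<Psi> \<in> borel_measurable (lebn n)"
      unfolding \<Psi>_def using measurable_border_inner'[OF f B] by measurable
  next
    fix x :: "nat \<Rightarrow> complex" assume x: "x \<in> space (lebn n)"
    show "R (S x) = x"
    proof
      fix i
      show "R (S x) i = x i"
      proof (cases "i < n")
        case True
        have "R (S x) i = (\<Sum>j<n. U $$ (i, j) * (\<Sum>k<n. cnj (U $$ (k, j)) * x k))"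
          using True by (simp add: R_def S_def)
        also have "\<dots> = (\<Sum>j<n. \<Sum>k<n. x k * (U $$ (i, j) * cnj (U $$ (k, j))))"
          by (simp add: sum_distrib_left mult_ac)
        also have "\<dots> = (\<Sum>k<n. x k * (\<Sum>j<n. U $$ (i, j) * cnj (U $$ (k, j))))"
          unfolding sum_distrib_left by (rule sum.swap)
        also have "\<dots> = (\<Sum>k<n. if k = i then x i else 0)"
          using True by (intro sum.cong refl) (simp add: unitary_mat_rows[OF U])
        finally show ?thesis using True by simp
      qed (use x in \<open>auto simp: R_def space_lebn extensional_def\<close>)
    qed
    show "(\<Sum>i<n. (cmod (R x i))\<^sup>2) = (\<Sum>i<n. (cmod (x i))\<^sup>2)"
      using sum_cmod_square_unitary[OF U, of x] by (simp add: R_def)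
  next
    fix x y :: "nat \<Rightarrow> complex" and i assume "i < n"
    then show "R (\<lambda>i\<in>{..<n}. x i + y i) i = R x i + R y i"
      by (simp add: R_def sum.distrib distrib_left)
  qed
  moreover have "\<Psi> (R v) = (\<integral>\<^sup>+ d. f (border n A v d) \<partial>std_normal) * ennreal (exp (- (\<Sum>i<n. (cmod (v i))\<^sup>2)))" for v
  proof -
    have "border n ?B (R v) d = extend_unitary n U * border n A v d * mat_adjoint (extend_unitary n U)" for d
      unfolding border_conj[OF A Uc] by (rule eq_matI) (auto simp: border_def R_def)
    then have "f (border n ?B (R v) d) = f (border n A v d)" for d
      using unitarily_invariantD[OF inv border_carrier unitary_extend[OF U]] by simp
    moreover have "(\<Sum>i<n. (cmod (R v i))\<^sup>2) = (\<Sum>i<n. (cmod (v i))\<^sup>2)"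
      using sum_cmod_square_unitary[OF U, of v] by (simp add: R_def)
    ultimately show ?thesis by (simp add: \<Psi>_def)
  qed
  ultimately show "border_mean n f ?B = border_mean n f A"
    by (simp add: border_mean_def \<Psi>_def)
qed

subsection \<open>Eigenvalue density\<close>

lemma sigma_finite_density_finite:
  assumes "u \<in> borel_measurable borel" "\<And>x. u x \<noteq> \<infinity>"
  shows "sigma_finite_measure (density (lborel :: real measure) u)"
  using assms by (subst sigma_finite_measure.sigma_finite_iff_density_finite[OF lborel.sigma_finite_measure_axioms]) auto

lemma nn_integral_PiM_density:
  fixes u :: "real \<Rightarrow> ennreal"
  assumes u [measurable]: "u \<in> borel_measurable borel" and fin: "\<And>x. u x \<noteq> \<infinity>"
    and "\<Phi> \<in> borel_measurable (lebn k)"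
  shows "(\<integral>\<^sup>+ x. \<Phi> x \<partial>(\<Pi>\<^sub>M i\<in>{..<k}. density lborel u)) = (\<integral>\<^sup>+ x. (\<Prod>i<k. u (x i)) * \<Phi> x \<partial>lebn k)"
  using assms(3)
proof (induction k arbitrary: \<Phi>)
  case 0
  show ?case by (simp add: PiM_empty nn_integral_count_space_finite)
next
  case (Suc k)
  note \<Phi> [measurable] = Suc.prems
  interpret D: sigma_finite_measure "density lborel u"
    using sigma_finite_density_finite[OF u fin] .
  interpret P: product_sigma_finite "\<lambda>_::nat. density lborel u" ..
  have sets: "sets (\<Pi>\<^sub>M i\<in>I. density lborel u) = sets (\<Pi>\<^sub>M i\<in>I. lborel)" for I :: "nat set"
    by (rule sets_PiM_cong) simp_all
  have "\<Phi> \<in> borel_measurable (\<Pi>\<^sub>M i\<in>insert k {..<k}. density lborel u)"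
    using \<Phi> unfolding lessThan_Suc[symmetric] by (subst measurable_cong_sets[OF sets refl])
  then have "(\<integral>\<^sup>+ x. \<Phi> x \<partial>(\<Pi>\<^sub>M i\<in>{..<Suc k}. density lborel u))
      = (\<integral>\<^sup>+ x. (\<integral>\<^sup>+ y. \<Phi> (x(k := y)) \<partial>density lborel u) \<partial>(\<Pi>\<^sub>M i\<in>{..<k}. density lborel u))"
    unfolding lessThan_Suc by (intro P.product_nn_integral_insert) simp_all
  also have "\<dots> = (\<integral>\<^sup>+ x. (\<integral>\<^sup>+ y. u y * \<Phi> (x(k := y)) \<partial>lborel) \<partial>(\<Pi>\<^sub>M i\<in>{..<k}. density lborel u))"
  proof (rule nn_integral_cong)
    fix x assume "x \<in> space (\<Pi>\<^sub>M i\<in>{..<k}. density lborel u)"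
    then have "x \<in> space (lebn k)" by (simp add: space_PiM)
    then have "(\<lambda>y. \<Phi> (x(k := y))) \<in> borel_measurable borel" by measurable
    then show "(\<integral>\<^sup>+ y. \<Phi> (x(k := y)) \<partial>density lborel u) = (\<integral>\<^sup>+ y. u y * \<Phi> (x(k := y)) \<partial>lborel)"
      by (subst nn_integral_density) simp_all
  qed
  also have "\<dots> = (\<integral>\<^sup>+ x. (\<Prod>i<k. u (x i)) * (\<integral>\<^sup>+ y. u y * \<Phi> (x(k := y)) \<partial>lborel) \<partial>lebn k)"
    by (rule Suc.IH) measurable
  also have "\<dots> = (\<integral>\<^sup>+ x. (\<integral>\<^sup>+ y. (\<Prod>i<Suc k. u ((x(k := y)) i)) * \<Phi> (x(k := y)) \<partial>lborel) \<partial>lebn k)"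
  proof (rule nn_integral_cong)
    fix x :: "nat \<Rightarrow> real" assume "x \<in> space (lebn k)"
    then have "(\<lambda>y. \<Phi> (x(k := y))) \<in> borel_measurable borel" by measurable
    then have "(\<Prod>i<k. u (x i)) * (\<integral>\<^sup>+ y. u y * \<Phi> (x(k := y)) \<partial>lborel)
        = (\<integral>\<^sup>+ y. (\<Prod>i<k. u (x i)) * (u y * \<Phi> (x(k := y))) \<partial>lborel)"
      by (intro nn_integral_cmult[symmetric]) simp
    also have "\<dots> = (\<integral>\<^sup>+ y. (\<Prod>i<Suc k. u ((x(k := y)) i)) * \<Phi> (x(k := y)) \<partial>lborel)"
      by (simp add: mult.assoc)
    finally show "(\<Prod>i<k. u (x i)) * (\<integral>\<^sup>+ y. u y * \<Phi> (x(k := y)) \<partial>lborel)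
      = (\<integral>\<^sup>+ y. (\<Prod>i<Suc k. u ((x(k := y)) i)) * \<Phi> (x(k := y)) \<partial>lborel)" .
  qed
  also have "\<dots> = (\<integral>\<^sup>+ x. (\<Prod>i<Suc k. u (x i)) * \<Phi> x \<partial>lebn (Suc k))"
    by (rule nn_integral_lebn_Suc[symmetric]) measurable
  finally show ?case .
qed

text \<open>The open half-line differs by a null set and provides the strictly positive weights that
  the partial fraction arguments require.\<close>

lemma nn_integral_cmod_square_pos:
  assumes [measurable]: "\<phi> \<in> borel_measurable borel"
  shows "(\<integral>\<^sup>+ z. \<phi> ((cmod z)\<^sup>2) \<partial>lborel) = (\<integral>\<^sup>+ w. \<phi> w \<partial>density lborel (\<lambda>w. ennreal pi * indicator {0<..} w))"
proof -
  have "(\<integral>\<^sup>+ w. ennreal pi * indicator {0..} w * \<phi> w \<partial>lborel) = (\<integral>\<^sup>+ w. ennreal pi * indicator {0<..} w * \<phi> w \<partial>lborel)"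
    by (intro nn_integral_cong_AE, rule eventually_mono[OF AE_lborel_singleton[of 0]]) (simp add: indicator_def less_le)
  then show ?thesis
    using nn_integral_cmod_square[OF assms] by (simp add: nn_integral_density)
qed

section \<open>Gaussian weight of a bordered diagonal matrix\<close>

lemma frobenius_real_diag: "frobenius n (real_diag n x) = (\<Sum>i<n. (x i)\<^sup>2)"
proof -
  have "(\<Sum>j<n. (cmod (real_diag n x $$ (i, j)))\<^sup>2) = (x i)\<^sup>2" if "i < n" for i
  proof -
    have "(\<Sum>j<n. (cmod (real_diag n x $$ (i, j)))\<^sup>2) = (\<Sum>j<n. if j = i then (x i)\<^sup>2 else 0)"
      using that by (intro sum.cong refl) (auto simp: real_diag_def)
    then show ?thesis using that by simp
  qed
  then show ?thesis by (simp add: frobenius_def)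
qed

lemma frobenius_arrow:
  assumes "\<And>i. i < n \<Longrightarrow> w i \<ge> 0"
  shows "frobenius (Suc n) (arrow n x w) = (\<Sum>i<n. (x i)\<^sup>2) + 2 * (\<Sum>i<n. w i) + (w n)\<^sup>2"
proof -
  have "frobenius (Suc n) (arrow n x w)
      = (\<Sum>i<n. (\<Sum>j<n. (cmod (real_diag n x $$ (i, j)))\<^sup>2) + w i) + ((\<Sum>j<n. w j) + (w n)\<^sup>2)"
    using assms by (simp add: frobenius_def arrow_def border_def)
  also have "(\<Sum>i<n. (\<Sum>j<n. (cmod (real_diag n x $$ (i, j)))\<^sup>2) + w i) = frobenius n (real_diag n x) + (\<Sum>i<n. w i)"
    by (simp add: frobenius_def sum.distrib)
  finally show ?thesis by (simp add: frobenius_real_diag)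
qed

lemma measurable_arrow:
  assumes "\<And>i. i < n \<Longrightarrow> (\<lambda>p. x p i) \<in> borel_measurable N" "\<And>i. i < Suc n \<Longrightarrow> (\<lambda>p. w p i) \<in> borel_measurable N"
  shows "(\<lambda>p. arrow n (x p) (w p)) \<in> N \<rightarrow>\<^sub>M mat_borel (Suc n)"
  unfolding arrow_def using assms by (intro measurable_border measurable_real_diag) simp_all

definition pos_indicator :: "nat \<Rightarrow> (nat \<Rightarrow> real) \<Rightarrow> ennreal" where
  "pos_indicator n w = (\<Prod>i<n. indicator {0<..} (w i))"

lemma pos_indicator_eq: "pos_indicator n w = (if \<forall>i<n. w i > 0 then 1 else 0)"
  by (auto simp: pos_indicator_def indicator_def)

lemma measurable_pos_indicator:
  assumes "\<And>i. i < n \<Longrightarrow> (\<lambda>p. w p i) \<in> borel_measurable N"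
  shows "(\<lambda>p. pos_indicator n (w p)) \<in> borel_measurable N"
  unfolding pos_indicator_def
proof (rule borel_measurable_prod_ennreal)
  fix i assume "i \<in> {..<n}"
  then show "(\<lambda>p. indicator {0<..} (w p i) :: ennreal) \<in> borel_measurable N"
    using measurable_compose[OF assms[of i] borel_measurable_indicator[of "{0<..}"]] by simp
qed

text \<open>For a Hermitian matrix the Frobenius square is the trace of A^2, so the exponential is
  the GUE density up to a constant. Off-diagonal entries are counted twice, which restores the
  weight exp (- |z|^2) of a border entry.\<close>

definition gauss_weight :: "nat \<Rightarrow> (complex mat \<Rightarrow> ennreal) \<Rightarrow> complex mat \<Rightarrow> ennreal" where
  "gauss_weight n f A = f A * ennreal (exp (- frobenius n A / 2))"

lemma measurable_gauss_weight:
  "f \<in> borel_measurable (mat_borel n) \<Longrightarrow> gauss_weight n f \<in> borel_measurable (mat_borel n)"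
  unfolding gauss_weight_def
  using measurable_compose[OF measurable_frobenius, of "\<lambda>r. ennreal (exp (- r / 2))" borel n]
  by (intro borel_measurable_times_ennreal) simp_all

text \<open>One factor pi for each squared modulus, and the normalisation of the normal
  corner.\<close>

definition polar_const :: "nat \<Rightarrow> ennreal" where
  "polar_const n = ennreal pi ^ n * ennreal (1 / sqrt (2 * pi))"

text \<open>Invariance removes the phases, and the squared moduli w i are the remaining variables.
  The exponents x^2 / 2 of the minor, w i of the border and d^2 / 2 of the corner add up to half the
  Frobenius square of the arrow matrix, so they merge into one weight that is itself unitarily
  invariant.\<close>

lemma border_mean_real_diag:
  assumes f: "f \<in> borel_measurable (mat_borel (Suc n))" and inv: "unitarily_invariant (Suc n) f"
  shows "border_mean n f (real_diag n x) * ennreal (exp (- (\<Sum>i<n. (x i)\<^sup>2) / 2))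
    = polar_const n * (\<integral>\<^sup>+ w. pos_indicator n w * gauss_weight (Suc n) f (arrow n x w) \<partial>lebn (Suc n))"
proof -
  let ?B = "\<lambda>w d. border n (real_diag n x) (\<lambda>i. complex_of_real (sqrt (w i))) d"
  define I where "I w = (\<integral>\<^sup>+ d. f (?B w d) * ennreal (exp (- d\<^sup>2 / 2)) \<partial>lborel)" for w
  define \<Psi> where "\<Psi> w = I w * ennreal (exp (- (\<Sum>i<n. w i)))" for w :: "nat \<Rightarrow> real"
  have fB: "(\<lambda>d. f (?B w d)) \<in> borel_measurable borel" for w
    by (intro measurable_compose[OF _ f] measurable_border measurable_const) simp_all
  have "(\<lambda>q. ?B (fst q) (snd q)) \<in> lebn n \<Otimes>\<^sub>M lborel \<rightarrow>\<^sub>M mat_borel (Suc n)"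
  proof (rule measurable_border)
    fix i assume "i < n"
    then have "(\<lambda>q. fst q i) \<in> lebn n \<Otimes>\<^sub>M lborel \<rightarrow>\<^sub>M (borel :: real measure)"
      by (intro measurable_compose[OF measurable_fst measurable_lebn_nth])
    then show "(\<lambda>q. complex_of_real (sqrt (fst q i))) \<in> lebn n \<Otimes>\<^sub>M lborel \<rightarrow>\<^sub>M borel"
      by (rule measurable_compose) (intro borel_measurable_continuous_onI continuous_intros)
  qed simp_all
  from measurable_compose[OF this f]
  have "(\<lambda>(w, d). f (?B w d) * ennreal (exp (- d\<^sup>2 / 2))) \<in> borel_measurable (lebn n \<Otimes>\<^sub>M lborel)"
    by (simp add: split_beta')
  then have I [measurable]: "I \<in> borel_measurable (lebn n)"
    unfolding I_def by (rule measurable_nn_integral[OF lborel.sigma_finite_measure_axioms])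
  have \<Psi> [measurable]: "\<Psi> \<in> borel_measurable (lebn n)"
    unfolding \<Psi>_def by measurable
  have std: "(\<integral>\<^sup>+ d. f (?B w d) \<partial>std_normal) = ennreal (1 / sqrt (2 * pi)) * I w" for w
  proof -
    have "(\<integral>\<^sup>+ d. f (?B w d) \<partial>std_normal) = (\<integral>\<^sup>+ d. ennreal (std_normal_density d) * f (?B w d) \<partial>lborel)"
      using fB by (subst nn_integral_density) simp_all
    also have "\<dots> = (\<integral>\<^sup>+ d. ennreal (1 / sqrt (2 * pi)) * (f (?B w d) * ennreal (exp (- d\<^sup>2 / 2))) \<partial>lborel)"
    proof (rule nn_integral_cong)
      fix d :: real
      have "ennreal (std_normal_density d) = ennreal (1 / sqrt (2 * pi)) * ennreal (exp (- d\<^sup>2 / 2))"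
        by (subst ennreal_mult'[symmetric]) (simp_all add: std_normal_density_def)
      then show "ennreal (std_normal_density d) * f (?B w d)
        = ennreal (1 / sqrt (2 * pi)) * (f (?B w d) * ennreal (exp (- d\<^sup>2 / 2)))"
        by (simp only: mult_ac)
    qed
    also have "\<dots> = ennreal (1 / sqrt (2 * pi)) * I w"
      unfolding I_def using fB by (intro nn_integral_cmult) simp
    finally show ?thesis .
  qed
  have "border_mean n f (real_diag n x) = (\<integral>\<^sup>+ v. ennreal (1 / sqrt (2 * pi)) * \<Psi> (\<lambda>i\<in>{..<n}. (cmod (v i))\<^sup>2) \<partial>lebn n)"
    unfolding border_mean_def
  proof (rule nn_integral_cong)
    fix v :: "nat \<Rightarrow> complex"
    let ?w = "\<lambda>i\<in>{..<n}. (cmod (v i))\<^sup>2"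
    have "border n (real_diag n x) (\<lambda>i. complex_of_real (cmod (v i))) d = ?B ?w d" for d
      by (rule eq_matI) (auto simp: border_def)
    then have "f (border n (real_diag n x) v d) = f (?B ?w d)" for d
      using border_real_diag_phases[OF inv] by metis
    moreover have "(\<Sum>i<n. (cmod (v i))\<^sup>2) = (\<Sum>i<n. ?w i)" by simp
    ultimately show "(\<integral>\<^sup>+ d. f (border n (real_diag n x) v d) \<partial>std_normal) * ennreal (exp (- (\<Sum>i<n. (cmod (v i))\<^sup>2)))
      = ennreal (1 / sqrt (2 * pi)) * \<Psi> ?w"
      by (simp only: std \<Psi>_def mult.assoc)
  qed
  also have "\<dots> = ennreal (1 / sqrt (2 * pi)) * (\<integral>\<^sup>+ v. \<Psi> (\<lambda>i\<in>{..<n}. (cmod (v i))\<^sup>2) \<partial>lebn n)"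
  proof (intro nn_integral_cmult measurable_compose[OF _ \<Psi>] measurable_lebnI)
    fix i assume "i < n"
    then have "(\<lambda>v. v i) \<in> lebn n \<rightarrow>\<^sub>M (borel :: complex measure)" by (rule measurable_lebn_nth)
    then show "(\<lambda>v. (cmod (v i))\<^sup>2) \<in> borel_measurable (lebn n)" by simp
  qed
  also have "(\<integral>\<^sup>+ v. \<Psi> (\<lambda>i\<in>{..<n}. (cmod (v i))\<^sup>2) \<partial>lebn n)
     = (\<integral>\<^sup>+ w. \<Psi> w \<partial>(\<Pi>\<^sub>M i\<in>{..<n}. density lborel (\<lambda>w. ennreal pi * indicator {0<..} w)))"
  proof (rule nn_integral_PiM_map)
    show "sigma_finite_measure (density lborel (\<lambda>w::real. ennreal pi * indicator {0<..} w))"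
      by (rule sigma_finite_density_finite) (auto simp: indicator_def)
    have sets: "sets (\<Pi>\<^sub>M i\<in>{..<n}. density lborel (\<lambda>w::real. ennreal pi * indicator {0<..} w)) = sets (lebn n)"
      by (rule sets_PiM_cong) simp_all
    show "\<Psi> \<in> borel_measurable (\<Pi>\<^sub>M i\<in>{..<n}. density lborel (\<lambda>w. ennreal pi * indicator {0<..} w))"
      unfolding measurable_cong_sets[OF sets refl] by (rule \<Psi>)
    fix \<phi> :: "real \<Rightarrow> ennreal" assume "\<phi> \<in> borel_measurable (density lborel (\<lambda>w. ennreal pi * indicator {0<..} w))"
    then show "(\<integral>\<^sup>+ z. \<phi> ((cmod z)\<^sup>2) \<partial>lborel) = (\<integral>\<^sup>+ w. \<phi> w \<partial>density lborel (\<lambda>w. ennreal pi * indicator {0<..} w))"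
      by (intro nn_integral_cmod_square_pos) simp
  qed (simp_all add: lborel.sigma_finite_measure_axioms)
  also have "\<dots> = (\<integral>\<^sup>+ w. (\<Prod>i<n. ennreal pi * indicator {0<..} (w i)) * \<Psi> w \<partial>lebn n)"
    by (rule nn_integral_PiM_density[OF _ _ \<Psi>]) (auto simp: indicator_def)
  also have "\<dots> = (\<integral>\<^sup>+ w. ennreal pi ^ n * (pos_indicator n w * \<Psi> w) \<partial>lebn n)"
    by (simp add: prod.distrib pos_indicator_def mult.assoc)
  also have "\<dots> = ennreal pi ^ n * (\<integral>\<^sup>+ w. pos_indicator n w * \<Psi> w \<partial>lebn n)"
    using measurable_pos_indicator[of n "\<lambda>w. w" "lebn n"] by (intro nn_integral_cmult) simp
  finally have 1: "border_mean n f (real_diag n x) = polar_const n * (\<integral>\<^sup>+ w. pos_indicator n w * \<Psi> w \<partial>lebn n)"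
    by (simp add: polar_const_def mult_ac)
  let ?e = "ennreal (exp (- (\<Sum>i<n. (x i)\<^sup>2) / 2))"
  have "(\<integral>\<^sup>+ w. pos_indicator n w * gauss_weight (Suc n) f (arrow n x w) \<partial>lebn (Suc n))
     = (\<integral>\<^sup>+ w. (\<integral>\<^sup>+ d. pos_indicator n (w(n := d)) * gauss_weight (Suc n) f (arrow n x (w(n := d))) \<partial>lborel) \<partial>lebn n)"
  proof (rule nn_integral_lebn_Suc)
    have "(\<lambda>w. arrow n x w) \<in> lebn (Suc n) \<rightarrow>\<^sub>M mat_borel (Suc n)"
      by (rule measurable_arrow) simp_all
    then show "(\<lambda>w. pos_indicator n w * gauss_weight (Suc n) f (arrow n x w)) \<in> borel_measurable (lebn (Suc n))"
      by (intro borel_measurable_times_ennreal measurable_compose[OF _ measurable_gauss_weight[OF f]]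
          measurable_pos_indicator) simp_all
  qed
  also have "\<dots> = (\<integral>\<^sup>+ w. (pos_indicator n w * \<Psi> w) * ?e \<partial>lebn n)"
  proof (rule nn_integral_cong)
    fix w :: "nat \<Rightarrow> real"
    have ind: "pos_indicator n (w(n := d)) = pos_indicator n w" for d
      by (simp add: pos_indicator_def)
    have arr: "arrow n x (w(n := d)) = ?B w d" for d
      unfolding arrow_def by (rule eq_matI) (auto simp: border_def)
    show "(\<integral>\<^sup>+ d. pos_indicator n (w(n := d)) * gauss_weight (Suc n) f (arrow n x (w(n := d))) \<partial>lborel)
      = (pos_indicator n w * \<Psi> w) * ?e"
    proof (cases "\<forall>i<n. w i > 0")
      case True
      then have pi1: "pos_indicator n w = 1" by (simp add: pos_indicator_eq)
      have "ennreal (exp (- frobenius (Suc n) (arrow n x (w(n := d))) / 2))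
          = ennreal (exp (- d\<^sup>2 / 2)) * (ennreal (exp (- (\<Sum>i<n. w i))) * ?e)" for d
      proof -
        have "frobenius (Suc n) (arrow n x (w(n := d))) = (\<Sum>i<n. (x i)\<^sup>2) + 2 * (\<Sum>i<n. w i) + d\<^sup>2"
          using True by (subst frobenius_arrow) (auto simp: less_imp_le)
        then have "exp (- frobenius (Suc n) (arrow n x (w(n := d))) / 2)
          = exp (- d\<^sup>2 / 2) * (exp (- (\<Sum>i<n. w i)) * exp (- (\<Sum>i<n. (x i)\<^sup>2) / 2))"
          by (simp only: exp_add[symmetric]) (simp add: field_simps)
        then show ?thesis by (simp only: ennreal_mult' exp_ge_zero mult_nonneg_nonneg)
      qed
      then have "(\<integral>\<^sup>+ d. pos_indicator n (w(n := d)) * gauss_weight (Suc n) f (arrow n x (w(n := d))) \<partial>lborel)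
        = (\<integral>\<^sup>+ d. (f (?B w d) * ennreal (exp (- d\<^sup>2 / 2))) * (ennreal (exp (- (\<Sum>i<n. w i))) * ?e) \<partial>lborel)"
        unfolding ind pi1 gauss_weight_def by (simp only: mult_1 mult.assoc arr)
      also have "\<dots> = I w * (ennreal (exp (- (\<Sum>i<n. w i))) * ?e)"
        unfolding I_def using fB by (intro nn_integral_multc) simp
      finally show ?thesis by (simp only: \<Psi>_def pi1 mult_1 mult.assoc)
    next
      case False
      then have "pos_indicator n w = 0" by (auto simp: pos_indicator_eq)
      then show ?thesis unfolding ind by simp
    qed
  qed
  also have "\<dots> = (\<integral>\<^sup>+ w. pos_indicator n w * \<Psi> w \<partial>lebn n) * ?e"
    using measurable_pos_indicator[of n "\<lambda>w. w" "lebn n"] by (intro nn_integral_multc) simp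
  finally show ?thesis
    unfolding 1 by (simp only: mult.assoc)
qed

lemma gauss_weight_unitary:
  assumes "unitarily_invariant n f" "A \<in> carrier_mat n n" "unitary_mat n U"
  shows "gauss_weight n f (U * A * mat_adjoint U) = gauss_weight n f A"
  using unitarily_invariantD[OF assms] frobenius_unitary[OF assms(2,3)] by (simp add: gauss_weight_def)

text \<open>The integration variables change from border data to coefficients, which uses up the
  Vandermonde factor of x, and from coefficients to roots, which produces (n + 1)! and the
  Vandermonde factor of y. The arrow matrix is unitarily equivalent to the diagonal matrix of y, so
  the integrand may be evaluated there. If two of the x coincide, both sides are zero.\<close>

lemma arrow_integral_eigenvalues:
  fixes f :: "complex mat \<Rightarrow> ennreal"
  assumes f: "f \<in> borel_measurable (mat_borel (Suc n))" and inv: "unitarily_invariant (Suc n) f"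
  shows "fact (Suc n) * (ennreal \<bar>vandermonde n x\<bar>
      * (\<integral>\<^sup>+ w. pos_indicator n w * gauss_weight (Suc n) f (arrow n x w) \<partial>lebn (Suc n)))
    = (if inj_on x {..<n} then \<integral>\<^sup>+ y. pos_indicator n (\<lambda>i. - poly (roots_poly (Suc n) y) (x i) / node n x i)
        * gauss_weight (Suc n) f (real_diag (Suc n) y) * ennreal \<bar>vandermonde (Suc n) y\<bar> \<partial>lebn (Suc n) else 0)"
proof (cases "inj_on x {..<n}")
  case False
  then have "vandermonde n x = 0" using vandermonde_eq_0_iff[of n x] by simp
  then show ?thesis using False by simp
next
  case True
  let ?F = "gauss_weight (Suc n) f"
  define \<phi> where "\<phi> w = pos_indicator n w * ?F (arrow n x w)" for w
  have \<phi>: "\<phi> \<in> borel_measurable (lebn (Suc n))"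
    unfolding \<phi>_def
    by (intro borel_measurable_times_ennreal measurable_compose[OF _ measurable_gauss_weight[OF f]]
        measurable_pos_indicator measurable_arrow) simp_all
  let ?W = "\<lambda>y i. - poly (roots_poly (Suc n) y) (x i) / node n x i"
  \<comment> \<open>Positive weights make the characteristic polynomial a Herglotz numerator with
    \<alpha> = 1, so its roots are real and simple.\<close>
  have supp: "card {t. poly (coeffs_poly (Suc n) c) t = 0} = Suc n" if "\<phi> (arrow_data n x c) \<noteq> 0" for c
  proof -
    let ?P = "coeffs_poly (Suc n) c"
    let ?w = "\<lambda>i. - poly ?P (x i) / node n x i"
    have pos: "?w i > 0" if "i < n" for i
      using that \<open>\<phi> (arrow_data n x c) \<noteq> 0\<close>
      by (auto simp: \<phi>_def pos_indicator_eq arrow_data_def simp del: coeffs_poly.simps split: if_splits)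
    have P: "?P = herglotz_poly 1 (- coeff ?P n - (\<Sum>i<n. x i)) n x ?w"
      using secular_equation[OF True, of ?P] unfolding herglotz_poly_def
      by (simp only: degree_coeffs_poly lead_coeff_coeffs_poly smult_1_left simp_thms)
    have "card {t. poly (herglotz_poly 1 (- coeff ?P n - (\<Sum>i<n. x i)) n x ?w) t = 0}
        = degree (herglotz_poly 1 (- coeff ?P n - (\<Sum>i<n. x i)) n x ?w)"
      by (rule herglotz_card_roots[OF True _ zero_le_one]) (rule pos, assumption, simp)
    then have "card {t. poly ?P t = 0} = degree ?P" unfolding P[symmetric] .
    then show ?thesis by (simp only: degree_coeffs_poly)
  qed
  have "ennreal \<bar>vandermonde n x\<bar> * (\<integral>\<^sup>+ w. \<phi> w \<partial>lebn (Suc n)) = (\<integral>\<^sup>+ c. \<phi> (arrow_data n x c) \<partial>lebn (Suc n))"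
    by (rule nn_integral_arrow_data[OF True \<phi>, symmetric])
  then have "fact (Suc n) * (ennreal \<bar>vandermonde n x\<bar> * (\<integral>\<^sup>+ w. \<phi> w \<partial>lebn (Suc n)))
    = (\<integral>\<^sup>+ y. \<phi> (arrow_data n x (poly_coeffs (Suc n) (roots_poly (Suc n) y))) * ennreal \<bar>vandermonde (Suc n) y\<bar> \<partial>lebn (Suc n))"
  proof -
    have "(\<integral>\<^sup>+ y. \<phi> (arrow_data n x (poly_coeffs (Suc n) (roots_poly (Suc n) y))) * ennreal \<bar>vandermonde (Suc n) y\<bar> \<partial>lebn (Suc n))
        = fact (Suc n) * (\<integral>\<^sup>+ c. \<phi> (arrow_data n x c) \<partial>lebn (Suc n))"
      by (rule nn_integral_roots_coeffs[OF measurable_compose[OF measurable_arrow_data \<phi>]]) (rule supp)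
    then show ?thesis using \<open>ennreal \<bar>vandermonde n x\<bar> * _ = _\<close> by (simp only:)
  qed
  also have "\<dots> = (\<integral>\<^sup>+ y. pos_indicator n (?W y) * ?F (real_diag (Suc n) y) * ennreal \<bar>vandermonde (Suc n) y\<bar> \<partial>lebn (Suc n))"
  proof (rule nn_integral_cong)
    fix y :: "nat \<Rightarrow> real"
    let ?w = "arrow_data n x (poly_coeffs (Suc n) (roots_poly (Suc n) y))"
    have cp: "coeffs_poly (Suc n) (poly_coeffs (Suc n) (roots_poly (Suc n) y)) = roots_poly (Suc n) y"
      by (rule coeffs_poly_poly_coeffs) simp_all
    have wi: "?w i = ?W y i" if "i < n" for i
      using that cp by (simp add: arrow_data_def del: coeffs_poly.simps)
    have pw: "pos_indicator n ?w = pos_indicator n (?W y)"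
      unfolding pos_indicator_def by (intro prod.cong refl) (simp add: wi)
    show "\<phi> ?w * ennreal \<bar>vandermonde (Suc n) y\<bar>
      = pos_indicator n (?W y) * ?F (real_diag (Suc n) y) * ennreal \<bar>vandermonde (Suc n) y\<bar>"
    \<comment> \<open>Diagonalisation requires distinct y and positive weights; in all other cases
      the Vandermonde factor or the positivity indicator is zero.\<close>
    proof (cases "inj_on y {..<Suc n} \<and> (\<forall>i<n. ?W y i > 0)")
      case good: True
      then obtain U where U: "unitary_mat (Suc n) U" "arrow n x ?w = U * real_diag (Suc n) y * mat_adjoint U"
        using arrow_diagonalisation[OF True, of y] wi by auto
      have "?F (arrow n x ?w) = ?F (real_diag (Suc n) y)"
        unfolding U(2) by (rule gauss_weight_unitary[OF inv real_diag_carrier U(1)])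
      then show ?thesis by (simp only: \<phi>_def pw)
    next
      case bad: False
      show ?thesis
      proof (cases "inj_on y {..<Suc n}")
        case inj: True
        then have "pos_indicator n (?W y) = 0" using bad by (auto simp: pos_indicator_eq)
        then show ?thesis by (simp only: \<phi>_def pw mult_zero_left)
      next
        case False
        then have "vandermonde (Suc n) y = 0" using vandermonde_eq_0_iff[of "Suc n" y] by simp
        then show ?thesis by simp
      qed
    qed
  qed
  finally show ?thesis using True by (simp only: \<phi>_def if_True)
qed

lemma nn_integral_interlacing':
  assumes "inj_on y {..<Suc k}"
  shows "(\<integral>\<^sup>+ x. pos_indicator k (\<lambda>i. - poly (roots_poly (Suc k) y) (x i) / node k x i) * ennreal \<bar>vandermonde k x\<bar> \<partial>lebn k)
    = interlacing_const k * ennreal \<bar>vandermonde (Suc k) y\<bar>"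
  using nn_integral_interlacing[OF assms] by (simp add: pos_indicator_eq indicator_def of_bool_def)

text \<open>The squared Vandermonde factor of the minor is spent in two halves. One half converts
  the border integral into an integral over the eigenvalues y of the whole matrix; after exchanging
  the integrals, the other half, integrated over all x that interlace with y, becomes a second
  Vandermonde factor of y.\<close>

theorem GUE_eigenvalue_density:
  "\<exists>C. \<forall>f. f \<in> borel_measurable (mat_borel n) \<longrightarrow> unitarily_invariant n f \<longrightarrow>
    (\<integral>\<^sup>+ A. f A \<partial>GUE n) = C * (\<integral>\<^sup>+ y. gauss_weight n f (real_diag n y) * ennreal \<bar>vandermonde n y\<bar> ^ 2 \<partial>lebn n)"
proof (induction n)
  case 0
  show ?case
  proof (intro exI[of _ 1] allI impI)
    fix f :: "complex mat \<Rightarrow> ennreal" assume f: "f \<in> borel_measurable (mat_borel 0)"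
    have eq: "A = real_diag 0 y" if "A \<in> carrier_mat 0 0" for A y
      using that by (intro eq_matI) (simp_all add: real_diag_def)
    show "(\<integral>\<^sup>+ A. f A \<partial>GUE 0) = 1 * (\<integral>\<^sup>+ y. gauss_weight 0 f (real_diag 0 y) * ennreal \<bar>vandermonde 0 y\<bar> ^ 2 \<partial>lebn 0)"
      unfolding nn_integral_GUE[OF f] eq[OF hermitise_carrier, of _ "\<lambda>_. undefined"]
      by (simp add: PiM_empty nn_integral_count_space_finite gauss_weight_def frobenius_def vandermonde_def)
  qed
next
  case (Suc n)
  then obtain C where C: "\<And>f. f \<in> borel_measurable (mat_borel n) \<Longrightarrow> unitarily_invariant n f \<Longrightarrow>
    (\<integral>\<^sup>+ A. f A \<partial>GUE n) = C * (\<integral>\<^sup>+ y. gauss_weight n f (real_diag n y) * ennreal \<bar>vandermonde n y\<bar> ^ 2 \<partial>lebn n)"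
    by blast
  show ?case
  \<comment> \<open>The factors stem from the Gaussian border entries, the density of the minor, the
    polar coordinates, the orderings of the roots and the interlacing integral.\<close>
  proof (intro exI[of _ "gauss_const ^ n * C * polar_const n * inverse (fact (Suc n)) * interlacing_const n"] allI impI)
    fix f :: "complex mat \<Rightarrow> ennreal"
    assume f: "f \<in> borel_measurable (mat_borel (Suc n))" and inv: "unitarily_invariant (Suc n) f"
    let ?F = "gauss_weight (Suc n) f"
    let ?W = "\<lambda>y x i. - poly (roots_poly (Suc n) y) (x i) / node n x i"
    define X where "X x = (\<integral>\<^sup>+ w. pos_indicator n w * ?F (arrow n x w) \<partial>lebn (Suc n))" for x
    have fa: "(fact (Suc n) :: ennreal) \<noteq> 0" "(fact (Suc n) :: ennreal) \<noteq> \<infinity>"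
      by (simp_all add: fact_nonzero del: fact_Suc)
    then have inv_fact: "A = inverse (fact (Suc n)) * B" if "fact (Suc n) * A = B" for A B :: ennreal
    proof -
      have "fact (Suc n) * inverse (fact (Suc n) :: ennreal) = 1"
        using ennreal_divide_self[OF fa(1)] fa(2) by (simp only: divide_ennreal_def infinity_ennreal_def less_top)
      then show ?thesis unfolding that[symmetric] by (metis mult.assoc mult.commute mult_1)
    qed
    have W_meas: "(\<lambda>p. ?W (snd p) (fst p) i) \<in> borel_measurable (lebn n \<Otimes>\<^sub>M lebn (Suc n))" if "i < n" for i
      unfolding poly_roots_poly
      by (intro borel_measurable_divide borel_measurable_uminus borel_measurable_prod borel_measurable_diff measurable_node
          measurable_compose[OF measurable_fst measurable_lebn_nth] measurable_compose[OF measurable_snd measurable_lebn_nth] that)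
        simp_all
    have Fd: "(\<lambda>y. ?F (real_diag (Suc n) y)) \<in> borel_measurable (lebn (Suc n))"
      by (intro measurable_compose[OF _ measurable_gauss_weight[OF f]] measurable_real_diag) simp
    have V: "(\<lambda>y. ennreal \<bar>vandermonde k y\<bar>) \<in> borel_measurable (lebn k)" for k
      using measurable_vandermonde[of k "\<lambda>y. y" "lebn k"] by simp
    \<comment> \<open>The unnormalised joint density of the eigenvalues x of the minor and y of the
      whole matrix, times the value of \<open>f\<close>.\<close>
    define G where "G x y = ennreal \<bar>vandermonde n x\<bar> * (pos_indicator n (?W y x) * ?F (real_diag (Suc n) y)
        * ennreal \<bar>vandermonde (Suc n) y\<bar>)" for x y
    have G: "(\<lambda>(x, y). G x y) \<in> borel_measurable (lebn n \<Otimes>\<^sub>M lebn (Suc n))"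
      unfolding G_def split_beta'
      by (intro borel_measurable_times_ennreal measurable_pos_indicator W_meas
          measurable_compose[OF measurable_fst V] measurable_compose[OF measurable_snd V] measurable_compose[OF measurable_snd Fd])
    have "(\<integral>\<^sup>+ A. border_mean n f A \<partial>GUE n)
      = C * (\<integral>\<^sup>+ x. gauss_weight n (border_mean n f) (real_diag n x) * ennreal \<bar>vandermonde n x\<bar> ^ 2 \<partial>lebn n)"
      by (rule C[OF measurable_border_mean[OF f] border_mean_invariant[OF f inv]])
    also have "(\<integral>\<^sup>+ x. gauss_weight n (border_mean n f) (real_diag n x) * ennreal \<bar>vandermonde n x\<bar> ^ 2 \<partial>lebn n)
      = (\<integral>\<^sup>+ x. polar_const n * inverse (fact (Suc n)) * (\<integral>\<^sup>+ y. G x y \<partial>lebn (Suc n)) \<partial>lebn n)"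
    proof (rule nn_integral_cong)
      fix x :: "nat \<Rightarrow> real" assume x: "x \<in> space (lebn n)"
      have Gx: "(\<lambda>y. pos_indicator n (?W y x) * ?F (real_diag (Suc n) y) * ennreal \<bar>vandermonde (Suc n) y\<bar>) \<in> borel_measurable (lebn (Suc n))"
        unfolding poly_roots_poly
        by (intro borel_measurable_times_ennreal measurable_pos_indicator Fd V borel_measurable_divide borel_measurable_uminus
            borel_measurable_prod borel_measurable_diff borel_measurable_const measurable_lebn_nth) simp_all
      have "fact (Suc n) * (ennreal \<bar>vandermonde n x\<bar> ^ 2 * X x) = (\<integral>\<^sup>+ y. G x y \<partial>lebn (Suc n))"
      proof -
        have "fact (Suc n) * (ennreal \<bar>vandermonde n x\<bar> ^ 2 * X x)
           = ennreal \<bar>vandermonde n x\<bar> * (fact (Suc n) * (ennreal \<bar>vandermonde n x\<bar> * X x))"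
          by (simp only: power2_eq_square mult_ac)
        also have "\<dots> = ennreal \<bar>vandermonde n x\<bar> * (\<integral>\<^sup>+ y. pos_indicator n (?W y x) * ?F (real_diag (Suc n) y)
             * ennreal \<bar>vandermonde (Suc n) y\<bar> \<partial>lebn (Suc n))"
          unfolding X_def arrow_integral_eigenvalues[OF f inv]
          using vandermonde_eq_0_iff[of n x] by simp
        also have "\<dots> = (\<integral>\<^sup>+ y. G x y \<partial>lebn (Suc n))"
          unfolding G_def by (rule nn_integral_cmult[symmetric, OF Gx])
        finally show ?thesis .
      qed
      from inv_fact[OF this] have "ennreal \<bar>vandermonde n x\<bar> ^ 2 * X x = inverse (fact (Suc n)) * (\<integral>\<^sup>+ y. G x y \<partial>lebn (Suc n))" .
      moreover have "gauss_weight n (border_mean n f) (real_diag n x) = polar_const n * X x"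
        unfolding X_def border_mean_real_diag[OF f inv, symmetric]
        by (simp only: gauss_weight_def[of n] frobenius_real_diag)
      ultimately show "gauss_weight n (border_mean n f) (real_diag n x) * ennreal \<bar>vandermonde n x\<bar> ^ 2
        = polar_const n * inverse (fact (Suc n)) * (\<integral>\<^sup>+ y. G x y \<partial>lebn (Suc n))"
        by (simp only: mult.assoc mult.commute[of "X x"])
    qed
    also have "\<dots> = polar_const n * inverse (fact (Suc n)) * (\<integral>\<^sup>+ x. (\<integral>\<^sup>+ y. G x y \<partial>lebn (Suc n)) \<partial>lebn n)"
      by (rule nn_integral_cmult) (rule measurable_nn_integral[OF sigma_finite_lebn G])
    also have "(\<integral>\<^sup>+ x. (\<integral>\<^sup>+ y. G x y \<partial>lebn (Suc n)) \<partial>lebn n) = (\<integral>\<^sup>+ y. (\<integral>\<^sup>+ x. G x y \<partial>lebn n) \<partial>lebn (Suc n))"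
      by (rule nn_integral_swap[OF sigma_finite_lebn sigma_finite_lebn G])
    also have "\<dots> = (\<integral>\<^sup>+ y. interlacing_const n * (?F (real_diag (Suc n) y) * ennreal \<bar>vandermonde (Suc n) y\<bar> ^ 2) \<partial>lebn (Suc n))"
    proof (rule nn_integral_cong)
      fix y :: "nat \<Rightarrow> real"
      have "(\<lambda>x. pos_indicator n (?W y x) * ennreal \<bar>vandermonde n x\<bar>) \<in> borel_measurable (lebn n)"
        unfolding poly_roots_poly
        by (intro borel_measurable_times_ennreal measurable_pos_indicator V borel_measurable_divide borel_measurable_uminus
            borel_measurable_prod borel_measurable_diff borel_measurable_const measurable_lebn_nth measurable_node) simp_all
      then have "(\<integral>\<^sup>+ x. G x y \<partial>lebn n) = (\<integral>\<^sup>+ x. pos_indicator n (?W y x) * ennreal \<bar>vandermonde n x\<bar> \<partial>lebn n)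
          * (?F (real_diag (Suc n) y) * ennreal \<bar>vandermonde (Suc n) y\<bar>)"
        unfolding G_def by (subst nn_integral_multc[symmetric]) (simp_all only: mult_ac)
      then show "(\<integral>\<^sup>+ x. G x y \<partial>lebn n) = interlacing_const n * (?F (real_diag (Suc n) y) * ennreal \<bar>vandermonde (Suc n) y\<bar> ^ 2)"
        using nn_integral_interlacing'[of y n] vandermonde_eq_0_iff[of "Suc n" y]
        by (cases "inj_on y {..<Suc n}") (simp_all add: power2_eq_square mult_ac)
    qed
    also have "\<dots> = interlacing_const n * (\<integral>\<^sup>+ y. ?F (real_diag (Suc n) y) * ennreal \<bar>vandermonde (Suc n) y\<bar> ^ 2 \<partial>lebn (Suc n))"
      using Fd V[of "Suc n"] by (intro nn_integral_cmult) simp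
    finally show "(\<integral>\<^sup>+ A. f A \<partial>GUE (Suc n)) = gauss_const ^ n * C * polar_const n * inverse (fact (Suc n)) * interlacing_const n
      * (\<integral>\<^sup>+ y. gauss_weight (Suc n) f (real_diag (Suc n) y) * ennreal \<bar>vandermonde (Suc n) y\<bar> ^ 2 \<partial>lebn (Suc n))"
      unfolding nn_integral_GUE_Suc[OF f] by (simp only: mult.assoc)
  qed
qed

subsection \<open>Smallest singular value\<close>

lemma mat_adjoint_mult:
  fixes A B :: "complex mat"
  assumes A: "A \<in> carrier_mat n m" and B: "B \<in> carrier_mat m k"
  shows "mat_adjoint (A * B) = mat_adjoint B * mat_adjoint A"
proof (rule eq_matI)
  note A' = mat_adjoint_carrier[OF A] and B' = mat_adjoint_carrier[OF B]
  have AB: "A * B \<in> carrier_mat n k" using A B by simp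
  fix i j assume "i < dim_row (mat_adjoint B * mat_adjoint A)" "j < dim_col (mat_adjoint B * mat_adjoint A)"
  then have ij: "i < k" "j < n" using A' B' by auto
  have "mat_adjoint (A * B) $$ (i, j) = (\<Sum>l<m. cnj (B $$ (l, i)) * cnj (A $$ (j, l)))"
    unfolding mat_adjoint_index[OF AB ij] index_mult_mat_sum[OF A B ij(2,1)] by (simp add: mult.commute)
  also have "\<dots> = (mat_adjoint B * mat_adjoint A) $$ (i, j)"
    unfolding index_mult_mat_sum[OF B' A' ij]
    by (intro sum.cong refl) (simp add: mat_adjoint_index[OF A] mat_adjoint_index[OF B] ij)
  finally show "mat_adjoint (A * B) $$ (i, j) = (mat_adjoint B * mat_adjoint A) $$ (i, j)" .
qed (use A B in \<open>simp_all add: mat_adjoint_def mat_of_rows_def\<close>)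

lemma mat_adjoint_adjoint:
  fixes A :: "complex mat"
  assumes A: "A \<in> carrier_mat n m"
  shows "mat_adjoint (mat_adjoint A) = A"
proof (rule eq_matI)
  note A' = mat_adjoint_carrier[OF A]
  fix i j assume "i < dim_row A" "j < dim_col A"
  then have ij: "i < n" "j < m" using A by auto
  show "mat_adjoint (mat_adjoint A) $$ (i, j) = A $$ (i, j)"
    unfolding mat_adjoint_index[OF A' ij] mat_adjoint_index[OF A ij(2,1)] by simp
qed (use A in \<open>simp_all add: mat_adjoint_def mat_of_rows_def\<close>)

text \<open>In the product of the adjoint with the matrix the inner unitary factors cancel, so A^H A
  is conjugated by \<open>U\<close> and keeps its characteristic polynomial.\<close>

lemma singular_values_unitary:
  assumes A: "A \<in> carrier_mat n n" and U: "unitary_mat n U"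
  shows "singular_values (U * A * mat_adjoint U) = singular_values A"
proof -
  note Uc = unitary_mat_carrier[OF U]
  note Ua = mat_adjoint_carrier[OF Uc] and Aa = mat_adjoint_carrier[OF A]
  have UU: "mat_adjoint U * U = 1\<^sub>m n" using U by (simp add: unitary_mat_def)
  let ?B = "U * A * mat_adjoint U"
  have UA: "U * A \<in> carrier_mat n n" using Uc A by simp
  have B: "?B \<in> carrier_mat n n" using UA Ua by simp
  have AU: "A * mat_adjoint U \<in> carrier_mat n n" using A Ua by simp
  have "mat_adjoint ?B = mat_adjoint (mat_adjoint U) * mat_adjoint (U * A)"
    by (rule mat_adjoint_mult[OF UA Ua])
  also have "\<dots> = U * (mat_adjoint A * mat_adjoint U)"
    by (simp add: mat_adjoint_adjoint[OF Uc] mat_adjoint_mult[OF Uc A])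
  finally have adjB: "mat_adjoint ?B = U * (mat_adjoint A * mat_adjoint U)" .
  have AaU: "mat_adjoint A * mat_adjoint U \<in> carrier_mat n n" using Aa Ua by simp
  have "mat_adjoint ?B * ?B = U * (mat_adjoint A * mat_adjoint U) * (U * (A * mat_adjoint U))"
    unfolding adjB using assoc_mult_mat[OF Uc A Ua] by simp
  also have "\<dots> = U * ((mat_adjoint A * mat_adjoint U) * (U * (A * mat_adjoint U)))"
    using Uc AaU AU by (intro assoc_mult_mat[of _ n n _ n _ n]) simp_all
  also have "(mat_adjoint A * mat_adjoint U) * (U * (A * mat_adjoint U)) = mat_adjoint A * (mat_adjoint U * (U * (A * mat_adjoint U)))"
    using Uc Aa Ua AU by (intro assoc_mult_mat[of _ n n _ n _ n]) simp_all
  also have "mat_adjoint U * (U * (A * mat_adjoint U)) = (mat_adjoint U * U) * (A * mat_adjoint U)"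
    using Uc Ua AU by (intro assoc_mult_mat[of _ n n _ n _ n, symmetric]) simp_all
  also have "\<dots> = A * mat_adjoint U" unfolding UU by (rule left_mult_one_mat[OF AU])
  also have "mat_adjoint A * (A * mat_adjoint U) = (mat_adjoint A * A) * mat_adjoint U"
    using Aa A Ua by (intro assoc_mult_mat[of _ n n _ n _ n, symmetric]) simp_all
  also have "U * ((mat_adjoint A * A) * mat_adjoint U) = U * (mat_adjoint A * A) * mat_adjoint U"
    using Uc Aa A Ua by (intro assoc_mult_mat[of _ n n _ n _ n, symmetric]) simp_all
  finally have eq: "mat_adjoint ?B * ?B = U * (mat_adjoint A * A) * mat_adjoint U" .
  have AA: "mat_adjoint A * A \<in> carrier_mat n n" using Aa A by simp
  have BB: "mat_adjoint ?B * ?B \<in> carrier_mat n n" using mat_adjoint_carrier[OF B] B by simp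
  have "similar_mat_wit (mat_adjoint ?B * ?B) (mat_adjoint A * A) U (mat_adjoint U)"
    by (rule similar_mat_witI[OF unitary_mat_right[OF U] UU eq BB AA Uc Ua])
  then have "similar_mat (mat_adjoint ?B * ?B) (mat_adjoint A * A)"
    unfolding similar_mat_def by blast
  then have "char_poly (mat_adjoint ?B * ?B) = char_poly (mat_adjoint A * A)"
    by (rule char_poly_similar)
  then show ?thesis
    unfolding singular_values_def eigenvalue_root_char_poly[OF AA] eigenvalue_root_char_poly[OF BB] by simp
qed

lemma finite_singular_values:
  assumes A: "A \<in> carrier_mat n n"
  shows "finite (singular_values A)"
proof -
  have AA: "mat_adjoint A * A \<in> carrier_mat n n" using mat_adjoint_carrier[OF A] A by simp
  let ?R = "{z. poly (char_poly (mat_adjoint A * A)) z = 0}"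
  have "char_poly (mat_adjoint A * A) \<noteq> 0"
    using degree_monic_char_poly[OF AA] by auto
  then have "finite ?R" by (rule poly_roots_finite)
  moreover have "inj_on (\<lambda>\<sigma>. complex_of_real (\<sigma>\<^sup>2)) (singular_values A)"
    by (rule inj_onI) (auto simp: singular_values_def simp del: of_real_power)
  moreover have "(\<lambda>\<sigma>. complex_of_real (\<sigma>\<^sup>2)) ` singular_values A \<subseteq> ?R"
    by (auto simp: singular_values_def eigenvalue_root_char_poly[OF AA])
  ultimately show ?thesis by (meson finite_imageD finite_subset)
qed

lemma index_mult_mat_vec_sum:
  "B \<in> carrier_mat n m \<Longrightarrow> v \<in> carrier_vec m \<Longrightarrow> i < n \<Longrightarrow> (B *\<^sub>v v) $ i = (\<Sum>j<m. B $$ (i, j) * v $ j)"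
  by (simp add: scalar_prod_def atLeast0LessThan)

text \<open>A^H A has an eigenvalue by the fundamental theorem of algebra. With an eigenvector v it
  equals |A v|^2 / |v|^2, hence is real and nonnegative and has a square root. This gives
  \<open>Min\<close> in \<open>sigma_min\<close> its meaning.\<close>

lemma singular_values_nonempty:
  assumes A: "A \<in> carrier_mat n n" and n: "n \<ge> 1"
  shows "singular_values A \<noteq> {}"
proof -
  let ?B = "mat_adjoint A * A"
  have AA: "?B \<in> carrier_mat n n" using mat_adjoint_carrier[OF A] A by simp
  have "degree (char_poly ?B) = n" using degree_monic_char_poly[OF AA] by simp
  then have "\<not> constant (poly (char_poly ?B))" using n by (simp add: constant_degree)
  then obtain k where "poly (char_poly ?B) k = 0" using fundamental_theorem_of_algebra by blast
  then have ev: "eigenvalue ?B k" using eigenvalue_root_char_poly[OF AA] by simp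
  then obtain v where v: "v \<in> carrier_vec n" "v \<noteq> 0\<^sub>v n" "?B *\<^sub>v v = k \<cdot>\<^sub>v v"
    unfolding eigenvalue_def eigenvector_def using AA by auto
  define N where "N = (\<Sum>i<n. (cmod (v $ i))\<^sup>2)"
  define M where "M = (\<Sum>l<n. (cmod (\<Sum>j<n. A $$ (l, j) * v $ j))\<^sup>2)"
  have N: "N > 0"
  proof -
    obtain i where i: "i < n" "v $ i \<noteq> 0"
      using v(1,2) by (metis carrier_vecD eq_vecI index_zero_vec)
    then show ?thesis unfolding N_def by (intro sum_pos2[of _ i]) auto
  qed
  have Bv: "(\<Sum>j<n. ?B $$ (i, j) * v $ j) = k * v $ i" if "i < n" for i
  proof -
    have "(\<Sum>j<n. ?B $$ (i, j) * v $ j) = (?B *\<^sub>v v) $ i"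
      by (rule index_mult_mat_vec_sum[OF AA v(1) that, symmetric])
    then show ?thesis using that v by simp
  qed
  \<comment> \<open>The Hermitian form v^H A^H A v is computed twice: by the eigenvalue equation,
    and as the squared norm of A v.\<close>
  have "k * complex_of_real N = (\<Sum>i<n. cnj (v $ i) * (k * v $ i))"
    by (simp add: N_def complex_norm_square sum_distrib_left mult_ac del: of_real_power)
  also have "\<dots> = (\<Sum>i<n. cnj (v $ i) * (\<Sum>j<n. (\<Sum>l<n. cnj (A $$ (l, i)) * A $$ (l, j)) * v $ j))"
  proof (intro sum.cong refl arg_cong2[where f="(*)"])
    fix i assume "i \<in> {..<n}"
    then have i: "i < n" by simp
    have "?B $$ (i, j) = (\<Sum>l<n. cnj (A $$ (l, i)) * A $$ (l, j))" if "j < n" for j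
      unfolding index_mult_mat_sum[OF mat_adjoint_carrier[OF A] A i that]
      by (intro sum.cong refl) (simp add: mat_adjoint_index[OF A i])
    then show "k * v $ i = (\<Sum>j<n. (\<Sum>l<n. cnj (A $$ (l, i)) * A $$ (l, j)) * v $ j)"
      unfolding Bv[OF i, symmetric] by simp
  qed
  also have "\<dots> = (\<Sum>i<n. \<Sum>j<n. \<Sum>l<n. (A $$ (l, j) * v $ j) * cnj (A $$ (l, i) * v $ i))"
    by (simp add: sum_distrib_left sum_distrib_right mult_ac)
  also have "\<dots> = (\<Sum>l<n. \<Sum>i<n. \<Sum>j<n. (A $$ (l, j) * v $ j) * cnj (A $$ (l, i) * v $ i))"
  proof -
    have "(\<Sum>i<n. \<Sum>j<n. \<Sum>l<n. (A $$ (l, j) * v $ j) * cnj (A $$ (l, i) * v $ i))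
      = (\<Sum>i<n. \<Sum>l<n. \<Sum>j<n. (A $$ (l, j) * v $ j) * cnj (A $$ (l, i) * v $ i))"
      by (intro sum.cong refl sum.swap)
    also have "\<dots> = (\<Sum>l<n. \<Sum>i<n. \<Sum>j<n. (A $$ (l, j) * v $ j) * cnj (A $$ (l, i) * v $ i))"
      by (rule sum.swap)
    finally show ?thesis .
  qed
  also have "\<dots> = (\<Sum>l<n. (\<Sum>j<n. A $$ (l, j) * v $ j) * cnj (\<Sum>i<n. A $$ (l, i) * v $ i))"
    unfolding cnj_sum sum_product by (intro sum.cong refl sum.swap)
  also have "\<dots> = complex_of_real M"
    by (simp add: M_def complex_norm_square del: of_real_power complex_cnj_mult cnj_sum)
  finally have "k * complex_of_real N = complex_of_real M" .
  then have "k = complex_of_real (M / N)" using N by (simp add: field_simps)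
  moreover have "M / N \<ge> 0" using N by (simp add: M_def sum_nonneg)
  ultimately have "k = complex_of_real ((sqrt (M / N))\<^sup>2)" "sqrt (M / N) \<ge> 0" by simp_all
  then have "sqrt (M / N) \<in> singular_values A" using ev by (simp add: singular_values_def del: of_real_power)
  then show ?thesis by blast
qed

lemma sigma_min_ge_iff:
  assumes "A \<in> carrier_mat n n" "n \<ge> 1"
  shows "sigma_min A \<ge> s \<longleftrightarrow> (\<forall>\<sigma>\<in>singular_values A. s \<le> \<sigma>)"
  unfolding sigma_min_def
  using finite_singular_values[OF assms(1)] singular_values_nonempty[OF assms] by simp

lemma singular_values_real_diag: "singular_values (real_diag n y) = (\<lambda>i. \<bar>y i\<bar>) ` {..<n}"
proof -
  let ?D = "real_diag n y"
  let ?B = "mat_adjoint ?D * ?D"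
  have D: "?D \<in> carrier_mat n n" by simp
  note D' = mat_adjoint_carrier[OF D]
  have B: "?B \<in> carrier_mat n n" using D D' by simp
  have Bij: "?B $$ (i, j) = (if i = j then complex_of_real ((y i)\<^sup>2) else 0)" if ij: "i < n" "j < n" for i j
  proof -
    have "?B $$ (i, j) = (\<Sum>l<n. mat_adjoint ?D $$ (i, l) * ?D $$ (l, j))"
      by (rule index_mult_mat_sum[OF D' D ij])
    also have "\<dots> = (\<Sum>l<n. if l = i then (if i = j then complex_of_real ((y i)\<^sup>2) else 0) else 0)"
    proof (intro sum.cong refl)
      fix l assume "l \<in> {..<n}"
      then have l: "l < n" by simp
      have "mat_adjoint ?D $$ (i, l) = (if l = i then complex_of_real (y i) else 0)"
        unfolding mat_adjoint_index[OF D ij(1) l] using ij l by (simp add: real_diag_def)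
      moreover have "?D $$ (l, j) = (if l = j then complex_of_real (y l) else 0)"
        using ij l by (simp add: real_diag_def)
      ultimately show "mat_adjoint ?D $$ (i, l) * ?D $$ (l, j)
          = (if l = i then (if i = j then complex_of_real ((y i)\<^sup>2) else 0) else 0)"
        by (simp add: power2_eq_square)
    qed
    finally show ?thesis using ij by simp
  qed
  have "upper_triangular ?B"
  proof (rule upper_triangularI)
    fix i j assume "j < i" "i < dim_row ?B"
    then show "?B $$ (i, j) = 0" using B Bij[of i j] by auto
  qed
  then have cp: "char_poly ?B = (\<Prod>a\<leftarrow>diag_mat ?B. [:- a, 1:])"
    by (rule char_poly_upper_triangular[OF B])
  have dm: "set (diag_mat ?B) = (\<lambda>i. complex_of_real ((y i)\<^sup>2)) ` {..<n}"
    using B Bij by (auto simp: diag_mat_def)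
  have "eigenvalue ?B k \<longleftrightarrow> (\<exists>i<n. k = complex_of_real ((y i)\<^sup>2))" for k
  proof -
    have "eigenvalue ?B k \<longleftrightarrow> poly (\<Prod>a\<leftarrow>diag_mat ?B. [:- a, 1:]) k = 0"
      unfolding eigenvalue_root_char_poly[OF B] cp ..
    also have "\<dots> \<longleftrightarrow> k \<in> set (diag_mat ?B)"
      by (auto simp: poly_prod_list prod_list_zero_iff)
    finally show ?thesis unfolding dm by blast
  qed
  then have mem: "\<sigma> \<in> singular_values ?D \<longleftrightarrow> 0 \<le> \<sigma> \<and> (\<exists>i<n. \<sigma>\<^sup>2 = (y i)\<^sup>2)" for \<sigma>
    by (simp add: singular_values_def del: of_real_power)
  show ?thesis
  proof (intro equalityI subsetI)
    fix \<sigma> assume "\<sigma> \<in> singular_values ?D"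
    then obtain i where i: "0 \<le> \<sigma>" "i < n" "\<sigma>\<^sup>2 = (y i)\<^sup>2" unfolding mem by blast
    then have "\<sigma> = \<bar>y i\<bar>" using power2_eq_iff_nonneg[of \<sigma> "\<bar>y i\<bar>"] by simp
    then show "\<sigma> \<in> (\<lambda>i. \<bar>y i\<bar>) ` {..<n}" using i(2) by blast
  next
    fix \<sigma> assume "\<sigma> \<in> (\<lambda>i. \<bar>y i\<bar>) ` {..<n}"
    then obtain i where "i < n" "\<sigma> = \<bar>y i\<bar>" by blast
    then show "\<sigma> \<in> singular_values ?D" unfolding mem by (intro conjI exI[of _ i]) simp_all
  qed
qed

section \<open>Measurability of the event\<close>

lemma measurable_det:
  fixes f :: "'a \<Rightarrow> complex mat"
  assumes "\<And>x. f x \<in> carrier_mat n n" "\<And>i j. i < n \<Longrightarrow> j < n \<Longrightarrow> (\<lambda>x. f x $$ (i, j)) \<in> borel_measurable N"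
  shows "(\<lambda>x. Determinant.det (f x)) \<in> borel_measurable N"
  unfolding det_def'[OF assms(1)]
proof (intro borel_measurable_sum borel_measurable_times borel_measurable_const borel_measurable_prod assms(2))
  fix p i assume p: "p \<in> {p. p permutes {0..<n}}" and i: "i \<in> {0..<n}"
  then show "p i < n" using permutes_in_image[of p "{0..<n}" i] by simp
qed simp_all

text \<open>The rational points lie to the right of the zero, so that they stay nonnegative even if
  the zero is at 0.\<close>

lemma exists_rational_right:
  fixes f :: "real \<Rightarrow> complex"
  assumes f: "isCont f \<sigma>" and "f \<sigma> = 0" "e > 0" "\<sigma> < T"
  shows "\<exists>q\<in>\<rat>. \<sigma> < q \<and> q < T \<and> cmod (f q) < e"
proof -
  obtain d where d: "d > 0" "\<And>x. dist x \<sigma> < d \<Longrightarrow> dist (f x) (f \<sigma>) < e"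
    using f \<open>e > 0\<close> unfolding continuous_at_eps_delta by blast
  obtain q where q: "q \<in> \<rat>" "\<sigma> < q" "q < min (\<sigma> + d) T"
    using Rats_dense_in_real[of \<sigma> "min (\<sigma> + d) T"] d(1) \<open>\<sigma> < T\<close> by auto
  then have "cmod (f q) < e" using d(2)[of q] \<open>f \<sigma> = 0\<close> by (auto simp: dist_norm)
  with q show ?thesis by auto
qed

text \<open>By compactness a continuous function without zeros on [0, s) is bounded away from zero at the
  rational points of [0, T] for every T < s; this turns the uncountable condition into a countable one.\<close>

lemma nonvanishing_iff_countable:
  fixes f :: "real \<Rightarrow> complex"
  assumes f: "continuous_on UNIV f"
  shows "(\<forall>\<sigma>. 0 \<le> \<sigma> \<and> \<sigma> < s \<longrightarrow> f \<sigma> \<noteq> 0) \<longleftrightarrow>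
    (\<forall>m::nat. \<exists>l::nat. \<forall>q\<in>\<rat>. 0 \<le> q \<and> q \<le> s - 1 / (real m + 1) \<longrightarrow> cmod (f q) \<ge> 1 / (real l + 1))"
proof
  assume nz: "\<forall>\<sigma>. 0 \<le> \<sigma> \<and> \<sigma> < s \<longrightarrow> f \<sigma> \<noteq> 0"
  show "\<forall>m::nat. \<exists>l::nat. \<forall>q\<in>\<rat>. 0 \<le> q \<and> q \<le> s - 1 / (real m + 1) \<longrightarrow> cmod (f q) \<ge> 1 / (real l + 1)"
  proof
    fix m :: nat
    let ?T = "s - 1 / (real m + 1)"
    have T: "?T < s" by simp
    show "\<exists>l::nat. \<forall>q\<in>\<rat>. 0 \<le> q \<and> q \<le> ?T \<longrightarrow> cmod (f q) \<ge> 1 / (real l + 1)"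
    proof (cases "0 \<le> ?T")
      case True
      have "continuous_on {0..?T} (\<lambda>x. cmod (f x))"
        by (intro continuous_intros continuous_on_subset[OF f]) simp
      then obtain z where z: "z \<in> {0..?T}" "\<And>y. y \<in> {0..?T} \<Longrightarrow> cmod (f z) \<le> cmod (f y)"
        using continuous_attains_inf[of "{0..?T}" "\<lambda>x. cmod (f x)"] True by auto
      have "0 \<le> z" "z \<le> ?T" using z(1) by auto
      then have "0 \<le> z \<and> z < s" using T by linarith
      then have "f z \<noteq> 0" using nz by blast
      then have "cmod (f z) > 0" by simp
      then obtain l where l: "inverse (real (Suc l)) < cmod (f z)" using reals_Archimedean by blast
      then have "1 / (real l + 1) \<le> cmod (f q)" if "0 \<le> q" "q \<le> ?T" for q
        using z(2)[of q] that by (simp add: inverse_eq_divide add.commute)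
      then show ?thesis by blast
    qed auto
  qed
next
  assume *: "\<forall>m::nat. \<exists>l::nat. \<forall>q\<in>\<rat>. 0 \<le> q \<and> q \<le> s - 1 / (real m + 1) \<longrightarrow> cmod (f q) \<ge> 1 / (real l + 1)"
  show "\<forall>\<sigma>. 0 \<le> \<sigma> \<and> \<sigma> < s \<longrightarrow> f \<sigma> \<noteq> 0"
  proof (intro allI impI notI, elim conjE)
    fix \<sigma> assume \<sigma>: "0 \<le> \<sigma>" "\<sigma> < s" "f \<sigma> = 0"
    then obtain m where m: "inverse (real (Suc m)) < s - \<sigma>" using reals_Archimedean[of "s - \<sigma>"] by auto
    then have T: "\<sigma> < s - 1 / (real m + 1)" by (simp add: inverse_eq_divide add.commute)
    from * obtain l where l: "\<And>q. q \<in> \<rat> \<Longrightarrow> 0 \<le> q \<Longrightarrow> q \<le> s - 1 / (real m + 1) \<Longrightarrow> cmod (f q) \<ge> 1 / (real l + 1)"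
      by blast
    have "isCont f \<sigma>" using f by (simp add: continuous_on_eq_continuous_at)
    from exists_rational_right[OF this \<sigma>(3) _ T, of "1 / (real l + 1)"] obtain q
      where "q \<in> \<rat>" "\<sigma> < q" "q < s - 1 / (real m + 1)" "cmod (f q) < 1 / (real l + 1)" by auto
    then show False using l[of q] \<sigma>(1) by auto
  qed
qed

lemma ball_Rats: "(\<forall>q\<in>\<rat>. P q) \<longleftrightarrow> (\<forall>r. P (of_rat r))"
  by (auto simp: Rats_def)

text \<open>The event says that the characteristic polynomial of A^H A has no zero at q^2 for 0
  \<le> q < s. For fixed q its value is a determinant in the entries and their conjugates, hence
  measurable, and \<open>nonvanishing_iff_countable\<close> leaves only countably many q.\<close>

lemma sets_sigma_min_ge:
  assumes n: "n \<ge> 1"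
  shows "{A \<in> carrier_mat n n. s \<le> sigma_min A} \<in> sets (mat_borel n)"
proof -
  define d where "d A q = poly (char_poly (mat_adjoint A * A)) (complex_of_real (q\<^sup>2))" for A :: "complex mat" and q :: real
  have eq: "s \<le> sigma_min A \<longleftrightarrow>
    (\<forall>m::nat. \<exists>l::nat. \<forall>q\<in>\<rat>. 0 \<le> q \<and> q \<le> s - 1 / (real m + 1) \<longrightarrow> cmod (d A q) \<ge> 1 / (real l + 1))"
    if A: "A \<in> carrier_mat n n" for A
  proof -
    have AA: "mat_adjoint A * A \<in> carrier_mat n n" using mat_adjoint_carrier[OF A] A by simp
    have "s \<le> sigma_min A \<longleftrightarrow> (\<forall>\<sigma>. 0 \<le> \<sigma> \<and> \<sigma> < s \<longrightarrow> d A \<sigma> \<noteq> 0)"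
    proof -
      have "(\<forall>\<sigma>\<in>{\<sigma>. 0 \<le> \<sigma> \<and> P \<sigma>}. s \<le> \<sigma>) \<longleftrightarrow> (\<forall>\<sigma>. 0 \<le> \<sigma> \<and> \<sigma> < s \<longrightarrow> \<not> P \<sigma>)" for P :: "real \<Rightarrow> bool"
        unfolding not_le[symmetric] by blast
      then show ?thesis
        unfolding sigma_min_ge_iff[OF A n] d_def singular_values_def eigenvalue_root_char_poly[OF AA] .
    qed
    moreover have "continuous_on UNIV (d A)"
      unfolding d_def by (intro continuous_intros)
    ultimately show ?thesis by (simp only: nonvanishing_iff_countable)
  qed
  have d_meas: "(\<lambda>A. d A q) \<in> borel_measurable (mat_borel n)" for q
  proof -
    let ?M = "\<lambda>A. mat n n (\<lambda>(i, j). (if i = j then complex_of_real (q\<^sup>2) else 0) - (\<Sum>l<n. cnj (A $$ (l, i)) * A $$ (l, j)))"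
    have "d A q = Determinant.det (?M A)" if A: "A \<in> space (mat_borel n)" for A
    proof -
      have A: "A \<in> carrier_mat n n" using A by simp
      have AA: "mat_adjoint A * A \<in> carrier_mat n n" using mat_adjoint_carrier[OF A] A by simp
      have Bij: "(mat_adjoint A * A) $$ (i, j) = (\<Sum>l<n. cnj (A $$ (l, i)) * A $$ (l, j))" if "i < n" "j < n" for i j
        unfolding index_mult_mat_sum[OF mat_adjoint_carrier[OF A] A that]
        by (intro sum.cong refl) (simp add: mat_adjoint_index[OF A] that)
      have "- char_matrix (mat_adjoint A * A) (complex_of_real (q\<^sup>2)) = ?M A"
      proof (rule eq_matI)
        fix i j assume "i < dim_row (?M A)" "j < dim_col (?M A)"
        then have ij: "i < n" "j < n" by simp_all
        have "(- char_matrix (mat_adjoint A * A) (complex_of_real (q\<^sup>2))) $$ (i, j)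
          = (if i = j then complex_of_real (q\<^sup>2) else 0) - (mat_adjoint A * A) $$ (i, j)"
          using ij AA by (simp add: char_matrix_def del: of_real_power index_mult_mat)
        then show "(- char_matrix (mat_adjoint A * A) (complex_of_real (q\<^sup>2))) $$ (i, j) = ?M A $$ (i, j)"
          using ij unfolding Bij[OF ij] by simp
      qed (use carrier_matD[OF AA] in \<open>simp_all add: char_matrix_def del: index_mult_mat\<close>)
      then show ?thesis unfolding d_def char_poly_matrix[OF AA] by (simp only:)
    qed
    moreover have "(\<lambda>A. Determinant.det (?M A)) \<in> borel_measurable (mat_borel n)"
    proof (rule measurable_det)
      fix i j assume ij: "i < n" "j < n"
      have "(\<lambda>A. cnj (A $$ (l, i))) \<in> borel_measurable (mat_borel n)" if "l < n" for l
        by (rule measurable_compose[OF measurable_mat_entry[OF that ij(1)]])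
          (intro borel_measurable_continuous_onI continuous_intros)
      then have "(\<lambda>A. (if i = j then complex_of_real (q\<^sup>2) else 0) - (\<Sum>l<n. cnj (A $$ (l, i)) * A $$ (l, j)))
          \<in> borel_measurable (mat_borel n)"
        using ij by (intro borel_measurable_diff borel_measurable_const borel_measurable_sum borel_measurable_times
          measurable_mat_entry) simp_all
      moreover have "?M A $$ (i, j) = (if i = j then complex_of_real (q\<^sup>2) else 0) - (\<Sum>l<n. cnj (A $$ (l, i)) * A $$ (l, j))" for A
        by (subst index_mat(1)[OF ij]) (simp only: prod.case)
      ultimately show "(\<lambda>A. ?M A $$ (i, j)) \<in> borel_measurable (mat_borel n)" by (simp only:)
    qed (rule mat_carrier)
    ultimately show ?thesis by (subst measurable_cong) 
  qed
  have "{A \<in> space (mat_borel n). \<forall>m::nat. \<exists>l::nat. \<forall>q\<in>\<rat>. 0 \<le> q \<and> q \<le> s - 1 / (real m + 1) \<longrightarrow> cmod (d A q) \<ge> 1 / (real l + 1)}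
    \<in> sets (mat_borel n)"
    unfolding ball_Rats
  proof (intro sets.sets_Collect_countable_All sets.sets_Collect_countable_Ex)
    fix m l :: nat and r :: rat
    define q where "q = real_of_rat r"
    have "{A \<in> space (mat_borel n). cmod (d A q) \<ge> 1 / (real l + 1)} \<in> sets (mat_borel n)"
      by (intro borel_measurable_le borel_measurable_const measurable_compose[OF d_meas, of cmod])
        (intro borel_measurable_continuous_onI continuous_intros)
    then show "{A \<in> space (mat_borel n). 0 \<le> real_of_rat r \<and> real_of_rat r \<le> s - 1 / (real m + 1)
        \<longrightarrow> cmod (d A (real_of_rat r)) \<ge> 1 / (real l + 1)} \<in> sets (mat_borel n)"
      unfolding q_def[symmetric] by (intro sets.sets_Collect_imp sets.sets_Collect_const)
  qed
  also have "{A \<in> space (mat_borel n). \<forall>m::nat. \<exists>l::nat. \<forall>q\<in>\<rat>. 0 \<le> q \<and> q \<le> s - 1 / (real m + 1) \<longrightarrow> cmod (d A q) \<ge> 1 / (real l + 1)}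
    = {A \<in> carrier_mat n n. s \<le> sigma_min A}"
    using eq by auto
  finally show ?thesis .
qed

text \<open>The constant is obtained before s is chosen, so one value serves all s and can be
  computed from s = 0. On diagonal matrices the indicator of the event is a product over the
  eigenvalues, the form to which Andreief's identity applies.\<close>

lemma GUE_sigma_min_integral:
  assumes n: "n \<ge> 1"
  obtains C where "\<And>s. emeasure (GUE n) {A \<in> carrier_mat n n. s \<le> sigma_min A}
    = C * (\<integral>\<^sup>+ y. ennreal ((\<Prod>i<n. indicator {t. s \<le> \<bar>t\<bar>} (y i) * exp (- (y i)\<^sup>2 / 2)) * (vandermonde n y)\<^sup>2) \<partial>lebn n)"
proof -
  obtain C where C: "\<And>f. f \<in> borel_measurable (mat_borel n) \<Longrightarrow> unitarily_invariant n f \<Longrightarrow>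
    (\<integral>\<^sup>+ A. f A \<partial>GUE n) = C * (\<integral>\<^sup>+ y. gauss_weight n f (real_diag n y) * ennreal \<bar>vandermonde n y\<bar> ^ 2 \<partial>lebn n)"
    using GUE_eigenvalue_density[of n] by blast
  show ?thesis
  proof (rule that)
    fix s
    let ?S = "{A \<in> carrier_mat n n. s \<le> sigma_min A}"
    have S: "?S \<in> sets (mat_borel n)" by (rule sets_sigma_min_ge[OF n])
    have inv: "unitarily_invariant n (indicator ?S :: _ \<Rightarrow> ennreal)"
      unfolding unitarily_invariant_def
    proof (intro ballI allI impI)
      fix A U :: "complex mat" assume A: "A \<in> carrier_mat n n" and U: "unitary_mat n U"
      have "U * A * mat_adjoint U \<in> carrier_mat n n"
        using A unitary_mat_carrier[OF U] mat_adjoint_carrier[OF unitary_mat_carrier[OF U]] by simp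
      then show "indicator ?S (U * A * mat_adjoint U) = (indicator ?S A :: ennreal)"
        using A by (simp add: indicator_def sigma_min_def singular_values_unitary[OF A U])
    qed
    have "emeasure (GUE n) ?S = (\<integral>\<^sup>+ A. indicator ?S A \<partial>GUE n)"
      using S by (simp add: GUE_def)
    also have "\<dots> = C * (\<integral>\<^sup>+ y. gauss_weight n (indicator ?S) (real_diag n y) * ennreal \<bar>vandermonde n y\<bar> ^ 2 \<partial>lebn n)"
      by (rule C[OF _ inv]) (rule borel_measurable_indicator[OF S])
    also have "(\<integral>\<^sup>+ y. gauss_weight n (indicator ?S) (real_diag n y) * ennreal \<bar>vandermonde n y\<bar> ^ 2 \<partial>lebn n)
      = (\<integral>\<^sup>+ y. ennreal ((\<Prod>i<n. indicator {t. s \<le> \<bar>t\<bar>} (y i) * exp (- (y i)\<^sup>2 / 2)) * (vandermonde n y)\<^sup>2) \<partial>lebn n)"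
    proof (rule nn_integral_cong)
      fix y :: "nat \<Rightarrow> real"
      have iff: "real_diag n y \<in> ?S \<longleftrightarrow> (\<forall>i<n. s \<le> \<bar>y i\<bar>)"
        using sigma_min_ge_iff[OF real_diag_carrier n] by (auto simp: singular_values_real_diag)
      have "(\<Prod>i<n. indicator {t. s \<le> \<bar>t\<bar>} (y i) :: real) = (if \<forall>i<n. s \<le> \<bar>y i\<bar> then 1 else 0)"
        by (auto simp: indicator_def)
      then have 1: "indicator ?S (real_diag n y) = ennreal (\<Prod>i<n. indicator {t. s \<le> \<bar>t\<bar>} (y i))"
        unfolding indicator_def[of ?S] iff by simp
      have 2: "exp (- frobenius n (real_diag n y) / 2) = (\<Prod>i<n. exp (- (y i)\<^sup>2 / 2))"
        unfolding frobenius_real_diag by (subst exp_sum[symmetric]) (simp_all add: sum_negf sum_divide_distrib)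
      have 3: "ennreal \<bar>vandermonde n y\<bar> ^ 2 = ennreal ((vandermonde n y)\<^sup>2)"
        by (simp add: ennreal_power)
      have 4: "ennreal a * ennreal b * ennreal c = ennreal (a * b * c)" if "a \<ge> 0" "b \<ge> 0" "c \<ge> 0" for a b c :: real
        using that by (simp add: ennreal_mult)
      show "gauss_weight n (indicator ?S) (real_diag n y) * ennreal \<bar>vandermonde n y\<bar> ^ 2
        = ennreal ((\<Prod>i<n. indicator {t. s \<le> \<bar>t\<bar>} (y i) * exp (- (y i)\<^sup>2 / 2)) * (vandermonde n y)\<^sup>2)"
        unfolding gauss_weight_def prod.distrib 1 2 3 by (rule 4) (auto intro: prod_nonneg)
    qed
    finally show "emeasure (GUE n) ?S
    = C * (\<integral>\<^sup>+ y. ennreal ((\<Prod>i<n. indicator {t. s \<le> \<bar>t\<bar>} (y i) * exp (- (y i)\<^sup>2 / 2)) * (vandermonde n y)\<^sup>2) \<partial>lebn n)" .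
  qed
qed

subsection \<open>Hankel determinants and incomplete gamma values\<close>

text \<open>Newton's basis: replacing the powers by the monic polynomials
  \<open>roots_poly j y\<close> multiplies by a unitriangular matrix. In this basis the matrix is
  lower triangular, and its diagonal consists of the products of differences.\<close>

lemma vandermonde_eq_det: "vandermonde n y = Determinant.det (mat n n (\<lambda>(i, j). y i ^ j))"
proof -
  let ?V = "mat n n (\<lambda>(i, j). y i ^ j)" and ?C = "mat n n (\<lambda>(k, j). coeff (roots_poly j y) k)"
  let ?M = "mat n n (\<lambda>(i, j). poly (roots_poly j y) (y i))"
  have V: "?V \<in> carrier_mat n n" and C: "?C \<in> carrier_mat n n" and M: "?M \<in> carrier_mat n n" by simp_all
  have "?M = ?V * ?C"
  proof (rule eq_matI)
    fix i j assume "i < dim_row (?V * ?C)" "j < dim_col (?V * ?C)"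
    then have ij: "i < n" "j < n" by simp_all
    have "poly (roots_poly j y) (y i) = (\<Sum>k\<le>j. coeff (roots_poly j y) k * y i ^ k)"
      by (simp add: poly_altdef)
    also have "\<dots> = (\<Sum>k<n. coeff (roots_poly j y) k * y i ^ k)"
      using ij by (intro sum.mono_neutral_left) (auto simp: coeff_eq_0)
    also have "\<dots> = (\<Sum>k<n. ?V $$ (i, k) * ?C $$ (k, j))"
      using ij by (intro sum.cong refl) simp
    also have "\<dots> = (?V * ?C) $$ (i, j)"
      by (rule index_mult_mat_sum[OF V C ij, symmetric])
    finally show "?M $$ (i, j) = (?V * ?C) $$ (i, j)" using ij by simp
  qed simp_all
  then have "Determinant.det ?M = Determinant.det ?V * Determinant.det ?C"
    by (simp only: det_mult[OF V C])
  moreover have "Determinant.det ?C = 1"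
  proof -
    have "upper_triangular ?C"
      by (rule upper_triangularI) (simp add: coeff_eq_0)
    from det_upper_triangular[OF this C] show ?thesis by (simp add: prod_list_diag_prod)
  qed
  moreover have "Determinant.det ?M = vandermonde n y"
  proof -
    have "?M $$ (i, j) = 0" if "i < j" "j < n" for i j
      using that poly_roots_poly_node[of i j y] by simp
    from det_lower_triangular[OF this M] show ?thesis
      by (simp add: prod_list_diag_prod vandermonde_def poly_roots_poly atLeast0LessThan)
  qed
  ultimately show ?thesis by simp
qed

text \<open>Both Vandermonde determinants are expanded over permutations p and q, and each product
  integrates to a product of moments. For fixed p the sum over q is the moment determinant with rows
  permuted by p; the sign this creates cancels the sign of p. So each of the n! permutations p
  contributes the same determinant.\<close>

lemma andreief:
  fixes \<phi> :: "real \<Rightarrow> real"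
  assumes int: "\<And>k. integrable lborel (\<lambda>t. t ^ k * \<phi> t)"
  defines "m \<equiv> \<lambda>k. \<integral>t. t ^ k * \<phi> t \<partial>lborel"
  shows "has_bochner_integral (lebn n) (\<lambda>y. (\<Prod>i<n. \<phi> (y i)) * (vandermonde n y)\<^sup>2)
    (fact n * Determinant.det (mat n n (\<lambda>(i, j). m (i + j))))"
proof -
  interpret product_sigma_finite "\<lambda>_::nat. lborel :: real measure" ..
  let ?P = "{p. p permutes {0..<n}}"
  let ?A = "mat n n (\<lambda>(i, j). m (i + j))"
  have fin: "finite ?P" by (rule finite_permutations) simp
  have V: "vandermonde n y = (\<Sum>p\<in>?P. signof p * (\<Prod>i<n. y i ^ p i))" for y
  proof -
    have "p i < n" if "p permutes {0..<n}" "i < n" for p i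
      using permutes_in_image[OF that(1), of i] that(2) by simp
    then show ?thesis
      unfolding vandermonde_eq_det det_def'[OF mat_carrier] atLeast0LessThan
      by (intro sum.cong refl arg_cong2[where f="(*)"] prod.cong) (auto simp: atLeast0LessThan)
  qed
  have expand: "(\<Prod>i<n. \<phi> (y i)) * (vandermonde n y)\<^sup>2
      = (\<Sum>p\<in>?P. \<Sum>q\<in>?P. (signof p * signof q) * (\<Prod>i<n. y i ^ (p i + q i) * \<phi> (y i)))" for y
    unfolding V power2_eq_square sum_product
    by (simp add: sum_distrib_left prod.distrib power_add mult_ac)
  have prod_int: "has_bochner_integral (lebn n) (\<lambda>y. \<Prod>i<n. y i ^ (p i + q i) * \<phi> (y i)) (\<Prod>i<n. m (p i + q i))" for p q
    unfolding has_bochner_integral_iff m_def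
    using product_integrable_prod[of "{..<n}" "\<lambda>i t. t ^ (p i + q i) * \<phi> t"]
      product_integral_prod[of "{..<n}" "\<lambda>i t. t ^ (p i + q i) * \<phi> t"] int by simp
  have "has_bochner_integral (lebn n) (\<lambda>y. (\<Prod>i<n. \<phi> (y i)) * (vandermonde n y)\<^sup>2)
      (\<Sum>p\<in>?P. \<Sum>q\<in>?P. (signof p * signof q) * (\<Prod>i<n. m (p i + q i)))"
    unfolding expand by (intro has_bochner_integral_sum has_bochner_integral_mult_right prod_int)
  also have "(\<Sum>p\<in>?P. \<Sum>q\<in>?P. (signof p * signof q) * (\<Prod>i<n. m (p i + q i))) = (\<Sum>p\<in>?P. Determinant.det ?A)"
  proof (rule sum.cong[OF refl])
    fix p assume "p \<in> ?P"
    then have p: "p permutes {0..<n}" by simp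
    have img: "q i < n" if "q permutes {0..<n}" "i < n" for q i
      using permutes_in_image[OF that(1), of i] that(2) by simp
    have "signof p * Determinant.det ?A = Determinant.det (mat n n (\<lambda>(i, j). ?A $$ (p i, j)))"
      by (rule det_permute_rows[OF _ p, symmetric]) simp
    also have "\<dots> = (\<Sum>q\<in>?P. signof q * (\<Prod>i<n. m (p i + q i)))"
      unfolding det_def'[OF mat_carrier]
    proof (intro sum.cong refl arg_cong2[where f="(*)"] prod.cong)
      fix q i assume q: "q \<in> ?P" and i: "i \<in> {..<n}"
      have "p i < n" "q i < n" using img p q i by simp_all
      then show "mat n n (\<lambda>(i, j). ?A $$ (p i, j)) $$ (i, q i) = m (p i + q i)" using i by simp
    qed (simp add: atLeast0LessThan)
    finally have "(\<Sum>q\<in>?P. (signof p * signof q) * (\<Prod>i<n. m (p i + q i))) = signof p * (signof p * Determinant.det ?A)"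
      by (simp add: sum_distrib_left mult.assoc)
    also have "\<dots> = Determinant.det ?A"
      by (simp add: sign_def)
    finally show "(\<Sum>q\<in>?P. (signof p * signof q) * (\<Prod>i<n. m (p i + q i))) = Determinant.det ?A" .
  qed
  also have "\<dots> = fact n * Determinant.det ?A"
    using card_permutations[of "{0..<n}" n] by simp
  finally show ?thesis .
qed

text \<open>In the Leibniz formula every permutation collects each row factor and each column factor
  exactly once.\<close>

lemma det_scale:
  fixes a b :: "nat \<Rightarrow> real"
  shows "Determinant.det (mat n n (\<lambda>(i, j). a i * b j * g i j))
    = (\<Prod>i<n. a i) * (\<Prod>j<n. b j) * Determinant.det (mat n n (\<lambda>(i, j). g i j))"
proof -
  have "(\<Prod>i = 0..<n. mat n n (\<lambda>(i, j). a i * b j * g i j) $$ (i, p i))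
      = (\<Prod>i<n. a i) * (\<Prod>j<n. b j) * (\<Prod>i = 0..<n. mat n n (\<lambda>(i, j). g i j) $$ (i, p i))"
    if p: "p permutes {0..<n}" for p
  proof -
    have img: "p i < n" if "i < n" for i
      using permutes_in_image[OF p, of i] that by simp
    have "(\<Prod>i = 0..<n. mat n n (\<lambda>(i, j). a i * b j * g i j) $$ (i, p i)) = (\<Prod>i = 0..<n. a i * b (p i) * g i (p i))"
      using img by (intro prod.cong) auto
    also have "\<dots> = (\<Prod>i = 0..<n. a i) * (\<Prod>i = 0..<n. b (p i)) * (\<Prod>i = 0..<n. g i (p i))"
      by (simp add: prod.distrib)
    also have "(\<Prod>i = 0..<n. b (p i)) = (\<Prod>i = 0..<n. b i)"
      using prod.permute[OF p, of b] by (simp add: comp_def)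
    also have "(\<Prod>i = 0..<n. g i (p i)) = (\<Prod>i = 0..<n. mat n n (\<lambda>(i, j). g i j) $$ (i, p i))"
      using img by (intro prod.cong) auto
    finally show ?thesis by (simp only: atLeast0LessThan)
  qed
  then show ?thesis
    unfolding det_def'[OF mat_carrier] sum_distrib_left by (intro sum.cong refl) (simp add: mult_ac)
qed

text \<open>Listing the even indices before the odd ones permutes rows and columns alike, so the
  sign cancels. There are (n + 1) div 2 even and n div 2 odd indices below n, which is the origin of
  the ceiling and the floor in the final formula.\<close>

lemma det_hankel_even_odd:
  fixes m :: "nat \<Rightarrow> real"
  assumes odd: "\<And>k. odd k \<Longrightarrow> m k = 0"
  shows "Determinant.det (mat n n (\<lambda>(i, j). m (i + j)))
    = Determinant.det (mat ((n + 1) div 2) ((n + 1) div 2) (\<lambda>(i, j). m (2 * (i + j))))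
    * Determinant.det (mat (n div 2) (n div 2) (\<lambda>(i, j). m (2 * (i + j + 1))))"
proof -
  define a where "a = (n + 1) div 2"
  define b where "b = n div 2"
  have ab: "a + b = n" "a \<le> b + 1" "b \<le> a" unfolding a_def b_def by presburger+
  \<comment> \<open>The last branch fixes the indices outside the matrix, as \<open>permutes\<close>
    demands.\<close>
  define \<pi> where "\<pi> i = (if i < a then 2 * i else if i < n then 2 * (i - a) + 1 else i)" for i
  have img: "\<pi> i < n" if "i < n" for i
    using that ab by (auto simp: \<pi>_def)
  have "inj_on \<pi> {0..<n}"
  proof (rule inj_onI)
    fix i j assume ij: "i \<in> {0..<n}" "j \<in> {0..<n}" "\<pi> i = \<pi> j"
    show "i = j"
    proof (cases "i < a"; cases "j < a")
      assume "i < a" "\<not> j < a"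
      then have "2 * i = 2 * (j - a) + 1" using ij by (simp add: \<pi>_def)
      then show ?thesis by presburger
    next
      assume "\<not> i < a" "j < a"
      then have "2 * j = 2 * (i - a) + 1" using ij by (simp add: \<pi>_def)
      then show ?thesis by presburger
    qed (use ij in \<open>simp_all add: \<pi>_def\<close>)
  qed
  moreover have "\<pi> ` {0..<n} \<subseteq> {0..<n}" using img by auto
  ultimately have "bij_betw \<pi> {0..<n} {0..<n}"
    unfolding bij_betw_def using endo_inj_surj[of "{0..<n}" \<pi>] by simp
  then have p: "\<pi> permutes {0..<n}"
    by (rule bij_imp_permutes) (use ab in \<open>auto simp: \<pi>_def\<close>)
  let ?H = "mat n n (\<lambda>(i, j). m (i + j))"
  let ?H1 = "mat n n (\<lambda>(i, j). ?H $$ (\<pi> i, j))"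
  \<comment> \<open>Rows are permuted twice with a transposition in between, which permutes the
    columns as well.\<close>
  let ?H2 = "mat n n (\<lambda>(i, j). ?H1\<^sup>T $$ (\<pi> i, j))"
  have d1: "Determinant.det ?H1 = signof \<pi> * Determinant.det ?H"
    by (rule det_permute_rows[OF _ p]) simp
  have "Determinant.det ?H2 = signof \<pi> * Determinant.det (?H1\<^sup>T)"
    by (rule det_permute_rows[OF _ p]) simp
  also have "Determinant.det (?H1\<^sup>T) = Determinant.det ?H1"
    by (rule det_transpose[of _ n]) simp
  finally have "Determinant.det ?H2 = Determinant.det ?H"
    unfolding d1 by (simp add: sign_def)
  moreover have "?H2 = four_block_mat (mat a a (\<lambda>(i, j). m (2 * (i + j)))) (0\<^sub>m a b) (0\<^sub>m b a)
      (mat b b (\<lambda>(i, j). m (2 * (i + j + 1))))" (is "_ = ?B")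
  proof (rule eq_matI)
    fix i j assume "i < dim_row ?B" "j < dim_col ?B"
    then have ij: "i < n" "j < n" using ab by simp_all
    have H2: "?H2 $$ (i, j) = m (\<pi> j + \<pi> i)" using ij img by simp
    show "?H2 $$ (i, j) = ?B $$ (i, j)"
    proof (cases "i < a"; cases "j < a")
      assume "i < a" "j < a"
      then show ?thesis unfolding H2 using ij ab by (simp add: \<pi>_def distrib_left add.commute)
    next
      assume "i < a" "\<not> j < a"
      then show ?thesis unfolding H2 using ij ab by (simp add: \<pi>_def odd)
    next
      assume "\<not> i < a" "j < a"
      then show ?thesis unfolding H2 using ij ab by (simp add: \<pi>_def odd)
    next
      assume c: "\<not> i < a" "\<not> j < a"
      then obtain i' j' where i': "i = a + i'" "j = a + j'"
        by (metis not_less nat_le_iff_add)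
      have "\<pi> j + \<pi> i = 2 * (i' + j' + 1)" using ij by (simp add: \<pi>_def i')
      moreover have "?B $$ (i, j) = m (2 * (i' + j' + 1))" using ij ab by (simp add: i')
      ultimately show ?thesis by (simp only: H2)
    qed
  qed (use ab in simp_all)
  ultimately have "Determinant.det ?H = Determinant.det ?B" by simp
  also have "\<dots> = Determinant.det (mat a a (\<lambda>(i, j). m (2 * (i + j)))) * Determinant.det (mat b b (\<lambda>(i, j). m (2 * (i + j + 1))))"
    by (rule det_four_block_mat_lower_left_zero[of _ a _ b]) simp_all
  finally show ?thesis by (simp only: a_def b_def)
qed

text \<open>The substitution y = x^2 / 2 is carried out on bounded intervals from s to s + k + 1,
  where it is increasing because s is nonnegative; monotone convergence extends it to the
  ray.\<close>

lemma nn_integral_half_square: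
  assumes s: "s \<ge> 0" and f [measurable]: "f \<in> borel_measurable borel"
  shows "(\<integral>\<^sup>+ y. f y * indicator {s\<^sup>2 / 2..} y \<partial>lborel) = (\<integral>\<^sup>+ x. f (x\<^sup>2 / 2) * ennreal x * indicator {s..} x \<partial>lborel)"
proof -
  let ?b = "\<lambda>k::nat. s + real (Suc k)"
  have step: "(\<integral>\<^sup>+ y. f y * indicator {s\<^sup>2 / 2..(?b k)\<^sup>2 / 2} y \<partial>lborel)
      = (\<integral>\<^sup>+ x. f (x\<^sup>2 / 2) * ennreal x * indicator {s..?b k} x \<partial>lborel)" for k
    using s by (intro nn_integral_substitution_aux f) (auto intro!: derivative_eq_intros continuous_intros)
  have mono: "(?b k)\<^sup>2 / 2 \<le> (?b l)\<^sup>2 / 2" "?b k \<le> ?b l" if "k \<le> l" for k l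
    using that s by (simp_all add: power_mono)
  have SUP1: "f y * indicator {s\<^sup>2 / 2..} y = (SUP k. f y * indicator {s\<^sup>2 / 2..(?b k)\<^sup>2 / 2} y)" for y
  proof (rule antisym)
    \<comment> \<open>The bound makes b = ?b k at least 1 and at least 2 y, so 2 y \<le> b \<le>
      b^2.\<close>
    obtain k :: nat where k: "2 * \<bar>y\<bar> + 1 \<le> real k" using real_arch_simple by blast
    have b: "2 * y \<le> ?b k" "1 \<le> ?b k" using k s by (simp_all add: abs_le_iff)
    from b(2) have "?b k * 1 \<le> ?b k * ?b k" by (intro mult_left_mono) linarith+
    then have "2 * y \<le> ?b k * ?b k" unfolding mult_1_right by (rule order_trans[OF b(1)])
    then have "y \<le> (?b k)\<^sup>2 / 2" by (simp add: power2_eq_square)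
    then have "f y * indicator {s\<^sup>2 / 2..} y = f y * indicator {s\<^sup>2 / 2..(?b k)\<^sup>2 / 2} y"
      by (simp add: indicator_def)
    also have "\<dots> \<le> (SUP k. f y * indicator {s\<^sup>2 / 2..(?b k)\<^sup>2 / 2} y)"
      by (rule SUP_upper) simp
    finally show "f y * indicator {s\<^sup>2 / 2..} y \<le> (SUP k. f y * indicator {s\<^sup>2 / 2..(?b k)\<^sup>2 / 2} y)" .
  qed (rule SUP_least, simp add: indicator_def)
  have SUP2: "f (x\<^sup>2 / 2) * ennreal x * indicator {s..} x = (SUP k. f (x\<^sup>2 / 2) * ennreal x * indicator {s..?b k} x)" for x
  proof (rule antisym)
    obtain k :: nat where "x \<le> real k" using real_arch_simple by blast
    then have "x \<le> ?b k" using s by simp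
    then have "f (x\<^sup>2 / 2) * ennreal x * indicator {s..} x = f (x\<^sup>2 / 2) * ennreal x * indicator {s..?b k} x"
      by (simp add: indicator_def)
    also have "\<dots> \<le> (SUP k. f (x\<^sup>2 / 2) * ennreal x * indicator {s..?b k} x)"
      by (rule SUP_upper) simp
    finally show "f (x\<^sup>2 / 2) * ennreal x * indicator {s..} x \<le> (SUP k. f (x\<^sup>2 / 2) * ennreal x * indicator {s..?b k} x)" .
  qed (rule SUP_least, simp add: indicator_def)
  have inc: "incseq (\<lambda>k y. f y * indicator {s\<^sup>2 / 2..(?b k)\<^sup>2 / 2} y)"
    "incseq (\<lambda>k x. f (x\<^sup>2 / 2) * ennreal x * indicator {s..?b k} x)"
    unfolding incseq_def le_fun_def
    using mono by (auto intro!: mult_left_mono simp: indicator_def intro: order_trans)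
  have meas: "(\<lambda>y. f y * indicator {c..d} y) \<in> borel_measurable borel"
    "(\<lambda>x. f (x\<^sup>2 / 2) * ennreal x * indicator {c..d} x) \<in> borel_measurable borel" for c d :: real
    by measurable
  have "(\<integral>\<^sup>+ y. f y * indicator {s\<^sup>2 / 2..} y \<partial>lborel)
      = (SUP k. \<integral>\<^sup>+ y. f y * indicator {s\<^sup>2 / 2..(?b k)\<^sup>2 / 2} y \<partial>lborel)"
    unfolding SUP1 by (rule nn_integral_monotone_convergence_SUP[OF inc(1)]) (subst measurable_cong_sets[OF sets_lborel refl], rule meas)
  also have "\<dots> = (\<integral>\<^sup>+ x. f (x\<^sup>2 / 2) * ennreal x * indicator {s..} x \<partial>lborel)"
    unfolding step SUP2 by (rule nn_integral_monotone_convergence_SUP[OF inc(2), symmetric]) (subst measurable_cong_sets[OF sets_lborel refl], rule meas)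
  finally show ?thesis .
qed

section \<open>Moments of the truncated Gaussian weight\<close>

definition tail_weight :: "real \<Rightarrow> real \<Rightarrow> real" where
  "tail_weight s t = indicator {t. s \<le> \<bar>t\<bar>} t * exp (- t\<^sup>2 / 2)"

definition tail_moment :: "real \<Rightarrow> nat \<Rightarrow> real" where
  "tail_moment s k = (\<integral>t. t ^ k * tail_weight s t \<partial>lborel)"

lemma measurable_tail_weight [measurable]: "tail_weight s \<in> borel_measurable borel"
proof -
  have "{t :: real. s \<le> \<bar>t\<bar>} \<in> sets borel" by measurable
  then show ?thesis unfolding tail_weight_def by measurable
qed

lemma integrable_tail_weight: "integrable lborel (\<lambda>t. t ^ k * tail_weight s t)"
proof -
  have "integrable lborel (\<lambda>t. indicator {t. s \<le> \<bar>t\<bar>} t *\<^sub>R (sqrt (2 * pi) * (std_normal_density t * t ^ k)))"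
    by (intro integrable_mult_indicator integrable_mult_right integrable_std_normal_moment) measurable
  then show ?thesis
    by (rule Bochner_Integration.integrable_cong[THEN iffD1, rotated -1])
      (simp_all add: tail_weight_def std_normal_density_def)
qed

lemma tail_moment_odd: "odd k \<Longrightarrow> tail_moment s k = 0"
proof -
  assume k: "odd k"
  have "tail_moment s k = (\<integral>t. (0 + - 1 * t) ^ k * tail_weight s (0 + - 1 * t) \<partial>lborel)"
    unfolding tail_moment_def
    using lborel_integral_real_affine[of "-1" "\<lambda>t. t ^ k * tail_weight s t" 0] by simp
  also have "\<dots> = (\<integral>t. - (t ^ k * tail_weight s t) \<partial>lborel)"
    using k by (intro Bochner_Integration.integral_cong) (simp_all add: tail_weight_def indicator_def)
  also have "\<dots> = - tail_moment s k" by (simp add: tail_moment_def)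
  finally show ?thesis by simp
qed

text \<open>The two half-lines contribute equally. With y = x^2 / 2 the power x^(2k) equals 2^(k -
  1/2) y^(k - 1/2) x, and x is the derivative of y; the factor 2 for the half-lines raises the
  exponent of two to k + 1/2.\<close>

lemma tail_moment_even:
  assumes s: "s \<ge> 0"
  shows "tail_moment s (2 * k) = 2 powr (real k + 1 / 2) * upper_Gamma (real k + 1 / 2) (s\<^sup>2 / 2)"
proof -
  define h where "h x = ennreal (x ^ (2 * k) * exp (- x\<^sup>2 / 2)) * indicator {s..} x" for x :: real
  have h [measurable]: "h \<in> borel_measurable borel" unfolding h_def by measurable
  define I where "I = (\<integral>\<^sup>+ x. h x \<partial>lborel)"
  have "tail_moment s (2 * k) = enn2real (\<integral>\<^sup>+ t. ennreal (t ^ (2 * k) * tail_weight s t) \<partial>lborel)"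
    unfolding tail_moment_def by (rule integral_eq_nn_integral) (auto simp: tail_weight_def)
  \<comment> \<open>For s = 0 the point t = 0 lies in both half-lines, so it is left out as a null
    set.\<close>
  also have "(\<integral>\<^sup>+ t. ennreal (t ^ (2 * k) * tail_weight s t) \<partial>lborel) = (\<integral>\<^sup>+ t. h t + h (- t) \<partial>lborel)"
  proof (rule nn_integral_cong_AE, rule eventually_mono[OF AE_lborel_singleton[of 0]])
    fix t :: real assume "t \<noteq> 0"
    then show "ennreal (t ^ (2 * k) * tail_weight s t) = h t + h (- t)"
      using s by (cases "t > 0") (auto simp: h_def tail_weight_def indicator_def)
  qed
  also have "\<dots> = I + I"
    using nn_integral_lborel_reflect[OF h] by (subst nn_integral_add) (simp_all add: I_def)
  finally have m: "tail_moment s (2 * k) = enn2real (2 * I)" by (simp add: mult_2)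
  define g where "g y = ennreal (y powr (real k - 1 / 2) * exp (- y))" for y :: real
  have g [measurable]: "g \<in> borel_measurable borel" unfolding g_def by measurable
  have "upper_Gamma (real k + 1 / 2) (s\<^sup>2 / 2)
      = enn2real (\<integral>\<^sup>+ y. ennreal (indicator {s\<^sup>2 / 2..} y * (y powr (real k - 1 / 2) * exp (- y))) \<partial>lborel)"
    unfolding upper_Gamma_def set_lebesgue_integral_def real_scaleR_def
    by (subst integral_eq_nn_integral) (auto simp: algebra_simps)
  also have "(\<integral>\<^sup>+ y. ennreal (indicator {s\<^sup>2 / 2..} y * (y powr (real k - 1 / 2) * exp (- y))) \<partial>lborel)
      = (\<integral>\<^sup>+ y. g y * indicator {s\<^sup>2 / 2..} y \<partial>lborel)"
    by (intro nn_integral_cong) (simp add: g_def indicator_def)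
  also have "\<dots> = (\<integral>\<^sup>+ x. g (x\<^sup>2 / 2) * ennreal x * indicator {s..} x \<partial>lborel)"
    by (rule nn_integral_half_square[OF s g])
  also have "\<dots> = (\<integral>\<^sup>+ x. ennreal (2 powr (1 / 2 - real k)) * h x \<partial>lborel)"
  \<comment> \<open>For s = 0 and k = 0 the sides differ at x = 0: the left one has the factor x,
    while h 0 = 1.\<close>
  proof (rule nn_integral_cong_AE, rule eventually_mono[OF AE_lborel_singleton[of 0]])
    fix x :: real assume "x \<noteq> 0"
    show "g (x\<^sup>2 / 2) * ennreal x * indicator {s..} x = ennreal (2 powr (1 / 2 - real k)) * h x"
    proof (cases "s \<le> x")
      case True
      then have x: "x > 0" using s \<open>x \<noteq> 0\<close> by simp
      have "(x\<^sup>2 / 2) powr (real k - 1 / 2) * x = 2 powr (1 / 2 - real k) * x ^ (2 * k)"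
      proof -
        have "(x\<^sup>2 / 2) powr (real k - 1 / 2) = (x powr 2) powr (real k - 1 / 2) / 2 powr (real k - 1 / 2)"
          using x by (subst powr_divide) simp_all
        also have "(x powr 2) powr (real k - 1 / 2) = x powr (real (2 * k) - 1)"
          unfolding powr_powr by (simp add: algebra_simps)
        also have "x powr (real (2 * k) - 1) = x ^ (2 * k) / x"
          using x by (simp add: powr_diff powr_realpow del: of_nat_mult)
        also have "2 powr (real k - 1 / 2) = inverse (2 powr (1 / 2 - real k) :: real)"
          by (simp add: powr_minus[symmetric])
        finally show ?thesis using x by (simp add: field_simps)
      qed
      then have "(x\<^sup>2 / 2) powr (real k - 1 / 2) * exp (- (x\<^sup>2 / 2)) * x
          = 2 powr (1 / 2 - real k) * (x ^ (2 * k) * exp (- x\<^sup>2 / 2))"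
        by (simp add: mult_ac)
      then have "g (x\<^sup>2 / 2) * ennreal x = ennreal (2 powr (1 / 2 - real k)) * ennreal (x ^ (2 * k) * exp (- x\<^sup>2 / 2))"
        unfolding g_def using x by (simp only: ennreal_mult'[symmetric] powr_ge_zero mult_nonneg_nonneg exp_ge_zero)
      then show ?thesis using True by (simp add: h_def)
    qed (simp add: h_def)
  qed
  also have "\<dots> = ennreal (2 powr (1 / 2 - real k)) * I"
    unfolding I_def using h by (intro nn_integral_cmult) simp
  finally have G: "upper_Gamma (real k + 1 / 2) (s\<^sup>2 / 2) = 2 powr (1 / 2 - real k) * enn2real I"
    by (simp add: enn2real_mult)
  have "2 powr (real k + 1 / 2) * 2 powr (1 / 2 - real k) = (2::real)"
    unfolding powr_add[symmetric] by simp
  then show ?thesis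
    unfolding m G by (simp add: enn2real_mult flip: mult.assoc)
qed

text \<open>The power 2^(i + j) in an entry is a row factor 2^i times a column factor 2^j, so it
  leaves the determinant as a factor that does not depend on s. The parameters -1/2 and 1/2 reflect
  the moments of order 2 (i + j) in the even block and 2 (i + j + 1) in the odd block.\<close>

lemma det_tail_moment:
  "\<exists>\<kappa>. \<kappa> \<noteq> 0 \<and> (\<forall>s\<ge>0. Determinant.det (mat n n (\<lambda>(i, j). tail_moment s (i + j)))
    = \<kappa> * (F (- 1 / 2) ((n + 1) div 2) (s\<^sup>2 / 2) * F (1 / 2) (n div 2) (s\<^sup>2 / 2)))"
proof -
  \<comment> \<open>Row factors times column factors. The remaining power c is 2^(1/2) in the even
    block and 2^(3/2) in the odd block, whose index is shifted by one.\<close>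
  define A where "A c k = (\<Prod>i<k. c * 2 ^ i) * (\<Prod>j<k. 2 ^ j :: real)" for c :: real and k :: nat
  let ?a = "(n + 1) div 2" and ?b = "n div 2"
  have even: "Determinant.det (mat k k (\<lambda>(i, j). tail_moment s (2 * (i + j)))) = A (2 powr (1 / 2)) k * F (- 1 / 2) k (s\<^sup>2 / 2)"
    if "s \<ge> 0" for s k
  proof -
    have "tail_moment s (2 * (i + j)) = (2 powr (1 / 2) * 2 ^ i) * 2 ^ j * upper_Gamma (real (Suc i) + real (Suc j) - 1 + - 1 / 2) (s\<^sup>2 / 2)" for i j
      unfolding tail_moment_even[OF that] by (simp add: powr_add powr_realpow[symmetric] algebra_simps)
    then show ?thesis
      unfolding F_def A_def by (simp only: det_scale)
  qed
  have odd: "Determinant.det (mat k k (\<lambda>(i, j). tail_moment s (2 * (i + j + 1)))) = A (2 powr (3 / 2)) k * F (1 / 2) k (s\<^sup>2 / 2)"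
    if "s \<ge> 0" for s k
  proof -
    have "tail_moment s (2 * (i + j + 1)) = (2 powr (3 / 2) * 2 ^ i) * 2 ^ j * upper_Gamma (real (Suc i) + real (Suc j) - 1 + 1 / 2) (s\<^sup>2 / 2)" for i j
    proof -
      have "2 powr (real (i + j + 1) + 1 / 2) = 2 powr (3 / 2) * 2 powr real i * 2 powr (real j) * (1::real)"
        unfolding powr_add[symmetric] mult_1_right by (rule arg_cong[where f="\<lambda>x. 2 powr x"]) simp
      moreover have "real (i + j + 1) + 1 / 2 = real (Suc i) + real (Suc j) - 1 + 1 / 2" by simp
      ultimately show ?thesis
        unfolding tail_moment_even[OF that] by (simp add: powr_realpow)
    qed
    then show ?thesis
      unfolding F_def A_def by (simp only: det_scale)
  qed
  show ?thesis
  proof (intro exI[of _ "A (2 powr (1 / 2)) ?a * A (2 powr (3 / 2)) ?b"] conjI allI impI)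
    show "A (2 powr (1 / 2)) ?a * A (2 powr (3 / 2)) ?b \<noteq> 0" by (simp add: A_def)
    fix s :: real assume "s \<ge> 0"
    show "Determinant.det (mat n n (\<lambda>(i, j). tail_moment s (i + j)))
      = A (2 powr (1 / 2)) ?a * A (2 powr (3 / 2)) ?b * (F (- 1 / 2) ?a (s\<^sup>2 / 2) * F (1 / 2) ?b (s\<^sup>2 / 2))"
      by (rule trans[OF det_hankel_even_odd[OF tail_moment_odd]], assumption)
        (unfold even[OF \<open>s \<ge> 0\<close>] odd[OF \<open>s \<ge> 0\<close>], simp only: mult_ac)
  qed
qed

text \<open>Up to a constant the probability is the Hankel determinant of the truncated moments. At
  s = 0 the event is the whole space, so the constant is the inverse of the value there, and n! and
  \<open>\<kappa>\<close> cancel in the quotient.\<close>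

lemma GUE_sigma_min:
  assumes n: "n \<ge> 1" and s: "s \<ge> 0"
  shows "measure (GUE n) {A \<in> carrier_mat n n. s \<le> sigma_min A} =
      F (- 1 / 2) ((n + 1) div 2) (s\<^sup>2 / 2) / F (- 1 / 2) ((n + 1) div 2) 0 *
      (F (1 / 2) (n div 2) (s\<^sup>2 / 2) / F (1 / 2) (n div 2) 0)"
proof -
  let ?S = "\<lambda>s. {A \<in> carrier_mat n n. s \<le> sigma_min A}"
  obtain C where C: "\<And>s. emeasure (GUE n) (?S s)
    = C * (\<integral>\<^sup>+ y. ennreal ((\<Prod>i<n. indicator {t. s \<le> \<bar>t\<bar>} (y i) * exp (- (y i)\<^sup>2 / 2)) * (vandermonde n y)\<^sup>2) \<partial>lebn n)"
    using GUE_sigma_min_integral[OF n] by blast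
  define x where "x s = fact n * Determinant.det (mat n n (\<lambda>(i, j). tail_moment s (i + j)))" for s
  have hbi: "has_bochner_integral (lebn n) (\<lambda>y. (\<Prod>i<n. tail_weight s (y i)) * (vandermonde n y)\<^sup>2) (x s)" for s
    using andreief[OF integrable_tail_weight, of n s] by (simp add: x_def tail_moment_def)
  have nonneg: "0 \<le> (\<Prod>i<n. tail_weight s (y i)) * (vandermonde n y)\<^sup>2" for s y
    by (intro mult_nonneg_nonneg prod_nonneg) (auto simp: tail_weight_def)
  have x0: "x s \<ge> 0" for s
    unfolding has_bochner_integral_integral_eq[OF hbi, symmetric]
    by (rule Bochner_Integration.integral_nonneg) (rule nonneg)
  have em: "emeasure (GUE n) (?S s) = C * ennreal (x s)" for s
  proof -
    have "(\<integral>\<^sup>+ y. ennreal ((\<Prod>i<n. tail_weight s (y i)) * (vandermonde n y)\<^sup>2) \<partial>lebn n) = ennreal (x s)"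
      using hbi[of s] nonneg[of s] by (subst nn_integral_eq_integral) (auto simp: has_bochner_integral_iff)
    then show ?thesis unfolding C tail_weight_def by (simp only:)
  qed
  interpret P: prob_space "GUE n" by (rule prob_space_GUE)
  have "?S 0 = space (GUE n)"
  proof -
    have "0 \<le> sigma_min A" if "A \<in> carrier_mat n n" for A
      unfolding sigma_min_ge_iff[OF that n] by (simp add: singular_values_def)
    then show ?thesis by (auto simp: GUE_def)
  qed
  then have one: "C * ennreal (x 0) = 1"
    using em[of 0] P.emeasure_space_1 by simp
  \<comment> \<open>Total mass 1 rules out that the determinant at s = 0 vanishes, which makes the
    division legitimate.\<close>
  then have pos: "x 0 > 0" using x0[of 0] by (cases "x 0 = 0") auto
  have "C = C * (ennreal (x 0) * ennreal (inverse (x 0)))"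
    using pos by (simp add: ennreal_mult_inverse)
  also have "\<dots> = ennreal (inverse (x 0))"
    using one by (simp flip: mult.assoc)
  finally have "emeasure (GUE n) (?S s) = ennreal (inverse (x 0) * x s)"
    unfolding em using pos by (simp add: ennreal_mult')
  then have "measure (GUE n) (?S s) = x s / x 0"
    unfolding measure_def using pos x0[of s] by (simp add: divide_inverse mult.commute)
  moreover obtain \<kappa> where "\<kappa> \<noteq> 0" and \<kappa>: "\<And>s. s \<ge> 0 \<Longrightarrow> Determinant.det (mat n n (\<lambda>(i, j). tail_moment s (i + j)))
    = \<kappa> * (F (- 1 / 2) ((n + 1) div 2) (s\<^sup>2 / 2) * F (1 / 2) (n div 2) (s\<^sup>2 / 2))"
    using det_tail_moment[of n] by blast
  ultimately show ?thesis
    unfolding x_def \<kappa>[OF s] \<kappa>[OF order_refl] by simp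
qed

theorem mainTheorem6:
  fixes n :: nat and s :: real and M :: "'w measure" and H :: "'w \<Rightarrow> complex mat"
  assumes "n \<ge> 1"
    and "prob_space M"
    and "H \<in> M \<rightarrow>\<^sub>M mat_borel n"
    and "distr M (mat_borel n) H = GUE n"
    and "s \<ge> 0"
  shows "measure M {\<omega> \<in> space M. sigma_min (H \<omega>) \<ge> s} =
      F (- 1 / 2) (nat \<lceil>real n / 2\<rceil>) (s\<^sup>2 / 2) / F (- 1 / 2) (nat \<lceil>real n / 2\<rceil>) 0 *
      (F (1 / 2) (nat \<lfloor>real n / 2\<rfloor>) (s\<^sup>2 / 2) / F (1 / 2) (nat \<lfloor>real n / 2\<rfloor>) 0)"
proof -
  have "{\<omega> \<in> space M. sigma_min (H \<omega>) \<ge> s} = H -` {A \<in> carrier_mat n n. s \<le> sigma_min A} \<inter> space M"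
    using measurable_space[OF assms(3)] by auto
  then have "measure M {\<omega> \<in> space M. sigma_min (H \<omega>) \<ge> s}
      = measure (GUE n) {A \<in> carrier_mat n n. s \<le> sigma_min A}"
    unfolding assms(4)[symmetric] by (simp only: measure_distr[OF assms(3) sets_sigma_min_ge[OF assms(1)]])
  moreover have "nat \<lceil>real n / 2\<rceil> = (n + 1) div 2"
    by (cases "even n") (auto elim!: evenE oddE simp: ceiling_eq_iff nat_eq_iff)
  moreover have "nat \<lfloor>real n / 2\<rfloor> = n div 2"
    by (simp add: floor_divide_of_nat_eq[of n 2, simplified])
  ultimately show ?thesis
    by (simp only: GUE_sigma_min[OF assms(1,5)])
qed

end
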